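(* Let $\mu>0$ and assume that $|\{y^\dag=t_i\}|$ is sufficiently small for all $1\le i\le k$. Then there exists a $\rho>0$ such that $$\|F(\hat u)-F(u)-G_u(\hat u-u)\|_{L^2(\Omega)}\le\mu\,\|F(\hat u)-F(u)\|_{L^2(\Omega)}$$ holds for all $u,\hat u\in\overline B_{L^2(\Omega)}(u^\dag,\rho)$.
   Context: $\Omega\subset\mathbb R^d$, $d\le3$, is a bounded domain with Lipschitz boundary; $|S|$ denotes the $d$-dimensional Lebesgue measure of a measurable set $S$; $\mathbf 1_S$ is the characteristic function of $S$; $\overline B_{L^2(\Omega)}(u,\rho)$ is the closed ball in $L^2(\Omega)$ of radius $\rho$ centered at $u$. $A$ is an elliptic second-order partial differential operator with bounded and measurable coefficients satisfying $c_0\|y\|_{H^1_0(\Omega)}^2\le\langle Ay,y\rangle\le c_1\|y\|_{H^1_0(\Omega)}^2$ for all $y\in H^1_0(\Omega)$, for some $c_1\ge c_0>0$, where $\langle\cdot,\cdot\rangle$ is the pairing between $H^1_0(\Omega)$ and $H^{-1}(\Omega)$. $f:\mathbb R\to\mathbb R$ is a $PC^1$-function, i.e., $f$ is continuous and for each point $x_0$ there are a neighborhood $W$ of $x_0$ and finitely many $C^1$-functions on $W$ such that for every $x\in W$ the value $f(x)$ equals the value at $x$ of one of these functions. The set of points at which $f$ is not differentiable is assumed to consist of finitely many points $t_1<\dots<t_k$. With $t_0:=-\infty$, $t_{k+1}:=\infty$ and the convention $(t_k,t_{k+1}]:=(t_k,\infty)$, $f$ is represented as $f(t)=\sum_{i=1}^{k+1}\mathbf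 1_{(t_{i-1},t_i]}(t)f_i(t)$ for all $t\in\mathbb R$, where the $f_i$ are $C^1$-functions on $\mathbb R$, each $f_i$ is non-decreasing on $(t_{i-1},t_i)$ for $1\le i\le k+1$, and $f_i(t_i)=f_{i+1}(t_i)$ for all $1\le i\le k$. $F:L^2(\Omega)\to H^1_0(\Omega)\cap C(\overline\Omega)\hookrightarrow L^2(\Omega)$, $u\mapsto y_u$, is the solution operator of the equation $Ay+f(y)=u$ in $\Omega$, $y=0$ on $\partial\Omega$ (understood in the weak sense; it has a unique solution for each $u\in L^2(\Omega)$). For each $u\in L^2(\Omega)$, $G_u:L^2(\Omega)\to H^1_0(\Omega)\cap C(\overline\Omega)\hookrightarrow L^2(\Omega)$, $w\mapsto\eta$, is the solution operator of the linear equation $A\eta+a_u\eta=w$ in $\Omega$, $\eta=0$ on $\partial\Omega$, where $a_u(x):=\sum_{i=1}^{k+1}\mathbf 1_{(t_{i-1},t_i]}(y_u(x))\,f_i'(y_u(x))$ for $x\in\Omega$ and $y_u:=F(u)$. $u^\dag\in L^2(\Omega)$ is a fixed element (the exact solution) and $y^\dag:=F(u^\dag)$ is the corresponding exact data; $\{y^\dag=t_i\}$ is the set of $x\in\Omega$ with $y^\dag(x)=t_i$. *)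

theory Defs
  imports "HOL-Analysis.Analysis"
begin

text \<open>Elements of \<open>L\<^sup>2(\<Omega>)\<close> are represented by functions on the whole space of which only the
  values on \<open>\<Omega>\<close> matter; functions that agree almost everywhere in \<open>\<Omega>\<close> are not identified.
  All norms below are insensitive to the choice of representative.\<close>

definition L2 :: "(real^'n) set \<Rightarrow> (real^'n \<Rightarrow> 'b::euclidean_space) set" where
  "L2 \<Omega> = {u \<in> borel_measurable (lebesgue_on \<Omega>). integrable (lebesgue_on \<Omega>) (\<lambda>x. (norm (u x))\<^sup>2)}"

definition norm_L2 :: "(real^'n) set \<Rightarrow> (real^'n \<Rightarrow> 'b::euclidean_space) \<Rightarrow> real" where
  "norm_L2 \<Omega> u = sqrt (\<integral>x. (norm (u x))\<^sup>2 \<partial>lebesgue_on \<Omega>)"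

definition cball_L2 :: "(real^'n) set \<Rightarrow> (real^'n \<Rightarrow> real) \<Rightarrow> real \<Rightarrow> (real^'n \<Rightarrow> real) set" where
  "cball_L2 \<Omega> u \<rho> = {v \<in> L2 \<Omega>. norm_L2 \<Omega> (\<lambda>x. v x - u x) \<le> \<rho>}"


text \<open>Near each boundary point, \<open>\<Omega>\<close> is the strict epigraph, in some unit direction \<open>e\<close>, of a Lipschitz
  function on the hyperplane orthogonal to \<open>e\<close>.\<close>

definition lipschitz_boundary :: "(real^'n) set \<Rightarrow> bool" where
  "lipschitz_boundary \<Omega> \<longleftrightarrow> (\<forall>p \<in> frontier \<Omega>. \<exists>r>0. \<exists>e L. \<exists>\<gamma>::real^'n \<Rightarrow> real.
     norm e = 1 \<and> lipschitz_on L {z. z \<bullet> e = 0} \<gamma> \<and>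
     \<Omega> \<inter> ball p r = {x \<in> ball p r. \<gamma> (x - (x \<bullet> e) *\<^sub>R e) < x \<bullet> e})"

definition bounded_lipschitz_domain :: "(real^'n) set \<Rightarrow> bool" where
  "bounded_lipschitz_domain \<Omega> \<longleftrightarrow>
     open \<Omega> \<and> connected \<Omega> \<and> \<Omega> \<noteq> {} \<and> bounded \<Omega> \<and> lipschitz_boundary \<Omega>"


definition partial_deriv :: "'n \<Rightarrow> (real^'n \<Rightarrow> real) \<Rightarrow> real^'n \<Rightarrow> real" where
  "partial_deriv i \<phi> x = frechet_derivative \<phi> (at x) (axis i 1)"

primrec Ck :: "nat \<Rightarrow> (real^'n \<Rightarrow> real) \<Rightarrow> bool" where
  "Ck 0 \<phi> \<longleftrightarrow> continuous_on UNIV \<phi>"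
| "Ck (Suc k) \<phi> \<longleftrightarrow> (\<forall>x. \<phi> differentiable (at x)) \<and> (\<forall>i. Ck k (partial_deriv i \<phi>))"

text \<open>\<open>C\<^sub>c\<^sup>\<infinity>(\<Omega>)\<close>, each function being extended by zero to the whole space.\<close>

definition test_functions :: "(real^'n) set \<Rightarrow> (real^'n \<Rightarrow> real) set" where
  "test_functions \<Omega> =
     {\<phi>. (\<forall>k. Ck k \<phi>) \<and> compact (closure {x. \<phi> x \<noteq> 0}) \<and> closure {x. \<phi> x \<noteq> 0} \<subseteq> \<Omega>}"

definition has_weak_gradient :: "(real^'n) set \<Rightarrow> (real^'n \<Rightarrow> real) \<Rightarrow> (real^'n \<Rightarrow> real^'n) \<Rightarrow> bool" where
  "has_weak_gradient \<Omega> y g \<longleftrightarrow> (\<forall>\<phi> \<in> test_functions \<Omega>. \<forall>i.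
     (\<integral>x. y x * partial_deriv i \<phi> x \<partial>lebesgue_on \<Omega>) = - (\<integral>x. g x $ i * \<phi> x \<partial>lebesgue_on \<Omega>))"

definition H1 :: "(real^'n) set \<Rightarrow> (real^'n \<Rightarrow> real) set" where
  "H1 \<Omega> = {y \<in> L2 \<Omega>. \<exists>g \<in> L2 \<Omega>. has_weak_gradient \<Omega> y g}"

text \<open>The weak gradient of a function in \<open>H\<^sup>1(\<Omega>)\<close> is unique up to null sets; we pick a representative.\<close>

definition weak_gradient :: "(real^'n) set \<Rightarrow> (real^'n \<Rightarrow> real) \<Rightarrow> real^'n \<Rightarrow> real^'n" where
  "weak_gradient \<Omega> y = (SOME g. g \<in> L2 \<Omega> \<and> has_weak_gradient \<Omega> y g)"

definition norm_H1 :: "(real^'n) set \<Rightarrow> (real^'n \<Rightarrow> real) \<Rightarrow> real" where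
  "norm_H1 \<Omega> y = sqrt ((norm_L2 \<Omega> y)\<^sup>2 + (norm_L2 \<Omega> (weak_gradient \<Omega> y))\<^sup>2)"

definition H10 :: "(real^'n) set \<Rightarrow> (real^'n \<Rightarrow> real) set" where
  "H10 \<Omega> = {y \<in> H1 \<Omega>. \<exists>\<phi>. (\<forall>n::nat. \<phi> n \<in> test_functions \<Omega>) \<and>
     (\<lambda>n. norm_H1 \<Omega> (\<lambda>x. y x - \<phi> n x)) \<longlonglongrightarrow> 0}"


definition Linfty :: "(real^'n) set \<Rightarrow> (real^'n \<Rightarrow> 'b::euclidean_space) set" where
  "Linfty \<Omega> = {u \<in> borel_measurable (lebesgue_on \<Omega>). \<exists>C. AE x in lebesgue_on \<Omega>. norm (u x) \<le> C}"

text \<open>An operator \<open>A : H\<^sup>1\<^sub>0(\<Omega>) \<rightarrow> H\<^sup>-\<^sup>1(\<Omega>)\<close> is represented by its pairing: \<open>A y v\<close> stands for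
  \<open>\<langle>A y, v\<rangle>\<close>. In divergence form, \<open>A y = - div (M \<nabla>y + y b) + d \<bullet> \<nabla>y + c y\<close>.\<close>

definition elliptic_operator ::
    "(real^'n) set \<Rightarrow> ((real^'n \<Rightarrow> real) \<Rightarrow> (real^'n \<Rightarrow> real) \<Rightarrow> real) \<Rightarrow> bool" where
  "elliptic_operator \<Omega> A \<longleftrightarrow>
     (\<exists>M \<in> (Linfty \<Omega> :: (real^'n \<Rightarrow> real^'n^'n) set). \<exists>b \<in> (Linfty \<Omega> :: (real^'n \<Rightarrow> real^'n) set).
      \<exists>d \<in> (Linfty \<Omega> :: (real^'n \<Rightarrow> real^'n) set). \<exists>c \<in> (Linfty \<Omega> :: (real^'n \<Rightarrow> real) set).
        (\<exists>\<theta>>0. AE x in lebesgue_on \<Omega>. \<forall>\<xi>. \<theta> * (norm \<xi>)\<^sup>2 \<le> (M x *v \<xi>) \<bullet> \<xi>) \<and>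
        (\<forall>y \<in> H10 \<Omega>. \<forall>v \<in> H10 \<Omega>.
           A y v = (\<integral>x. (M x *v weak_gradient \<Omega> y x + y x *\<^sub>R b x) \<bullet> weak_gradient \<Omega> v x
                        + (d x \<bullet> weak_gradient \<Omega> y x) * v x + c x * y x * v x \<partial>lebesgue_on \<Omega>)))"


definition PC1 :: "(real \<Rightarrow> real) \<Rightarrow> bool" where
  "PC1 f \<longleftrightarrow> continuous_on UNIV f \<and>
     (\<forall>x\<^sub>0. \<exists>W. open W \<and> x\<^sub>0 \<in> W \<and>
        (\<exists>S. finite S \<and> (\<forall>g \<in> S. g C1_differentiable_on W) \<and> (\<forall>x \<in> W. \<exists>g \<in> S. f x = g x)))"

definition knot :: "nat \<Rightarrow> (nat \<Rightarrow> real) \<Rightarrow> nat \<Rightarrow> ereal" where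
  "knot k t i = (if i = 0 then -\<infinity> else if i \<le> k then ereal (t i) else \<infinity>)"

definition piece :: "nat \<Rightarrow> (nat \<Rightarrow> real) \<Rightarrow> nat \<Rightarrow> real set" where
  "piece k t i = {s. knot k t (i - 1) < ereal s \<and> ereal s \<le> knot k t i}"

definition open_piece :: "nat \<Rightarrow> (nat \<Rightarrow> real) \<Rightarrow> nat \<Rightarrow> real set" where
  "open_piece k t i = {s. knot k t (i - 1) < ereal s \<and> ereal s < knot k t i}"

text \<open>The coefficient \<open>a\<^sub>u\<close>, as a function of \<open>y = y\<^sub>u\<close>.\<close>

definition slope_coeff ::
    "nat \<Rightarrow> (nat \<Rightarrow> real) \<Rightarrow> (nat \<Rightarrow> real \<Rightarrow> real) \<Rightarrow> (real^'n \<Rightarrow> real) \<Rightarrow> real^'n \<Rightarrow> real" where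
  "slope_coeff k t fs y x = (\<Sum>i=1..k+1. indicator (piece k t i) (y x) * deriv (fs i) (y x))"


text \<open>Weak solutions, in \<open>H\<^sup>1\<^sub>0(\<Omega>) \<inter> C(closure \<Omega>)\<close>, of \<open>A y + f(y) = u\<close> and of
  \<open>A \<eta> + a \<eta> = w\<close> with homogeneous Dirichlet conditions. The continuous representative is taken,
  so that pointwise level sets make sense.\<close>

definition semilinear_solution ::
    "(real^'n) set \<Rightarrow> ((real^'n \<Rightarrow> real) \<Rightarrow> (real^'n \<Rightarrow> real) \<Rightarrow> real) \<Rightarrow> (real \<Rightarrow> real)
      \<Rightarrow> (real^'n \<Rightarrow> real) \<Rightarrow> (real^'n \<Rightarrow> real) \<Rightarrow> bool" where
  "semilinear_solution \<Omega> A f u y \<longleftrightarrow> y \<in> H10 \<Omega> \<and> continuous_on (closure \<Omega>) y \<and>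
     (\<forall>v \<in> H10 \<Omega>. A y v + (\<integral>x. f (y x) * v x \<partial>lebesgue_on \<Omega>) = (\<integral>x. u x * v x \<partial>lebesgue_on \<Omega>))"

definition linear_solution ::
    "(real^'n) set \<Rightarrow> ((real^'n \<Rightarrow> real) \<Rightarrow> (real^'n \<Rightarrow> real) \<Rightarrow> real) \<Rightarrow> (real^'n \<Rightarrow> real)
      \<Rightarrow> (real^'n \<Rightarrow> real) \<Rightarrow> (real^'n \<Rightarrow> real) \<Rightarrow> bool" where
  "linear_solution \<Omega> A a w \<eta> \<longleftrightarrow> \<eta> \<in> H10 \<Omega> \<and> continuous_on (closure \<Omega>) \<eta> \<and>
     (\<forall>v \<in> H10 \<Omega>. A \<eta> v + (\<integral>x. a x * \<eta> x * v x \<partial>lebesgue_on \<Omega>) = (\<integral>x. w x * v x \<partial>lebesgue_on \<Omega>))"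

end

theory Submission
  imports Defs
begin

text \<open>
  Write \<open>y = F u\<close>, \<open>y' = F u'\<close>, \<open>e = y' - y\<close> and \<open>a\<close> for the coefficient of the linearised equation at
  \<open>u\<close>. Subtracting the equations shows that the defect \<open>d = e - G u (u' - u)\<close> solves
  \<open>A d + a d = - r\<close>, where \<open>r = f y' - f y - a e\<close> is the linearisation error. As \<open>a \<ge> 0\<close>, coercivity
  bounds \<open>c\<^sub>0\<close> times the squared \<open>H\<^sup>1\<close> norm of \<open>d\<close> by the integral of \<open>\<bar>r\<bar> \<bar>d\<bar>\<close>.

  Suppose that \<open>y\<close> and \<open>y'\<close> are uniformly close to \<open>F u\<^sub>d\<close>. Away from the set \<open>S\<close> on which \<open>y\<close> comes near
  a knot \<open>t i\<close>, both states lie in one piece of \<open>f\<close>, and \<open>\<bar>r\<bar> \<le> \<tau> \<bar>e\<bar>\<close> with a small \<open>\<tau>\<close>. On \<open>S\<close> there is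
  only \<open>\<bar>r\<bar> \<le> K \<bar>e\<bar>\<close>, but \<open>S\<close> is contained in a neighbourhood of the level sets of \<open>F u\<^sub>d\<close> at the knots
  and therefore has small measure. By \<open>small_set_estimate\<close> the \<open>L\<^sup>2\<close> mass of \<open>d\<close> on \<open>S\<close> is then a small
  fraction of its \<open>H\<^sup>1\<close> norm, and the claim follows (\<open>defect_estimate\<close>). Since \<open>K\<close> depends only on the
  slopes of \<open>f\<close> near the knots, the smallness required of the level sets does not depend on \<open>u\<^sub>d\<close>.

  Two facts from the theory of elliptic equations carry the argument, and both are obtained in an
  elementary way. The first is \<open>small_set_estimate\<close>. Comparing a test function with its translates and
  averaging over all translations in a small ball splits its mass on \<open>S\<close> into a gradient term with a
  small factor and a term with the factor \<open>|S|\<close>.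

  The second is continuity of \<open>F\<close> from \<open>L\<^sup>2\<close> to the uniform norm, \<open>F_uniformly_continuous_at\<close>. Each
  solution is a continuous function on the closure of the domain and hence bounded, but a bound
  that is uniform in the data has to be found. It comes from the comparison principle: a rapidly
  convergent sequence of data is dominated by a single square integrable function, and the one
  bounded solution that belongs to it dominates all the solutions (\<open>linear_solutions_uniformly_small\<close>).

  The comparison principle needs the positive part of a function in \<open>H\<^sup>1\<^sub>0\<close> as a test function. To
  differentiate it, \<open>H\<^sup>1\<^sub>0\<close> is described as the closure of the test functions together with their
  classical gradients (\<open>H10_gradient\<close>). That this description agrees with weak gradients rests on the
  fundamental lemma of the calculus of variations, \<open>AE_zero_if_orthogonal_to_test_functions\<close>.
\<close>

section \<open>The space of square integrable functions\<close>

lemma L2_measurable: "u \<in> L2 \<Omega> \<Longrightarrow> u \<in> borel_measurable (lebesgue_on \<Omega>)"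
  by (simp add: L2_def)

lemma L2_integrable_square: "u \<in> L2 \<Omega> \<Longrightarrow> integrable (lebesgue_on \<Omega>) (\<lambda>x. (norm (u x))\<^sup>2)"
  by (simp add: L2_def)

lemma norm_L2_nonneg [simp]: "0 \<le> norm_L2 \<Omega> u"
  by (simp add: norm_L2_def)

lemma norm_L2_square: "(norm_L2 \<Omega> u)\<^sup>2 = (\<integral>x. (norm (u x))\<^sup>2 \<partial>lebesgue_on \<Omega>)"
  by (simp add: norm_L2_def)

lemma L2_dominated:
  assumes u: "u \<in> L2 \<Omega>" and v: "v \<in> borel_measurable (lebesgue_on \<Omega>)"
    and le: "AE x in lebesgue_on \<Omega>. norm (v x) \<le> norm (u x)"
  shows "v \<in> L2 \<Omega>" "norm_L2 \<Omega> v \<le> norm_L2 \<Omega> u"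
proof -
  have le2: "AE x in lebesgue_on \<Omega>. (norm (v x))\<^sup>2 \<le> (norm (u x))\<^sup>2"
    using le by eventually_elim (simp add: power_mono)
  have i: "integrable (lebesgue_on \<Omega>) (\<lambda>x. (norm (v x))\<^sup>2)"
    by (rule Bochner_Integration.integrable_bound[OF L2_integrable_square[OF u]])
       (use v le2 in auto)
  then show "v \<in> L2 \<Omega>" using v by (simp add: L2_def)
  show "norm_L2 \<Omega> v \<le> norm_L2 \<Omega> u"
    unfolding norm_L2_def
    by (intro real_sqrt_le_mono integral_mono_AE i L2_integrable_square[OF u] le2)
qed

lemma L2_integrable_product:
  assumes "u \<in> L2 \<Omega>" "v \<in> L2 \<Omega>"
  shows "integrable (lebesgue_on \<Omega>) (\<lambda>x. norm (u x) * norm (v x))"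
proof (rule Bochner_Integration.integrable_bound)
  show "integrable (lebesgue_on \<Omega>) (\<lambda>x. (norm (u x))\<^sup>2 + (norm (v x))\<^sup>2)"
    using assms by (intro Bochner_Integration.integrable_add L2_integrable_square)
  show "(\<lambda>x. norm (u x) * norm (v x)) \<in> borel_measurable (lebesgue_on \<Omega>)"
    using assms[THEN L2_measurable] by measurable
  show "AE x in lebesgue_on \<Omega>. norm (norm (u x) * norm (v x)) \<le> norm ((norm (u x))\<^sup>2 + (norm (v x))\<^sup>2)"
  proof (rule AE_I2)
    fix x
    have "2 * (norm (u x) * norm (v x)) \<le> (norm (u x))\<^sup>2 + (norm (v x))\<^sup>2"
      using sum_squares_bound[of "norm (u x)" "norm (v x)"] by simp
    then have "norm (u x) * norm (v x) \<le> (norm (u x))\<^sup>2 + (norm (v x))\<^sup>2"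
      using mult_nonneg_nonneg[OF norm_ge_zero[of "u x"] norm_ge_zero[of "v x"]] by linarith
    then show "norm (norm (u x) * norm (v x)) \<le> norm ((norm (u x))\<^sup>2 + (norm (v x))\<^sup>2)"
      by simp
  qed
qed

lemma L2_integrable_mult:
  fixes u v :: "real^'n \<Rightarrow> real"
  assumes "u \<in> L2 \<Omega>" "v \<in> L2 \<Omega>"
  shows "integrable (lebesgue_on \<Omega>) (\<lambda>x. u x * v x)"
  by (rule Bochner_Integration.integrable_bound[OF L2_integrable_product[OF assms]])
     (use assms[THEN L2_measurable] in \<open>auto simp: abs_mult\<close>)

text \<open>For positive \<open>a\<close> and \<open>b\<close> integrate \<open>0 \<le> (b \<bar>u\<bar> - a \<bar>v\<bar>)\<^sup>2\<close>. The choice of \<open>a\<close> and \<open>b\<close> as the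
  two norms gives the inequality, except that a norm may vanish; so a number \<open>e > 0\<close> is added to both.\<close>

lemma L2_Cauchy_Schwarz:
  assumes u: "u \<in> L2 \<Omega>" and v: "v \<in> L2 \<Omega>"
  shows "(\<integral>x. norm (u x) * norm (v x) \<partial>lebesgue_on \<Omega>) \<le> norm_L2 \<Omega> u * norm_L2 \<Omega> v"
proof -
  let ?I = "\<integral>x. norm (u x) * norm (v x) \<partial>lebesgue_on \<Omega>"
  let ?a = "norm_L2 \<Omega> u" and ?b = "norm_L2 \<Omega> v"
  have key: "?I \<le> (?a + e) * (?b + e)" if e: "0 < e" for e
  proof -
    define a b where "a = ?a + e" and "b = ?b + e"
    have ab: "0 < a" "0 < b" "?a \<le> a" "?b \<le> b" using e by (auto simp: a_def b_def add_nonneg_pos)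
    have "2 * a * b * ?I = (\<integral>x. 2 * a * b * (norm (u x) * norm (v x)) \<partial>lebesgue_on \<Omega>)"
      by simp
    also have "\<dots> \<le> (\<integral>x. b\<^sup>2 * (norm (u x))\<^sup>2 + a\<^sup>2 * (norm (v x))\<^sup>2 \<partial>lebesgue_on \<Omega>)"
    proof (rule integral_mono)
      show "integrable (lebesgue_on \<Omega>) (\<lambda>x. 2 * a * b * (norm (u x) * norm (v x)))"
        using L2_integrable_product[OF u v] by simp
      show "integrable (lebesgue_on \<Omega>) (\<lambda>x. b\<^sup>2 * (norm (u x))\<^sup>2 + a\<^sup>2 * (norm (v x))\<^sup>2)"
        using L2_integrable_square[OF u] L2_integrable_square[OF v] by simp
      show "2 * a * b * (norm (u x) * norm (v x)) \<le> b\<^sup>2 * (norm (u x))\<^sup>2 + a\<^sup>2 * (norm (v x))\<^sup>2" for x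
        using sum_squares_bound[of "b * norm (u x)" "a * norm (v x)"]
        by (simp add: power_mult_distrib mult_ac)
    qed
    also have "\<dots> = b\<^sup>2 * ?a\<^sup>2 + a\<^sup>2 * ?b\<^sup>2"
      using L2_integrable_square[OF u] L2_integrable_square[OF v] by (simp add: norm_L2_square)
    also have "\<dots> \<le> b\<^sup>2 * a\<^sup>2 + a\<^sup>2 * b\<^sup>2"
      using ab by (intro add_mono mult_left_mono power_mono) auto
    finally have "(2 * a * b) * ?I \<le> (2 * a * b) * (a * b)"
      by (simp add: power2_eq_square mult_ac)
    then show ?thesis using ab by (simp add: a_def b_def)
  qed
  have "((\<lambda>e. (?a + e) * (?b + e)) \<longlongrightarrow> (?a + 0) * (?b + 0)) (at_right 0)"
    by (intro tendsto_intros)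
  moreover have "\<forall>\<^sub>F e in at_right 0. ?I \<le> (?a + e) * (?b + e)"
    using key eventually_at_right_less[of "0::real"] by (auto elim: eventually_mono)
  ultimately have "?I \<le> (?a + 0) * (?b + 0)"
    by (rule tendsto_lowerbound) simp
  then show ?thesis by simp
qed

lemma L2_Cauchy_Schwarz_mult:
  fixes u v :: "real^'n \<Rightarrow> real"
  assumes "u \<in> L2 \<Omega>" "v \<in> L2 \<Omega>"
  shows "\<bar>\<integral>x. u x * v x \<partial>lebesgue_on \<Omega>\<bar> \<le> norm_L2 \<Omega> u * norm_L2 \<Omega> v"
proof -
  have "\<bar>\<integral>x. u x * v x \<partial>lebesgue_on \<Omega>\<bar> \<le> (\<integral>x. norm (u x * v x) \<partial>lebesgue_on \<Omega>)"
    using integral_norm_bound[of "lebesgue_on \<Omega>" "\<lambda>x. u x * v x"] by simp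
  also have "\<dots> \<le> norm_L2 \<Omega> u * norm_L2 \<Omega> v"
    using L2_Cauchy_Schwarz[OF assms] by (simp add: abs_mult)
  finally show ?thesis .
qed

lemma
  assumes u: "u \<in> L2 \<Omega>" and v: "v \<in> L2 \<Omega>"
  shows L2_add: "(\<lambda>x. u x + v x) \<in> L2 \<Omega>"
    and norm_L2_triangle: "norm_L2 \<Omega> (\<lambda>x. u x + v x) \<le> norm_L2 \<Omega> u + norm_L2 \<Omega> v"
proof -
  note iu = L2_integrable_square[OF u] and iv = L2_integrable_square[OF v]
    and iuv = L2_integrable_product[OF u v]
  have le: "(norm (u x + v x))\<^sup>2 \<le> (norm (u x))\<^sup>2 + 2 * (norm (u x) * norm (v x)) + (norm (v x))\<^sup>2" for x
    using power_mono[OF norm_triangle_ineq[of "u x" "v x"], of 2] by (simp add: power2_sum)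
  have I: "integrable (lebesgue_on \<Omega>)
      (\<lambda>x. (norm (u x))\<^sup>2 + 2 * (norm (u x) * norm (v x)) + (norm (v x))\<^sup>2)"
    using iu iv iuv by (intro Bochner_Integration.integrable_add) auto
  have i: "integrable (lebesgue_on \<Omega>) (\<lambda>x. (norm (u x + v x))\<^sup>2)"
    by (rule Bochner_Integration.integrable_bound[OF I])
       (use L2_measurable[OF u] L2_measurable[OF v] le in auto)
  then show "(\<lambda>x. u x + v x) \<in> L2 \<Omega>"
    using L2_measurable[OF u] L2_measurable[OF v] by (simp add: L2_def)
  have "(norm_L2 \<Omega> (\<lambda>x. u x + v x))\<^sup>2
      \<le> (\<integral>x. (norm (u x))\<^sup>2 + 2 * (norm (u x) * norm (v x)) + (norm (v x))\<^sup>2 \<partial>lebesgue_on \<Omega>)"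
    unfolding norm_L2_square by (intro integral_mono i I le)
  also have "\<dots> = (norm_L2 \<Omega> u)\<^sup>2 + 2 * (\<integral>x. norm (u x) * norm (v x) \<partial>lebesgue_on \<Omega>) + (norm_L2 \<Omega> v)\<^sup>2"
    using iu iv iuv by (simp add: norm_L2_square)
  also have "\<dots> \<le> (norm_L2 \<Omega> u + norm_L2 \<Omega> v)\<^sup>2"
    using L2_Cauchy_Schwarz[OF u v] by (simp add: power2_sum)
  finally show "norm_L2 \<Omega> (\<lambda>x. u x + v x) \<le> norm_L2 \<Omega> u + norm_L2 \<Omega> v"
    by (rule power2_le_imp_le) simp
qed

lemma norm_L2_scaleR: "norm_L2 \<Omega> (\<lambda>x. c *\<^sub>R u x) = \<bar>c\<bar> * norm_L2 \<Omega> u"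
  by (simp add: norm_L2_def power_mult_distrib real_sqrt_mult)

lemma L2_scaleR: "u \<in> L2 \<Omega> \<Longrightarrow> (\<lambda>x. c *\<^sub>R u x) \<in> L2 \<Omega>"
  by (auto simp: L2_def power_mult_distrib)

lemma L2_cmult: "u \<in> L2 \<Omega> \<Longrightarrow> (\<lambda>x. c * u x :: real) \<in> L2 \<Omega>"
  using L2_scaleR[of u \<Omega> c] by simp

lemma L2_uminus: "u \<in> L2 \<Omega> \<Longrightarrow> (\<lambda>x. - u x) \<in> L2 \<Omega>"
  using L2_scaleR[of u \<Omega> "-1"] by simp

lemma norm_L2_uminus: "norm_L2 \<Omega> (\<lambda>x. - u x) = norm_L2 \<Omega> u"
  by (simp add: norm_L2_def)

lemma norm_L2_minus_commute: "norm_L2 \<Omega> (\<lambda>x. u x - v x) = norm_L2 \<Omega> (\<lambda>x. v x - u x)"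
  by (simp add: norm_L2_def norm_minus_commute)

lemma L2_diff: "u \<in> L2 \<Omega> \<Longrightarrow> v \<in> L2 \<Omega> \<Longrightarrow> (\<lambda>x. u x - v x) \<in> L2 \<Omega>"
  using L2_add[of u \<Omega> "\<lambda>x. - v x"] L2_uminus[of v \<Omega>] by simp

lemma norm_L2_le_diff:
  assumes "u \<in> L2 \<Omega>" "v \<in> L2 \<Omega>"
  shows "norm_L2 \<Omega> u \<le> norm_L2 \<Omega> v + norm_L2 \<Omega> (\<lambda>x. u x - v x)"
  using norm_L2_triangle[OF assms(2) L2_diff[OF assms]] by simp

abbreviation L2_converges ::
    "(real^'n) set \<Rightarrow> (nat \<Rightarrow> real^'n \<Rightarrow> 'b::euclidean_space) \<Rightarrow> (real^'n \<Rightarrow> 'b) \<Rightarrow> bool" where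
  "L2_converges \<Omega> u v \<equiv> (\<lambda>n. norm_L2 \<Omega> (\<lambda>x. v x - u n x)) \<longlonglongrightarrow> 0"

lemma norm_L2_tendsto:
  assumes "\<And>n. u n \<in> L2 \<Omega>" "v \<in> L2 \<Omega>" "L2_converges \<Omega> u v"
  shows "(\<lambda>n. norm_L2 \<Omega> (u n)) \<longlonglongrightarrow> norm_L2 \<Omega> v"
proof (rule LIM_zero_cancel, rule tendsto_rabs_zero_cancel, rule Lim_null_comparison[OF _ assms(3)])
  show "\<forall>\<^sub>F n in sequentially. norm \<bar>norm_L2 \<Omega> (u n) - norm_L2 \<Omega> v\<bar> \<le> norm_L2 \<Omega> (\<lambda>x. v x - u n x)"
  proof (rule always_eventually, rule allI)
    fix n
    show "norm \<bar>norm_L2 \<Omega> (u n) - norm_L2 \<Omega> v\<bar> \<le> norm_L2 \<Omega> (\<lambda>x. v x - u n x)"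
      using norm_L2_le_diff[OF assms(1,2), of n] norm_L2_le_diff[OF assms(2,1), of n]
      by (simp add: norm_L2_minus_commute[of \<Omega> "u n" v] abs_le_iff)
  qed
qed

lemma norm_L2_cong_AE:
  assumes "u \<in> borel_measurable (lebesgue_on \<Omega>)" "v \<in> borel_measurable (lebesgue_on \<Omega>)"
    "AE x in lebesgue_on \<Omega>. u x = v x"
  shows "norm_L2 \<Omega> u = norm_L2 \<Omega> v"
  unfolding norm_L2_def using assms by (intro arg_cong[where f=sqrt] integral_cong_AE) auto

lemma norm_L2_eq_0_imp_AE:
  assumes u: "u \<in> L2 \<Omega>" and "norm_L2 \<Omega> u = 0"
  shows "AE x in lebesgue_on \<Omega>. u x = 0"
proof -
  have "(\<integral>x. (norm (u x))\<^sup>2 \<partial>lebesgue_on \<Omega>) = 0"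
    using assms(2) norm_L2_square[of \<Omega> u] by simp
  then have "AE x in lebesgue_on \<Omega>. (norm (u x))\<^sup>2 = 0"
    by (subst (asm) integral_nonneg_eq_0_iff_AE) (use L2_integrable_square[OF u] in auto)
  then show ?thesis by simp
qed

lemma L2_dominated_convergence:
  assumes u: "\<And>n. u n \<in> borel_measurable (lebesgue_on \<Omega>)" and w: "w \<in> L2 \<Omega>"
    and lim: "AE x in lebesgue_on \<Omega>. (\<lambda>n. u n x) \<longlonglongrightarrow> 0"
    and le: "\<And>n. AE x in lebesgue_on \<Omega>. norm (u n x) \<le> norm (w x)"
  shows "(\<lambda>n. norm_L2 \<Omega> (u n)) \<longlonglongrightarrow> 0"
proof -
  have "(\<lambda>n. \<integral>x. (norm (u n x))\<^sup>2 \<partial>lebesgue_on \<Omega>) \<longlonglongrightarrow> (\<integral>x. 0 \<partial>lebesgue_on \<Omega>)"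
  proof (rule integral_dominated_convergence[OF _ _ L2_integrable_square[OF w]])
    show "AE x in lebesgue_on \<Omega>. (\<lambda>n. (norm (u n x))\<^sup>2) \<longlonglongrightarrow> 0"
      using lim by eventually_elim (auto intro!: tendsto_eq_intros)
    show "AE x in lebesgue_on \<Omega>. norm ((norm (u n x))\<^sup>2) \<le> (norm (w x))\<^sup>2" for n
      using le[of n] by eventually_elim (simp add: power_mono)
  qed (use u in auto)
  then show ?thesis
    unfolding norm_L2_def using tendsto_real_sqrt by fastforce
qed

lemma L2_tendsto_AE_subsequence:
  assumes u: "\<And>n. u n \<in> L2 \<Omega>" and lim: "(\<lambda>n. norm_L2 \<Omega> (u n)) \<longlonglongrightarrow> 0"
  obtains r :: "nat \<Rightarrow> nat" where "strict_mono r" "AE x in lebesgue_on \<Omega>. (\<lambda>n. u (r n) x) \<longlonglongrightarrow> 0"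
proof -
  have "(\<lambda>n. \<integral>x. norm ((norm (u n x))\<^sup>2) \<partial>lebesgue_on \<Omega>) \<longlonglongrightarrow> 0"
    using tendsto_power[OF lim, of 2] by (simp add: norm_L2_square)
  then obtain r where r: "strict_mono r"
      "AE x in lebesgue_on \<Omega>. (\<lambda>n. (norm (u (r n) x))\<^sup>2) \<longlonglongrightarrow> 0"
    using tendsto_L1_AE_subseq[of "lebesgue_on \<Omega>" "\<lambda>n x. (norm (u n x))\<^sup>2"] L2_integrable_square[OF u]
    by blast
  have "AE x in lebesgue_on \<Omega>. (\<lambda>n. u (r n) x) \<longlonglongrightarrow> 0"
    using r(2)
  proof eventually_elim
    case (elim x)
    then have "(\<lambda>n. sqrt ((norm (u (r n) x))\<^sup>2)) \<longlonglongrightarrow> sqrt 0" by (rule tendsto_real_sqrt)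
    then show ?case by (simp add: tendsto_norm_zero_iff)
  qed
  with r(1) show ?thesis by (rule that)
qed

lemma L2_bounded_mult:
  fixes u :: "real^'n \<Rightarrow> real"
  assumes u: "u \<in> L2 \<Omega>" and a: "a \<in> borel_measurable (lebesgue_on \<Omega>)"
    and C: "0 \<le> C" "AE x in lebesgue_on \<Omega>. \<bar>a x\<bar> \<le> C"
  shows "(\<lambda>x. a x * u x) \<in> L2 \<Omega>" "norm_L2 \<Omega> (\<lambda>x. a x * u x) \<le> C * norm_L2 \<Omega> u"
proof -
  have *: "(\<lambda>x. C * u x) \<in> L2 \<Omega>" using u by (rule L2_cmult)
  have m: "(\<lambda>x. a x * u x) \<in> borel_measurable (lebesgue_on \<Omega>)"
    using a L2_measurable[OF u] by simp
  have le: "AE x in lebesgue_on \<Omega>. norm (a x * u x) \<le> norm (C * u x)"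
    using C(2) by eventually_elim (use C(1) in \<open>auto simp: abs_mult intro!: mult_right_mono\<close>)
  show "(\<lambda>x. a x * u x) \<in> L2 \<Omega>" by (rule L2_dominated(1)[OF * m le])
  show "norm_L2 \<Omega> (\<lambda>x. a x * u x) \<le> C * norm_L2 \<Omega> u"
    using L2_dominated(2)[OF * m le] norm_L2_scaleR[of \<Omega> C u] C(1) by simp
qed

lemma L2_bounded:
  assumes "\<Omega> \<in> lmeasurable" and u: "u \<in> borel_measurable (lebesgue_on \<Omega>)"
    and C: "\<And>x. x \<in> \<Omega> \<Longrightarrow> norm (u x) \<le> C"
  shows "u \<in> L2 \<Omega>"
proof -
  interpret finite_measure "lebesgue_on \<Omega>"
    by (rule finite_measure_lebesgue_on[OF assms(1)])
  have *: "space (lebesgue_on \<Omega>) = \<Omega>" by (simp add: space_restrict_space)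
  have "integrable (lebesgue_on \<Omega>) (\<lambda>x. (norm (u x))\<^sup>2)"
    by (rule integrable_const_bound[where B="C\<^sup>2"])
       (use u C in \<open>auto simp: * power_mono intro!: AE_I2\<close>)
  then show ?thesis using u by (simp add: L2_def)
qed

text \<open>The function that dominates all \<open>\<bar>w\<^sub>n\<bar>\<close> at once is the square root of \<open>\<Sum> w\<^sub>n\<^sup>2\<close>.\<close>

lemma L2_common_majorant:
  fixes w :: "nat \<Rightarrow> real^'n \<Rightarrow> real"
  assumes w: "\<And>n. w n \<in> L2 \<Omega>" and s: "summable (\<lambda>n. (norm_L2 \<Omega> (w n))\<^sup>2)"
  obtains W where "W \<in> L2 \<Omega>" "\<And>x. 0 \<le> W x" "\<And>n. AE x in lebesgue_on \<Omega>. \<bar>w n x\<bar> \<le> W x"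
proof -
  let ?M = "lebesgue_on \<Omega>"
  have [measurable]: "w n \<in> borel_measurable ?M" for n using w by (rule L2_measurable)
  have i: "integrable ?M (\<lambda>x. (w n x)\<^sup>2)" for n using L2_integrable_square[OF w[of n]] by simp
  have int: "(\<integral>x. (w n x)\<^sup>2 \<partial>?M) = (norm_L2 \<Omega> (w n))\<^sup>2" for n by (simp add: norm_L2_square)
  have "(\<integral>\<^sup>+x. (\<Sum>n. ennreal ((w n x)\<^sup>2)) \<partial>?M) = (\<Sum>n. \<integral>\<^sup>+x. ennreal ((w n x)\<^sup>2) \<partial>?M)"
    by (rule nn_integral_suminf) measurable
  also have "\<dots> = (\<Sum>n. ennreal ((norm_L2 \<Omega> (w n))\<^sup>2))"
    by (subst nn_integral_eq_integral[OF i]) (auto simp: int)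
  also have "\<dots> = ennreal (\<Sum>n. (norm_L2 \<Omega> (w n))\<^sup>2)"
    by (rule suminf_ennreal_eq) (use s in \<open>auto simp: summable_sums\<close>)
  also have "\<dots> < \<infinity>" by simp
  finally have "AE x in ?M. (\<Sum>n. ennreal ((w n x)\<^sup>2)) \<noteq> \<infinity>"
    by (intro nn_integral_noteq_infinite) (auto simp: less_top)
  then have sm: "AE x in ?M. summable (\<lambda>n. (w n x)\<^sup>2)"
    by eventually_elim (auto intro!: summable_suminf_not_top simp: top_unique)
  have I: "integrable ?M (\<lambda>x. \<Sum>n. (w n x)\<^sup>2)"
    by (rule integrable_suminf) (use i s sm in \<open>auto simp: int\<close>)
  define W where "W x = sqrt (max 0 (\<Sum>n. (w n x)\<^sup>2))" for x
  have W0: "0 \<le> W x" for x by (simp add: W_def)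
  have mW: "W \<in> borel_measurable ?M" unfolding W_def using borel_measurable_integrable[OF I] by measurable
  have "AE x in ?M. (norm (W x))\<^sup>2 = (\<Sum>n. (w n x)\<^sup>2)"
    using sm by eventually_elim (simp add: W_def suminf_nonneg)
  then have "integrable ?M (\<lambda>x. (norm (W x))\<^sup>2)"
    using I mW by (subst integrable_cong_AE) (auto intro: borel_measurable_integrable)
  then have "W \<in> L2 \<Omega>" using mW by (simp add: L2_def)
  moreover have "AE x in ?M. \<bar>w n x\<bar> \<le> W x" for n
    using sm
  proof eventually_elim
    case (elim x)
    have "(w n x)\<^sup>2 \<le> (\<Sum>n. (w n x)\<^sup>2)"
      using sum_le_suminf[OF elim, of "{n}"] by simp
    then have "sqrt ((w n x)\<^sup>2) \<le> W x" unfolding W_def by (intro real_sqrt_le_mono) simp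
    then show ?case by simp
  qed
  ultimately show ?thesis using W0 by (intro that)
qed

section \<open>Smooth functions\<close>

lemma partial_deriv_eqI:
  "(\<phi> has_derivative D) (at x) \<Longrightarrow> partial_deriv i \<phi> x = D (axis i 1)"
  by (simp add: partial_deriv_def frechet_derivative_at[symmetric])

lemma differentiable_has_derivative:
  "\<phi> differentiable (at x) \<Longrightarrow> (\<phi> has_derivative frechet_derivative \<phi> (at x)) (at x)"
  by (simp add: frechet_derivative_works)

lemma Ck_SucD: "Ck (Suc k) \<phi> \<Longrightarrow> Ck k \<phi>"
proof (induction k arbitrary: \<phi>)
  case 0
  then show ?case
    by (auto intro!: continuous_at_imp_continuous_on differentiable_imp_continuous_within)
qed auto

lemma Ck_const: "Ck k (\<lambda>x::real^'n. c)"
proof (induction k arbitrary: c)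
  case (Suc k)
  have "partial_deriv i (\<lambda>x::real^'n. c) = (\<lambda>x. 0)" for i
    by (rule ext, rule partial_deriv_eqI[where D="\<lambda>_. 0"]) simp
  with Suc[of 0] show ?case by simp
qed auto

lemma Ck_component: "Ck k (\<lambda>x::real^'n. x $ j)"
proof (cases k)
  case (Suc m)
  have d: "((\<lambda>x::real^'n. x $ j) has_derivative (\<lambda>h. h $ j)) (at x)" for x
    by (rule bounded_linear_imp_has_derivative[OF bounded_linear_vec_nth])
  have "partial_deriv i (\<lambda>x::real^'n. x $ j) = (\<lambda>x. axis i 1 $ j)" for i
    by (rule ext, rule partial_deriv_eqI[OF d])
  then show ?thesis using Suc d by (auto simp: Ck_const differentiable_def)
qed (auto intro!: continuous_intros)

lemma partial_deriv_add:
  assumes "\<phi> differentiable (at x)" "\<psi> differentiable (at x)"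
  shows "partial_deriv i (\<lambda>x. \<phi> x + \<psi> x) x = partial_deriv i \<phi> x + partial_deriv i \<psi> x"
  using partial_deriv_eqI[OF has_derivative_add[OF assms[THEN differentiable_has_derivative]]]
  by (simp add: partial_deriv_def)

lemma partial_deriv_mult:
  assumes "\<phi> differentiable (at x)" "\<psi> differentiable (at x)"
  shows "partial_deriv i (\<lambda>x. \<phi> x * \<psi> x) x = \<phi> x * partial_deriv i \<psi> x + partial_deriv i \<phi> x * \<psi> x"
  using partial_deriv_eqI[OF has_derivative_mult[OF assms[THEN differentiable_has_derivative]]]
  by (simp add: partial_deriv_def)

lemma Ck_add: "Ck k \<phi> \<Longrightarrow> Ck k \<psi> \<Longrightarrow> Ck k (\<lambda>x. \<phi> x + \<psi> x)"
proof (induction k arbitrary: \<phi> \<psi>)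
  case (Suc k)
  then have "partial_deriv i (\<lambda>x. \<phi> x + \<psi> x) = (\<lambda>x. partial_deriv i \<phi> x + partial_deriv i \<psi> x)" for i
    by (auto simp: partial_deriv_add)
  with Suc show ?case by auto
qed (auto intro!: continuous_intros)

lemma Ck_mult: "Ck k \<phi> \<Longrightarrow> Ck k \<psi> \<Longrightarrow> Ck k (\<lambda>x. \<phi> x * \<psi> x)"
proof (induction k arbitrary: \<phi> \<psi>)
  case (Suc k)
  then have "partial_deriv i (\<lambda>x. \<phi> x * \<psi> x)
      = (\<lambda>x. \<phi> x * partial_deriv i \<psi> x + partial_deriv i \<phi> x * \<psi> x)" for i
    by (auto simp: partial_deriv_mult)
  with Suc Suc.prems[THEN Ck_SucD] show ?case by (auto intro!: Ck_add)
qed (auto intro!: continuous_intros)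

lemma Ck_prod: "finite J \<Longrightarrow> (\<And>j. j \<in> J \<Longrightarrow> Ck k (\<phi> j)) \<Longrightarrow> Ck k (\<lambda>x. \<Prod>j\<in>J. \<phi> j x)"
  by (induction J rule: finite_induct) (auto intro!: Ck_mult Ck_const)

text \<open>For \<open>t > 0\<close> this is \<open>t\<^sup>1\<^sup>-\<^sup>m exp(-1/t)\<close>. The family is closed under differentiation up to linear
  combinations, so all its members are smooth. The member \<open>m = 0\<close> serves as a smooth positive part,
  the member \<open>m = 1\<close> as a smooth step.\<close>

definition flat :: "nat \<Rightarrow> real \<Rightarrow> real" where
  "flat m t = (if 0 < t then t * (1 / t) ^ m * exp (- (1 / t)) else 0)"

lemma flat_nonpos [simp]: "t \<le> 0 \<Longrightarrow> flat m t = 0"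
  by (simp add: flat_def)

lemma flat_pos: "0 < t \<Longrightarrow> 0 < flat m t"
  by (simp add: flat_def)

lemma flat_nonneg: "0 \<le> flat m t"
  by (simp add: flat_def)

lemma flat_one: "flat (Suc 0) t = (if 0 < t then exp (- (1 / t)) else 0)"
  by (simp add: flat_def)

lemma has_real_derivative_flat:
  "(flat m has_real_derivative (1 - real m) * flat (Suc m) t + flat (Suc (Suc m)) t) (at t)"
proof -
  consider "t > 0" | "t < 0" | "t = 0" by linarith
  then show ?thesis
  proof cases
    case 1
    have "((\<lambda>t. t * (1 / t) ^ m * exp (- (1 / t))) has_real_derivative
        (1 - real m) * flat (Suc m) t + flat (Suc (Suc m)) t) (at t)"
    proof -
      have i: "((\<lambda>t. 1 / t) has_real_derivative - ((1 / t) * (1 / t))) (at t)"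
        using 1 by (auto intro!: derivative_eq_intros simp: field_simps power2_eq_square)
      have p: "((\<lambda>t. (1 / t) ^ m) has_real_derivative - (real m * (1 / t) ^ Suc m)) (at t)"
        using DERIV_power[OF i, of m] by (cases m) (auto simp: mult_ac)
      have e: "((\<lambda>t. exp (- (1 / t))) has_real_derivative exp (- (1 / t)) * ((1 / t) * (1 / t))) (at t)"
        using DERIV_fun_exp[OF DERIV_minus[OF i]] by simp
      have "t * (1 / t) ^ Suc m = (1 / t) ^ m" "t * (1 / t) ^ Suc (Suc m) = (1 / t) ^ Suc m" using 1 by auto
      then have "((1 / t) ^ m + t * - (real m * (1 / t) ^ Suc m)) * exp (- (1 / t))
            + t * (1 / t) ^ m * (exp (- (1 / t)) * ((1 / t) * (1 / t)))
          = (1 - real m) * flat (Suc m) t + flat (Suc (Suc m)) t"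
        using 1 by (simp add: flat_def algebra_simps)
      then show ?thesis
        by (intro DERIV_cong[OF DERIV_mult[OF DERIV_mult[OF DERIV_ident p] e]]) (simp add: algebra_simps)
    qed
    moreover have "\<forall>\<^sub>F x in nhds t. t * (1 / t) ^ m * exp (- (1 / t)) = flat m t \<and> 0 < x"
      using 1 by (auto simp: flat_def intro: eventually_nhds_in_open[of "{0<..}"]
          eventually_mono[OF eventually_nhds_in_open[of "{0<..}"]])
    ultimately show ?thesis
      by (subst DERIV_cong_ev[OF refl _ refl])
         (auto simp: flat_def elim!: eventually_mono)
  next
    case 2
    have "\<forall>\<^sub>F x in nhds t. flat m x = 0"
      using 2 by (auto intro: eventually_mono[OF eventually_nhds_in_open[of "{..<0}"]])
    then show ?thesis
      using 2 by (subst DERIV_cong_ev[OF refl _ refl, where g="\<lambda>_. 0"]) auto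
  next
    case 3
    have "((\<lambda>h. h ^ m / exp h) \<longlongrightarrow> 0) (at_top :: real filter)"
      by (rule tendsto_power_div_exp_0)
    then have r: "((\<lambda>h. (inverse h) ^ m / exp (inverse h)) \<longlongrightarrow> 0) (at_right (0::real))"
      by (rule filterlim_compose[OF _ filterlim_inverse_at_top_right])
    have "((\<lambda>h. flat m h / h) \<longlongrightarrow> 0) (at_right 0)"
      by (rule Lim_transform_eventually[OF r])
         (auto simp: eventually_at_right_less flat_def exp_minus divide_simps
           intro!: eventually_mono[OF eventually_at_right_less])
    moreover have "((\<lambda>h. flat m h / h) \<longlongrightarrow> 0) (at_left 0)"
      by (rule tendsto_eventually)
         (auto intro!: eventually_mono[OF eventually_at_left_real[of "-1" 0]])
    ultimately have "((\<lambda>h. flat m h / h) \<longlongrightarrow> 0) (at 0)"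
      by (simp add: filterlim_at_split)
    then show ?thesis using 3 by (simp add: DERIV_def)
  qed
qed

lemma continuous_on_flat: "continuous_on UNIV (flat m)"
  by (intro continuous_at_imp_continuous_on ballI DERIV_isCont[OF has_real_derivative_flat])

lemma has_derivative_flat_compose:
  assumes "\<phi> differentiable (at x)"
  shows "((\<lambda>x. flat m (\<phi> x)) has_derivative
    (\<lambda>h. ((1 - real m) * flat (Suc m) (\<phi> x) + flat (Suc (Suc m)) (\<phi> x)) * frechet_derivative \<phi> (at x) h)) (at x)"
proof -
  have "(flat m has_derivative (*) ((1 - real m) * flat (Suc m) (\<phi> x) + flat (Suc (Suc m)) (\<phi> x)))
     (at (\<phi> x))"
    using has_real_derivative_flat by (simp add: has_field_derivative_def)
  from has_derivative_compose[OF differentiable_has_derivative[OF assms] this]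
  show ?thesis by simp
qed

lemma partial_deriv_flat:
  assumes "\<phi> differentiable (at x)"
  shows "partial_deriv i (\<lambda>x. flat m (\<phi> x)) x
    = ((1 - real m) * flat (Suc m) (\<phi> x) + flat (Suc (Suc m)) (\<phi> x)) * partial_deriv i \<phi> x"
  using partial_deriv_eqI[OF has_derivative_flat_compose[OF assms]] by (simp add: partial_deriv_def)

lemma Ck_flat: "Ck k \<phi> \<Longrightarrow> Ck k (\<lambda>x. flat m (\<phi> x))"
proof (induction k arbitrary: m \<phi>)
  case 0
  then show ?case using continuous_on_compose2[OF continuous_on_flat, of UNIV \<phi> m] by simp
next
  case (Suc k)
  then have d: "\<phi> differentiable (at x)" for x by simp
  have "Ck k \<phi>" using Suc.prems by (rule Ck_SucD)
  then have f: "Ck k (\<lambda>x. flat j (\<phi> x))" for j by (rule Suc.IH)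
  have "partial_deriv i (\<lambda>x. flat m (\<phi> x))
      = (\<lambda>x. ((1 - real m) * flat (Suc m) (\<phi> x) + flat (Suc (Suc m)) (\<phi> x)) * partial_deriv i \<phi> x)" for i
    using partial_deriv_flat[OF d] by auto
  moreover have "(\<lambda>x. flat m (\<phi> x)) differentiable (at x)" for x
    using has_derivative_flat_compose[OF d] by (rule differentiableI)
  ultimately show ?case
    using f Suc.prems by (auto intro!: Ck_add Ck_mult Ck_const)
qed

definition grad :: "(real^'n \<Rightarrow> real) \<Rightarrow> real^'n \<Rightarrow> real^'n" where
  "grad \<phi> x = (\<chi> i. partial_deriv i \<phi> x)"

lemma grad_component [simp]: "grad \<phi> x $ i = partial_deriv i \<phi> x"
  by (simp add: grad_def)

lemma frechet_derivative_eq_grad: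
  assumes "\<phi> differentiable (at x)"
  shows "frechet_derivative \<phi> (at x) h = grad \<phi> x \<bullet> h"
proof -
  interpret D: linear "frechet_derivative \<phi> (at x)"
    using differentiable_has_derivative[OF assms] has_derivative_linear by blast
  have "h = (\<Sum>i\<in>UNIV. h $ i *\<^sub>R axis i 1)"
    by (simp add: vec_eq_iff axis_def if_distrib cong: if_cong)
  then have "frechet_derivative \<phi> (at x) h = (\<Sum>i\<in>UNIV. h $ i *\<^sub>R frechet_derivative \<phi> (at x) (axis i 1))"
    by (metis (no_types, lifting) D.sum D.scaleR sum.cong)
  then show ?thesis by (simp add: inner_vec_def partial_deriv_def mult.commute)
qed

lemma has_real_derivative_along_line:
  assumes "\<And>x. \<phi> differentiable (at x)"
  shows "((\<lambda>s. \<phi> (x + s *\<^sub>R h)) has_real_derivative grad \<phi> (x + s *\<^sub>R h) \<bullet> h) (at s)"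
proof -
  have "((\<lambda>s. x + s *\<^sub>R h) has_derivative (\<lambda>s. s *\<^sub>R h)) (at s)"
    by (auto intro!: derivative_eq_intros)
  from has_derivative_compose[OF this differentiable_has_derivative[OF assms]]
  show ?thesis
    by (simp add: has_field_derivative_def frechet_derivative_eq_grad[OF assms] mult_commute_abs)
qed

section \<open>Test functions\<close>

lemma
  assumes "\<phi> \<in> test_functions \<Omega>"
  shows test_Ck: "Ck k \<phi>"
    and test_compact: "compact (closure {x. \<phi> x \<noteq> 0})"
    and test_support: "closure {x. \<phi> x \<noteq> 0} \<subseteq> \<Omega>"
  using assms by (auto simp: test_functions_def)

lemma test_differentiable: "\<phi> \<in> test_functions \<Omega> \<Longrightarrow> \<phi> differentiable (at x)"
  using test_Ck[of \<phi> \<Omega> "Suc 0"] by simp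

lemma test_continuous: "\<phi> \<in> test_functions \<Omega> \<Longrightarrow> continuous_on UNIV \<phi>"
  using test_Ck[of \<phi> \<Omega> 0] by simp

lemma test_zero_outside: "\<phi> \<in> test_functions \<Omega> \<Longrightarrow> x \<notin> \<Omega> \<Longrightarrow> \<phi> x = 0"
  using test_support[of \<phi> \<Omega>] closure_subset[of "{x. \<phi> x \<noteq> 0}"] by auto

lemma test_functionsI:
  assumes "\<And>k. Ck k \<psi>" "compact K" "K \<subseteq> \<Omega>" "\<And>x. x \<notin> K \<Longrightarrow> \<psi> x = 0"
  shows "\<psi> \<in> test_functions \<Omega>"
proof -
  have "closure {x. \<psi> x \<noteq> 0} \<subseteq> K"
    using assms(2,4) by (intro closure_minimal compact_imp_closed) auto
  moreover from this have "compact (closure {x. \<psi> x \<noteq> 0})"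
    using assms(2) by (meson bounded_subset closed_closure compact_eq_bounded_closed)
  ultimately show ?thesis using assms(1,3) by (auto simp: test_functions_def)
qed

lemma test_functions_sub_support:
  assumes \<phi>: "\<phi> \<in> test_functions \<Omega>" and "\<And>k. Ck k \<psi>" "\<And>x. \<phi> x = 0 \<Longrightarrow> \<psi> x = 0"
  shows "\<psi> \<in> test_functions \<Omega>"
  by (rule test_functionsI[OF assms(2) test_compact[OF \<phi>] test_support[OF \<phi>]])
     (use assms(3) closure_subset[of "{x. \<phi> x \<noteq> 0}"] in auto)

lemma test_mult:
  assumes "\<phi> \<in> test_functions \<Omega>" "\<psi> \<in> test_functions \<Omega>"
  shows "(\<lambda>x. \<phi> x * \<psi> x) \<in> test_functions \<Omega>"
  by (rule test_functions_sub_support[OF assms(1)]) (auto intro!: Ck_mult assms[THEN test_Ck])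

lemma test_cmult:
  assumes "\<phi> \<in> test_functions \<Omega>"
  shows "(\<lambda>x. c * \<phi> x) \<in> test_functions \<Omega>"
  by (rule test_functions_sub_support[OF assms(1)]) (auto intro!: Ck_mult Ck_const test_Ck[OF assms])

lemma test_flat:
  assumes "\<phi> \<in> test_functions \<Omega>"
  shows "(\<lambda>x. flat m (\<phi> x)) \<in> test_functions \<Omega>"
  by (rule test_functions_sub_support[OF assms(1)]) (auto intro!: Ck_flat test_Ck[OF assms])

lemma test_add:
  assumes "\<phi> \<in> test_functions \<Omega>" "\<psi> \<in> test_functions \<Omega>"
  shows "(\<lambda>x. \<phi> x + \<psi> x) \<in> test_functions \<Omega>"
proof (rule test_functionsI)
  let ?K = "closure {x. \<phi> x \<noteq> 0} \<union> closure {x. \<psi> x \<noteq> 0}"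
  show "compact ?K" "?K \<subseteq> \<Omega>" using assms test_compact test_support by (blast intro: compact_Un)+
  show "\<phi> x + \<psi> x = 0" if "x \<notin> ?K" for x
  proof -
    have "\<phi> x = 0" "\<psi> x = 0"
      using that closure_subset[of "{x. \<phi> x \<noteq> 0}"] closure_subset[of "{x. \<psi> x \<noteq> 0}"] by blast+
    then show ?thesis by simp
  qed
qed (intro Ck_add assms[THEN test_Ck])

lemma partial_deriv_zero_outside_support:
  assumes "x \<notin> closure {x. \<phi> x \<noteq> 0}"
  shows "partial_deriv i \<phi> x = 0"
proof -
  have "((\<lambda>_. 0) has_derivative (\<lambda>_. 0)) (at x)" by simp
  then have "(\<phi> has_derivative (\<lambda>_. 0)) (at x)"
    by (rule has_derivative_transform_within_open[of _ _ _ _ "- closure {x. \<phi> x \<noteq> 0}"])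
       (use assms closure_subset[of "{x. \<phi> x \<noteq> 0}"] in auto)
  from partial_deriv_eqI[OF this] show ?thesis by simp
qed

lemma test_partial_deriv:
  assumes "\<phi> \<in> test_functions \<Omega>"
  shows "partial_deriv i \<phi> \<in> test_functions \<Omega>"
proof (rule test_functionsI[OF _ test_compact[OF assms] test_support[OF assms]])
  show "Ck k (partial_deriv i \<phi>)" for k using test_Ck[OF assms, of "Suc k"] by simp
qed (rule partial_deriv_zero_outside_support)

lemma grad_zero_outside: "\<phi> \<in> test_functions \<Omega> \<Longrightarrow> x \<notin> \<Omega> \<Longrightarrow> grad \<phi> x = 0"
  by (simp add: vec_eq_iff test_zero_outside[OF test_partial_deriv])

lemma grad_add:
  "\<phi> \<in> test_functions \<Omega> \<Longrightarrow> \<psi> \<in> test_functions \<Omega> \<Longrightarrow>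
    grad (\<lambda>x. \<phi> x + \<psi> x) x = grad \<phi> x + grad \<psi> x"
  by (simp add: vec_eq_iff partial_deriv_add test_differentiable)

lemma grad_cmult:
  fixes \<phi> :: "real^'n \<Rightarrow> real"
  assumes "\<phi> \<in> test_functions \<Omega>"
  shows "grad (\<lambda>x. c * \<phi> x) x = c *\<^sub>R grad \<phi> x"
proof -
  have "partial_deriv i (\<lambda>x. c) x = 0" for i and x :: "real^'n"
    using partial_deriv_eqI[of "\<lambda>x. c" "\<lambda>_. 0"] by simp
  then show ?thesis
    using partial_deriv_mult[of "\<lambda>x. c" x \<phi>] test_differentiable[OF assms]
    by (simp add: vec_eq_iff)
qed

lemma grad_flat:
  "\<phi> \<in> test_functions \<Omega> \<Longrightarrow>
    grad (\<lambda>x. flat 0 (\<phi> x)) x = (flat 1 (\<phi> x) + flat 2 (\<phi> x)) *\<^sub>R grad \<phi> x"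
  by (simp add: vec_eq_iff partial_deriv_flat test_differentiable numeral_2_eq_2)

lemma continuous_on_grad: "\<phi> \<in> test_functions \<Omega> \<Longrightarrow> continuous_on UNIV (grad \<phi>)"
  unfolding grad_def by (intro continuous_on_vec_lambda test_continuous[OF test_partial_deriv])

lemma bounded_of_compact_support:
  fixes f :: "real^'n \<Rightarrow> 'b::euclidean_space"
  assumes "continuous_on UNIV f" "compact K" "\<And>x. x \<notin> K \<Longrightarrow> f x = 0"
  obtains B where "0 \<le> B" "\<And>x. norm (f x) \<le> B"
proof -
  have "bounded (f ` K)"
    using assms(1,2) by (meson compact_continuous_image compact_imp_bounded continuous_on_subset subset_UNIV)
  then obtain B where B: "\<And>x. x \<in> K \<Longrightarrow> norm (f x) \<le> B" by (auto simp: bounded_iff)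
  show ?thesis
    by (rule that[of "max 0 B"]) (use B assms(3) in \<open>force simp: le_max_iff_disj\<close>)+
qed

lemma integrable_lborel_of_compact_support:
  fixes f :: "real^'n \<Rightarrow> 'b::euclidean_space"
  assumes "continuous_on UNIV f" "compact K" "\<And>x. x \<notin> K \<Longrightarrow> f x = 0"
  shows "integrable lborel f"
proof -
  have "integrable lborel (\<lambda>x. indicator K x *\<^sub>R f x)"
    using assms(1,2) by (intro borel_integrable_compact) (auto intro: continuous_on_subset)
  moreover have "(\<lambda>x. indicator K x *\<^sub>R f x) = f" using assms(3) by (auto simp: indicator_def)
  ultimately show ?thesis by simp
qed

lemma integral_lebesgue_on_eq_lborel:
  fixes f :: "real^'n \<Rightarrow> 'b::euclidean_space"
  assumes "open \<Omega>" and c: "f \<in> borel_measurable borel" and "\<And>x. x \<notin> \<Omega> \<Longrightarrow> f x = 0"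
  shows "(\<integral>x. f x \<partial>lebesgue_on \<Omega>) = (\<integral>x. f x \<partial>lborel)"
proof -
  have "(\<integral>x. f x \<partial>lebesgue_on \<Omega>) = (\<integral>x. indicator \<Omega> x *\<^sub>R f x \<partial>lebesgue)"
    using assms(1) by (intro integral_restrict_space) auto
  also have "(\<lambda>x. indicator \<Omega> x *\<^sub>R f x) = f" using assms(3) by (auto simp: indicator_def)
  also have "(\<integral>x. f x \<partial>lebesgue) = (\<integral>x. f x \<partial>lborel)"
    using c by (intro integral_completion) simp
  finally show ?thesis .
qed

lemma borel_measurable_lebesgue_on:
  fixes f :: "real^'n \<Rightarrow> 'b::euclidean_space"
  assumes "f \<in> borel_measurable borel"
  shows "f \<in> borel_measurable (lebesgue_on \<Omega>)"
  by (intro measurable_restrict_space1 measurable_completion) (use assms in simp)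

lemma L2_of_compact_support:
  fixes f :: "real^'n \<Rightarrow> 'b::euclidean_space"
  assumes "\<Omega> \<in> lmeasurable" "continuous_on UNIV f" "compact K" "\<And>x. x \<notin> K \<Longrightarrow> f x = 0"
  shows "f \<in> L2 \<Omega>"
proof -
  obtain B where "\<And>x. norm (f x) \<le> B"
    using bounded_of_compact_support[OF assms(2-4)] by blast
  then show ?thesis
    by (intro L2_bounded assms(1) borel_measurable_lebesgue_on borel_measurable_continuous_onI assms(2))
qed

lemma test_L2:
  assumes "\<Omega> \<in> lmeasurable" "\<phi> \<in> test_functions \<Omega>"
  shows "\<phi> \<in> L2 \<Omega>"
  by (rule L2_of_compact_support[OF assms(1) test_continuous[OF assms(2)] test_compact[OF assms(2)]])
     (use closure_subset[of "{x. \<phi> x \<noteq> 0}"] in auto)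

lemma grad_L2:
  assumes "\<Omega> \<in> lmeasurable" "\<phi> \<in> test_functions \<Omega>"
  shows "grad \<phi> \<in> L2 \<Omega>"
  by (rule L2_of_compact_support[OF assms(1) continuous_on_grad[OF assms(2)] test_compact[OF assms(2)]])
     (auto simp: vec_eq_iff partial_deriv_zero_outside_support)

text \<open>The difference quotients of \<open>\<zeta>\<close> have integral zero, by translation invariance, and they
  converge boundedly to the partial derivative.\<close>

lemma integral_partial_deriv_eq_0:
  fixes \<zeta> :: "real^'n \<Rightarrow> real"
  assumes \<zeta>: "\<zeta> \<in> test_functions \<Omega>"
  shows "(\<integral>x. partial_deriv i \<zeta> x \<partial>lborel) = 0"
proof -
  let ?e = "axis i 1 :: real^'n"
  define h :: "nat \<Rightarrow> real" where "h n = inverse (real (Suc n))" for n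
  have h: "h n > 0" "h n \<le> 1" for n by (auto simp: h_def divide_simps)
  define K where "K = closure {x. \<zeta> x \<noteq> 0}"
  have K: "compact K" "\<And>x. x \<notin> K \<Longrightarrow> \<zeta> x = 0"
    using test_compact[OF \<zeta>] closure_subset[of "{x. \<zeta> x \<noteq> 0}"] by (auto simp: K_def)
  define K' where "K' = {x + y |x y. x \<in> K \<and> y \<in> cball 0 1}"
  have K': "compact K'" unfolding K'_def by (intro compact_sums K compact_cball)
  obtain B where B: "0 \<le> B" "\<And>x. norm (partial_deriv i \<zeta> x) \<le> B"
    using bounded_of_compact_support[OF test_continuous[OF test_partial_deriv[OF \<zeta>]] K(1)]
    by (metis K_def partial_deriv_zero_outside_support)
  have diff: "\<zeta> differentiable (at x)" for x by (rule test_differentiable[OF \<zeta>])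
  have line: "((\<lambda>s. \<zeta> (x + s *\<^sub>R ?e)) has_real_derivative partial_deriv i \<zeta> (x + s *\<^sub>R ?e)) (at s)" for x s
    using has_real_derivative_along_line[OF diff, of x ?e s] by (simp add: inner_axis)
  define q where "q n x = (\<zeta> (x + h n *\<^sub>R ?e) - \<zeta> x) / h n" for n x
  have cont: "continuous_on UNIV \<zeta>" by (rule test_continuous[OF \<zeta>])
  have m: "\<zeta> \<in> borel_measurable borel" by (rule borel_measurable_continuous_onI[OF cont])
  have i1: "integrable lborel \<zeta>" by (rule integrable_lborel_of_compact_support[OF cont K])
  have i2: "integrable lborel (\<lambda>x. \<zeta> (x + c))" and e2: "(\<integral>x. \<zeta> (x + c) \<partial>lborel) = (\<integral>x. \<zeta> x \<partial>lborel)" for c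
  proof -
    have "integrable (distr lborel borel ((+) c)) \<zeta>" using i1 by (simp add: lborel_distr_plus)
    then show "integrable lborel (\<lambda>x. \<zeta> (x + c))"
      by (subst (asm) integrable_distr_eq) (use m in \<open>auto simp: add.commute\<close>)
    have "(\<integral>x. \<zeta> x \<partial>lborel) = (\<integral>x. \<zeta> x \<partial>distr lborel borel ((+) c))" by (simp add: lborel_distr_plus)
    also have "\<dots> = (\<integral>x. \<zeta> (c + x) \<partial>lborel)" by (subst integral_distr) (use m in auto)
    finally show "(\<integral>x. \<zeta> (x + c) \<partial>lborel) = (\<integral>x. \<zeta> x \<partial>lborel)" by (simp add: add.commute)
  qed
  have "(\<integral>x. q n x \<partial>lborel) = 0" for n
    unfolding q_def using i1 i2 e2 by simp
  moreover have "(\<lambda>n. \<integral>x. q n x \<partial>lborel) \<longlonglongrightarrow> (\<integral>x. partial_deriv i \<zeta> x \<partial>lborel)"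
  proof (rule integral_dominated_convergence[where w="\<lambda>x. indicator K' x *\<^sub>R B"])
    show "integrable lborel (\<lambda>x. indicator K' x *\<^sub>R B)"
      using K' by (intro borel_integrable_compact continuous_intros)
    show "AE x in lborel. (\<lambda>n. q n x) \<longlonglongrightarrow> partial_deriv i \<zeta> x"
    proof (rule AE_I2)
      fix x
      have "((\<lambda>s. (\<zeta> (x + s *\<^sub>R ?e) - \<zeta> x) / s) \<longlongrightarrow> partial_deriv i \<zeta> x) (at 0)"
        using line[of x 0] by (simp add: DERIV_def)
      moreover have "h \<longlonglongrightarrow> 0" unfolding h_def by (rule LIMSEQ_inverse_real_of_nat)
      then have "filterlim h (at 0) sequentially"
        using h(1) by (auto simp: filterlim_at intro!: always_eventually less_imp_neq[symmetric] dest: spec)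
      ultimately show "(\<lambda>n. q n x) \<longlonglongrightarrow> partial_deriv i \<zeta> x"
        unfolding q_def by (rule filterlim_compose)
    qed
    show "AE x in lborel. norm (q n x) \<le> indicator K' x *\<^sub>R B" for n
    proof (rule AE_I2)
      fix x
      obtain z where z: "\<zeta> (x + h n *\<^sub>R ?e) - \<zeta> (x + 0 *\<^sub>R ?e) = (h n - 0) * partial_deriv i \<zeta> (x + z *\<^sub>R ?e)"
        using MVT2[OF h(1)[of n], of "\<lambda>s. \<zeta> (x + s *\<^sub>R ?e)" "\<lambda>s. partial_deriv i \<zeta> (x + s *\<^sub>R ?e)"] line by metis
      then have le: "norm (q n x) \<le> B" using h(1)[of n] B(2)[of "x + z *\<^sub>R ?e"] by (simp add: q_def)
      have "q n x = 0" if "x \<notin> K'"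
      proof -
        have "x \<notin> K" using that by (force simp: K'_def)
        moreover have "x + h n *\<^sub>R ?e \<notin> K"
        proof
          assume a: "x + h n *\<^sub>R ?e \<in> K"
          have "- (h n *\<^sub>R ?e) \<in> cball 0 1" using h[of n] by (simp add: norm_axis_1)
          moreover have "x = (x + h n *\<^sub>R ?e) + - (h n *\<^sub>R ?e)" by simp
          ultimately have "x \<in> K'" unfolding K'_def using a by blast
          with that show False by simp
        qed
        ultimately show ?thesis using K(2) by (simp add: q_def)
      qed
      with le show "norm (q n x) \<le> indicator K' x *\<^sub>R B" by (auto simp: indicator_def)
    qed
    show "partial_deriv i \<zeta> \<in> borel_measurable lborel"
      using test_continuous[OF test_partial_deriv[OF \<zeta>]] by (simp add: borel_measurable_continuous_onI)
    show "q n \<in> borel_measurable lborel" for n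
      unfolding q_def using i1 i2 by measurable
  qed
  ultimately show ?thesis by (simp add: LIMSEQ_const_iff)
qed

lemma has_weak_gradient_grad:
  assumes "open \<Omega>" "\<Omega> \<in> lmeasurable" and \<phi>: "\<phi> \<in> test_functions \<Omega>"
  shows "has_weak_gradient \<Omega> \<phi> (grad \<phi>)"
  unfolding has_weak_gradient_def
proof (intro ballI allI)
  fix \<psi> i assume \<psi>: "\<psi> \<in> test_functions \<Omega>"
  have t: "(\<lambda>x. \<phi> x * \<psi> x) \<in> test_functions \<Omega>" by (rule test_mult[OF \<phi> \<psi>])
  have "0 = (\<integral>x. partial_deriv i (\<lambda>x. \<phi> x * \<psi> x) x \<partial>lborel)"
    using integral_partial_deriv_eq_0[OF t] by simp
  also have "\<dots> = (\<integral>x. partial_deriv i (\<lambda>x. \<phi> x * \<psi> x) x \<partial>lebesgue_on \<Omega>)"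
    by (rule integral_lebesgue_on_eq_lborel[symmetric, OF assms(1)
          borel_measurable_continuous_onI[OF test_continuous[OF test_partial_deriv[OF t]]]
          test_zero_outside[OF test_partial_deriv[OF t]]])
  also have "\<dots> = (\<integral>x. \<phi> x * partial_deriv i \<psi> x + partial_deriv i \<phi> x * \<psi> x \<partial>lebesgue_on \<Omega>)"
    using \<phi> \<psi> by (simp add: partial_deriv_mult test_differentiable)
  also have "\<dots> = (\<integral>x. \<phi> x * partial_deriv i \<psi> x \<partial>lebesgue_on \<Omega>) + (\<integral>x. partial_deriv i \<phi> x * \<psi> x \<partial>lebesgue_on \<Omega>)"
    using assms(2) \<phi> \<psi>
    by (intro Bochner_Integration.integral_add L2_integrable_mult test_L2 test_partial_deriv)
  finally show "(\<integral>x. \<phi> x * partial_deriv i \<psi> x \<partial>lebesgue_on \<Omega>) = - (\<integral>x. grad \<phi> x $ i * \<psi> x \<partial>lebesgue_on \<Omega>)"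
    by simp
qed

section \<open>Uniqueness of weak gradients\<close>

text \<open>With \<open>b\<close> a product of one-dimensional smooth bumps, positive exactly on the open box,
  \<open>exp (- 1 / (n b))\<close> increases to the indicator function of the box.\<close>

lemma test_functions_approximate_box:
  fixes a b :: "real^'n"
  assumes "cbox a b \<subseteq> \<Omega>"
  obtains \<psi> :: "nat \<Rightarrow> real^'n \<Rightarrow> real" where "\<And>n. \<psi> n \<in> test_functions \<Omega>" "\<And>n x. \<bar>\<psi> n x\<bar> \<le> 1"
    "\<And>x. (\<lambda>n. \<psi> n x) \<longlonglongrightarrow> indicator (box a b) x"
proof -
  define p :: "real^'n \<Rightarrow> real" where "p x = (\<Prod>j\<in>UNIV. flat 0 (x $ j + - a $ j) * flat 0 (b $ j + - 1 * x $ j))" for x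
  have p: "Ck k p" for k
    unfolding p_def by (intro Ck_prod Ck_mult Ck_flat Ck_add Ck_const Ck_component) simp
  have p0: "0 \<le> p x" for x unfolding p_def by (intro prod_nonneg) (simp add: flat_nonneg)
  have pin: "0 < p x" if "x \<in> box a b" for x
    unfolding p_def using that by (intro prod_pos) (auto simp: mem_box_cart intro!: mult_pos_pos flat_pos)
  have pout: "p x = 0" if "x \<notin> box a b" for x
  proof -
    obtain j where "x $ j \<le> a $ j \<or> b $ j \<le> x $ j" using \<open>x \<notin> box a b\<close> by (auto simp: mem_box_cart not_less)
    then have "flat 0 (x $ j + - a $ j) * flat 0 (b $ j + - 1 * x $ j) = 0" by auto
    then show ?thesis unfolding p_def by (intro prod_zero) auto
  qed
  define \<psi> where "\<psi> n x = flat 1 (real n * p x)" for n x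
  show ?thesis
  proof (rule that[of \<psi>])
    show "\<psi> n \<in> test_functions \<Omega>" for n
    proof (rule test_functionsI[OF _ compact_cbox assms])
      show "Ck k (\<psi> n)" for k unfolding \<psi>_def by (intro Ck_flat Ck_mult Ck_const p)
      show "\<psi> n x = 0" if "x \<notin> cbox a b" for x
      proof -
        have "p x = 0" using that box_subset_cbox[of a b] by (intro pout) blast
        then show ?thesis by (simp add: \<psi>_def)
      qed
    qed
    show "\<bar>\<psi> n x\<bar> \<le> 1" for n x by (simp add: \<psi>_def flat_one)
    show "(\<lambda>n. \<psi> n x) \<longlonglongrightarrow> indicator (box a b) x" for x
    proof (cases "x \<in> box a b")
      case True
      have "(\<lambda>n. 1 / (real n * p x)) \<longlonglongrightarrow> 0"
        using tendsto_mult[OF lim_inverse_n tendsto_const[of "1 / p x"]] by (simp add: field_simps)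
      then have "(\<lambda>n. exp (- (1 / (real n * p x)))) \<longlonglongrightarrow> exp (- 0)" by (intro tendsto_intros)
      then have "(\<lambda>n. \<psi> n x) \<longlonglongrightarrow> exp (- 0)"
        by (rule Lim_transform_eventually)
           (use pin[OF True] in \<open>auto simp: \<psi>_def flat_one intro!: eventually_mono[OF eventually_gt_at_top[of 0]]\<close>)
      with True show ?thesis by simp
    qed (simp add: \<psi>_def pout)
  qed
qed

lemma L2_integrable:
  fixes u :: "real^'n \<Rightarrow> real"
  assumes "\<Omega> \<in> lmeasurable" "u \<in> L2 \<Omega>"
  shows "integrable (lebesgue_on \<Omega>) u"
proof -
  have "(\<lambda>x. 1::real) \<in> L2 \<Omega>" by (rule L2_bounded[OF assms(1), where C=1]) auto
  from L2_integrable_mult[OF assms(2) this] show ?thesis by simp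
qed

text \<open>The open boxes form an intersection stable generator of the Borel sets, so by Dynkin's theorem
  the integral of \<open>h\<close> over every Borel set vanishes. Passing to a Borel representative makes this
  enough to conclude.\<close>

lemma AE_zero_if_integrals_over_boxes_vanish:
  fixes h :: "real^'n \<Rightarrow> real"
  assumes h: "integrable lebesgue h"
    and box0: "\<And>c d. (\<integral>x. indicator (box c d) x * h x \<partial>lebesgue) = 0"
    and all0: "(\<integral>x. h x \<partial>lebesgue) = 0"
  shows "AE x in lebesgue. h x = 0"
proof -
  obtain h' where h'[measurable]: "h' \<in> borel_measurable lborel" and ae: "AE x in lborel. h x = h' x"
    using completion_ex_borel_measurable_real[OF borel_measurable_integrable[OF h]] by blast
  have ae': "AE x in lebesgue. h x = h' x" by (rule AE_completion[OF ae])
  have ml: "h' \<in> borel_measurable lebesgue" by (rule measurable_completion[OF h'])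
  have mh: "h \<in> borel_measurable lebesgue" by (rule borel_measurable_integrable[OF h])
  have "integrable lebesgue h'"
  proof (rule Bochner_Integration.integrable_bound[OF h ml])
    show "AE x in lebesgue. norm (h' x) \<le> norm (h x)" using ae' by eventually_elim simp
  qed
  then have h'i: "integrable lborel h'" by (simp add: integrable_completion)
  have eq: "(\<integral>x\<in>B. h' x \<partial>lborel) = (\<integral>x. indicator B x * h x \<partial>lebesgue)" if "B \<in> sets borel" for B
  proof -
    have "(\<integral>x\<in>B. h' x \<partial>lborel) = (\<integral>x. indicator B x *\<^sub>R h' x \<partial>lebesgue)"
      unfolding set_lebesgue_integral_def using that by (subst integral_completion) auto
    also have "\<dots> = (\<integral>x. indicator B x * h x \<partial>lebesgue)"
    proof (rule integral_cong_AE)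
      have i: "indicat_real B \<in> borel_measurable lebesgue"
        by (rule borel_measurable_indicator) (use that in simp)
      show "(\<lambda>x. indicator B x *\<^sub>R h' x) \<in> borel_measurable lebesgue"
        "(\<lambda>x. indicator B x * h x) \<in> borel_measurable lebesgue"
        using borel_measurable_times[OF i ml] borel_measurable_times[OF i mh] by simp_all
      show "AE x in lebesgue. indicator B x *\<^sub>R h' x = indicator B x * h x"
        using ae' by eventually_elim simp
    qed
    finally show ?thesis .
  qed
  have int0: "(\<integral>x\<in>B. h' x \<partial>lborel) = 0" if "B \<in> sets borel" for B :: "(real^'n) set"
  proof -
    have si: "set_integrable lborel C h'" if "C \<in> sets borel" for C
      unfolding set_integrable_def using that h'i by (intro integrable_mult_indicator) auto
    have stable: "Int_stable (range (\<lambda>(a, b). box a b :: (real^'n) set))"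
      by (auto simp: Int_stable_def box_Int_box)
    have "B \<in> sigma_sets UNIV (range (\<lambda>(a, b). box a b))"
      using that by (simp add: borel_eq_box)
    with stable subset_UNIV[of "range (\<lambda>(a, b). box a b :: (real^'n) set)", folded Pow_UNIV]
    show ?thesis
    proof (induction B rule: sigma_sets_induct_disjoint)
      case (basic A)
      then obtain a b where A: "A = box a b" by auto
      show ?case unfolding A by (subst eq) (auto simp: box0)
    next
      case (compl A)
      have A: "A \<in> sets borel" using compl(1) by (simp add: borel_eq_box)
      have "(\<integral>x\<in>UNIV. h' x \<partial>lborel) = (\<integral>x\<in>A \<union> (UNIV - A). h' x \<partial>lborel)" by simp
      also have "\<dots> = (\<integral>x\<in>A. h' x \<partial>lborel) + (\<integral>x\<in>UNIV - A. h' x \<partial>lborel)"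
        by (rule set_integral_Un) (use A si in auto)
      finally show ?case using compl(2) eq[of UNIV] all0 by simp
    next
      case (union A)
      have A: "A i \<in> sets borel" for i using union(2) by (auto simp: borel_eq_box)
      have "(\<integral>x\<in>(\<Union>i. A i). h' x \<partial>lborel) = (\<Sum>i. \<integral>x\<in>A i. h' x \<partial>lborel)"
        using A union(1) si by (intro lebesgue_integral_countable_add) (auto simp: disjoint_family_on_def)
      then show ?case using union(3) by simp
    qed (auto simp: set_lebesgue_integral_def)
  qed
  have "AE x in lborel. h' x = 0"
    by (rule density_unique_real[OF h'i]) (use int0 in \<open>auto simp: set_lebesgue_integral_def\<close>)
  then have "AE x in lebesgue. h' x = 0" by (rule AE_completion)
  with ae' show ?thesis by eventually_elim simp
qed

text \<open>This is the fundamental lemma of the calculus of variations. Test functions approximate the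
  indicator functions of boxes inside \<open>\<Omega>\<close>, and countably many such boxes cover \<open>\<Omega>\<close>.\<close>

lemma AE_zero_if_orthogonal_to_test_functions:
  fixes g :: "real^'n \<Rightarrow> real"
  assumes \<Omega>: "open \<Omega>" "\<Omega> \<in> lmeasurable" and g: "g \<in> L2 \<Omega>"
    and orth: "\<And>\<psi>. \<psi> \<in> test_functions \<Omega> \<Longrightarrow> (\<integral>x. g x * \<psi> x \<partial>lebesgue_on \<Omega>) = 0"
  shows "AE x in lebesgue_on \<Omega>. g x = 0"
proof -
  have \<Omega>s: "\<Omega> \<inter> space lebesgue \<in> sets lebesgue" using \<Omega> by auto
  have gi: "integrable (lebesgue_on \<Omega>) g" by (rule L2_integrable[OF \<Omega>(2) g])
  have gm: "g \<in> borel_measurable (lebesgue_on \<Omega>)" by (rule L2_measurable[OF g])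
  have ind: "indicat_real (box c d) \<in> borel_measurable (lebesgue_on \<Omega>)" for c d
    by (rule borel_measurable_lebesgue_on) simp
  have in_box: "(\<integral>x. indicator (box c d) x * g x \<partial>lebesgue_on \<Omega>) = 0" if cd: "cbox c d \<subseteq> \<Omega>" for c d
  proof -
    obtain \<psi> :: "nat \<Rightarrow> real^'n \<Rightarrow> real" where \<psi>: "\<And>n. \<psi> n \<in> test_functions \<Omega>" "\<And>n x. \<bar>\<psi> n x\<bar> \<le> 1"
      "\<And>x. (\<lambda>n. \<psi> n x) \<longlonglongrightarrow> indicator (box c d) x"
      using test_functions_approximate_box[OF cd] by blast
    have "(\<lambda>n. \<integral>x. g x * \<psi> n x \<partial>lebesgue_on \<Omega>) \<longlonglongrightarrow> (\<integral>x. g x * indicator (box c d) x \<partial>lebesgue_on \<Omega>)"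
    proof (rule integral_dominated_convergence[where w="\<lambda>x. norm (g x)"])
      show "(\<lambda>x. g x * indicator (box c d) x) \<in> borel_measurable (lebesgue_on \<Omega>)"
        by (rule borel_measurable_times[OF gm ind])
      show "(\<lambda>x. g x * \<psi> n x) \<in> borel_measurable (lebesgue_on \<Omega>)" for n
        by (intro borel_measurable_times gm L2_measurable[OF test_L2[OF \<Omega>(2) \<psi>(1)]])
      show "AE x in lebesgue_on \<Omega>. (\<lambda>n. g x * \<psi> n x) \<longlonglongrightarrow> g x * indicator (box c d) x"
        by (intro AE_I2 tendsto_intros \<psi>(3))
      show "AE x in lebesgue_on \<Omega>. norm (g x * \<psi> n x) \<le> norm (g x)" for n
        using \<psi>(2)[of n] by (intro AE_I2) (simp add: abs_mult mult_left_le)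
    qed (use gi in auto)
    then show ?thesis by (simp add: orth[OF \<psi>(1)] LIMSEQ_const_iff mult.commute)
  qed
  have on_box: "AE x in lebesgue. x \<in> box a b \<longrightarrow> g x = 0" if ab: "cbox a b \<subseteq> \<Omega>" for a b
  proof -
    have sub: "box a b \<subseteq> \<Omega>" using ab box_subset_cbox[of a b] by blast
    define h where "h x = indicator (box a b) x * g x" for x
    have restr: "indicator \<Omega> x *\<^sub>R h x = h x" for x using sub by (auto simp: h_def indicator_def)
    have "integrable (lebesgue_on \<Omega>) h"
      unfolding h_def
    proof (rule Bochner_Integration.integrable_bound[OF gi])
      show "(\<lambda>x. indicator (box a b) x * g x) \<in> borel_measurable (lebesgue_on \<Omega>)"
        by (rule borel_measurable_times[OF ind gm])
      show "AE x in lebesgue_on \<Omega>. norm (indicator (box a b) x * g x) \<le> norm (g x)"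
        by (rule AE_I2) (simp add: indicator_def)
    qed
    then have hi: "integrable lebesgue h"
      by (subst (asm) integrable_restrict_space[OF \<Omega>s]) (simp only: restr)
    have hint: "(\<integral>x. indicator B x * h x \<partial>lebesgue) = (\<integral>x. indicator B x * h x \<partial>lebesgue_on \<Omega>)" for B
    proof -
      have "indicator \<Omega> x *\<^sub>R (indicator B x * h x) = indicator B x * h x" for x
        using restr[of x] by (metis mult.left_commute real_scaleR_def)
      then show ?thesis by (simp only: integral_restrict_space[OF \<Omega>s])
    qed
    have "AE x in lebesgue. h x = 0"
    proof (rule AE_zero_if_integrals_over_boxes_vanish[OF hi])
      fix c d :: "real^'n"
      obtain p q where pq: "box c d \<inter> box a b = box p q" unfolding box_Int_box by blast
      have "indicator (box c d) x * h x = indicator (box p q) x * g x" for x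
        by (simp add: h_def pq[symmetric] indicator_inter_arith)
      moreover have "(\<integral>x. indicator (box p q) x * g x \<partial>lebesgue_on \<Omega>) = 0"
      proof (cases "box p q = {}")
        case False
        then have "closure (box p q) = cbox p q" by (rule closure_box)
        moreover have "closure (box p q) \<subseteq> cbox a b"
          using pq box_subset_cbox[of a b] by (intro closure_minimal) auto
        ultimately show ?thesis using ab by (intro in_box) auto
      qed simp
      ultimately show "(\<integral>x. indicator (box c d) x * h x \<partial>lebesgue) = 0" by (subst hint) simp
    next
      have "(\<integral>x. h x \<partial>lebesgue) = (\<integral>x. h x \<partial>lebesgue_on \<Omega>)" using hint[of UNIV] by simp
      then show "(\<integral>x. h x \<partial>lebesgue) = 0" using in_box[OF ab] by (simp add: h_def)
    qed
    then show ?thesis by eventually_elim (auto simp: h_def)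
  qed
  obtain \<D> where \<D>: "countable \<D>" "\<D> \<subseteq> Pow \<Omega>" "\<And>X. X \<in> \<D> \<Longrightarrow> \<exists>a b. X = cbox a b" "\<Union>\<D> = \<Omega>"
    using open_countable_Union_open_cbox[OF \<Omega>(1)] by blast
  have "AE x in lebesgue. x \<in> X \<longrightarrow> g x = 0" if XD: "X \<in> \<D>" for X
  proof -
    obtain a b where X: "X = cbox a b" using \<D>(3)[OF XD] by blast
    have "cbox a b \<subseteq> \<Omega>" using \<D>(2) XD X by auto
    note on_box[OF this]
    moreover have "AE x in lebesgue. x \<notin> cbox a b - box a b"
      using negligible_frontier_interval[of a b] by (intro AE_not_in) (simp add: negligible_iff_null_sets)
    ultimately show ?thesis unfolding X by eventually_elim auto
  qed
  then have "AE x in lebesgue. \<forall>X\<in>\<D>. x \<in> X \<longrightarrow> g x = 0"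
    by (subst AE_ball_countable[OF \<D>(1)]) blast
  then have "AE x in lebesgue. x \<in> \<Omega> \<longrightarrow> g x = 0"
    by eventually_elim (use \<D>(4) in auto)
  then show ?thesis using \<Omega> by (subst AE_restrict_space_iff) auto
qed

lemma L2_component: "g \<in> L2 \<Omega> \<Longrightarrow> (\<lambda>x. (g x :: real^'m) $ i) \<in> L2 \<Omega>"
  and norm_L2_component_le: "g \<in> L2 \<Omega> \<Longrightarrow> norm_L2 \<Omega> (\<lambda>x. (g x :: real^'m) $ i) \<le> norm_L2 \<Omega> g"
proof -
  assume g: "g \<in> L2 \<Omega>"
  have "(\<lambda>x. g x \<bullet> axis i 1) \<in> borel_measurable (lebesgue_on \<Omega>)"
    using L2_measurable[OF g] by measurable
  then have m: "(\<lambda>x. g x $ i) \<in> borel_measurable (lebesgue_on \<Omega>)" by (simp add: inner_axis)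
  have le: "AE x in lebesgue_on \<Omega>. norm (g x $ i) \<le> norm (g x)"
    by (intro AE_I2) (simp add: component_le_norm_cart)
  from L2_dominated[OF g m le] show "(\<lambda>x. g x $ i) \<in> L2 \<Omega>" "norm_L2 \<Omega> (\<lambda>x. g x $ i) \<le> norm_L2 \<Omega> g"
    by auto
qed

lemma weak_gradient_unique:
  assumes \<Omega>: "open \<Omega>" "\<Omega> \<in> lmeasurable"
    and g: "g \<in> L2 \<Omega>" "has_weak_gradient \<Omega> y g" and h: "h \<in> L2 \<Omega>" "has_weak_gradient \<Omega> y h"
  shows "AE x in lebesgue_on \<Omega>. g x = h x"
proof -
  have "AE x in lebesgue_on \<Omega>. g x $ i - h x $ i = 0" for i
  proof (rule AE_zero_if_orthogonal_to_test_functions[OF \<Omega>])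
    show "(\<lambda>x. g x $ i - h x $ i) \<in> L2 \<Omega>" using g(1) h(1) by (intro L2_diff L2_component)
    fix \<psi> assume \<psi>: "\<psi> \<in> test_functions \<Omega>"
    have i: "integrable (lebesgue_on \<Omega>) (\<lambda>x. u x $ i * \<psi> x)" if "u \<in> L2 \<Omega>" for u :: "real^'a \<Rightarrow> real^'a"
      by (intro L2_integrable_mult L2_component that test_L2[OF \<Omega>(2) \<psi>])
    have "(\<integral>x. g x $ i * \<psi> x \<partial>lebesgue_on \<Omega>) = (\<integral>x. h x $ i * \<psi> x \<partial>lebesgue_on \<Omega>)"
      using g(2) h(2) \<psi> by (simp add: has_weak_gradient_def)
    then show "(\<integral>x. (g x $ i - h x $ i) * \<psi> x \<partial>lebesgue_on \<Omega>) = 0"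
      using i[OF g(1)] i[OF h(1)] by (simp add: left_diff_distrib)
  qed
  then have "AE x in lebesgue_on \<Omega>. \<forall>i\<in>UNIV. g x $ i - h x $ i = 0"
    by (intro AE_finite_allI) auto
  then show ?thesis by eventually_elim (simp add: vec_eq_iff)
qed

section \<open>Functions in \<open>H\<^sup>1\<^sub>0\<close> and their gradients\<close>

text \<open>The graph of the closure of the classical gradient on test functions. It turns out to be the
  graph of the weak gradient on \<open>H\<^sup>1\<^sub>0\<close>, but it is far easier to compute with.\<close>

definition H10_gradient :: "(real^'n) set \<Rightarrow> (real^'n \<Rightarrow> real) \<Rightarrow> (real^'n \<Rightarrow> real^'n) \<Rightarrow> bool" where
  "H10_gradient \<Omega> y g \<longleftrightarrow> y \<in> L2 \<Omega> \<and> g \<in> L2 \<Omega> \<and> (\<exists>\<phi>. (\<forall>n::nat. \<phi> n \<in> test_functions \<Omega>) \<and>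
     L2_converges \<Omega> \<phi> y \<and>
     L2_converges \<Omega> (\<lambda>n. grad (\<phi> n)) g)"

lemma H10_gradient_L2: "H10_gradient \<Omega> y g \<Longrightarrow> y \<in> L2 \<Omega>" "H10_gradient \<Omega> y g \<Longrightarrow> g \<in> L2 \<Omega>"
  by (auto simp: H10_gradient_def)

lemma H10_gradientE:
  assumes "H10_gradient \<Omega> y g"
  obtains \<phi> :: "nat \<Rightarrow> real^'n \<Rightarrow> real" where "\<And>n. \<phi> n \<in> test_functions \<Omega>"
    "L2_converges \<Omega> \<phi> y" "L2_converges \<Omega> (\<lambda>n. grad (\<phi> n)) g"
  using assms by (auto simp: H10_gradient_def)

lemma L2_integral_tendsto:
  fixes v :: "real^'n \<Rightarrow> real"
  assumes u: "\<And>n. u n \<in> L2 \<Omega>" and w: "w \<in> L2 \<Omega>" and v: "v \<in> L2 \<Omega>"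
    and lim: "L2_converges \<Omega> u w"
  shows "(\<lambda>n. \<integral>x. u n x * v x \<partial>lebesgue_on \<Omega>) \<longlonglongrightarrow> (\<integral>x. w x * v x \<partial>lebesgue_on \<Omega>)"
proof (rule LIM_zero_cancel, rule Lim_null_comparison)
  show "(\<lambda>n. norm_L2 \<Omega> (\<lambda>x. w x - u n x) * norm_L2 \<Omega> v) \<longlonglongrightarrow> 0"
    using tendsto_mult_right[OF lim, of "norm_L2 \<Omega> v"] by simp
  show "\<forall>\<^sub>F n in sequentially. norm ((\<integral>x. u n x * v x \<partial>lebesgue_on \<Omega>) - (\<integral>x. w x * v x \<partial>lebesgue_on \<Omega>))
      \<le> norm_L2 \<Omega> (\<lambda>x. w x - u n x) * norm_L2 \<Omega> v"
  proof (rule always_eventually, rule allI)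
    fix n
    have "(\<integral>x. u n x * v x \<partial>lebesgue_on \<Omega>) - (\<integral>x. w x * v x \<partial>lebesgue_on \<Omega>)
        = - (\<integral>x. (w x - u n x) * v x \<partial>lebesgue_on \<Omega>)"
      using L2_integrable_mult[OF u v] L2_integrable_mult[OF w v] by (simp add: left_diff_distrib)
    then show "norm ((\<integral>x. u n x * v x \<partial>lebesgue_on \<Omega>) - (\<integral>x. w x * v x \<partial>lebesgue_on \<Omega>))
      \<le> norm_L2 \<Omega> (\<lambda>x. w x - u n x) * norm_L2 \<Omega> v"
      using L2_Cauchy_Schwarz_mult[OF L2_diff[OF w u] v] by simp
  qed
qed

text \<open>Integration by parts survives \<open>L\<^sup>2\<close> limits, since test functions and their derivatives are
  square integrable.\<close>

lemma H10_gradient_has_weak_gradient: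
  fixes \<Omega> :: "(real^'n) set"
  assumes \<Omega>: "open \<Omega>" "\<Omega> \<in> lmeasurable" and y: "H10_gradient \<Omega> y g"
  shows "has_weak_gradient \<Omega> y g"
  unfolding has_weak_gradient_def
proof (intro ballI allI)
  fix \<psi> i assume \<psi>: "\<psi> \<in> test_functions \<Omega>"
  obtain \<phi> :: "nat \<Rightarrow> real^'n \<Rightarrow> real" where \<phi>: "\<And>n. \<phi> n \<in> test_functions \<Omega>"
    "L2_converges \<Omega> \<phi> y" "L2_converges \<Omega> (\<lambda>n. grad (\<phi> n)) g"
    by (rule H10_gradientE[OF y]) (rule that)
  note L = H10_gradient_L2[OF y]
  have gL: "grad (\<phi> n) \<in> L2 \<Omega>" for n by (rule grad_L2[OF \<Omega>(2) \<phi>(1)])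
  have "(\<lambda>n. norm_L2 \<Omega> (\<lambda>x. g x $ i - grad (\<phi> n) x $ i)) \<longlonglongrightarrow> 0"
  proof (rule Lim_null_comparison[OF _ \<phi>(3)], rule always_eventually, rule allI)
    show "norm (norm_L2 \<Omega> (\<lambda>x. g x $ i - grad (\<phi> n) x $ i)) \<le> norm_L2 \<Omega> (\<lambda>x. g x - grad (\<phi> n) x)" for n
      using norm_L2_component_le[OF L2_diff[OF L(2) gL[of n]], of i] by simp
  qed
  then have "(\<lambda>n. \<integral>x. grad (\<phi> n) x $ i * \<psi> x \<partial>lebesgue_on \<Omega>) \<longlonglongrightarrow> (\<integral>x. g x $ i * \<psi> x \<partial>lebesgue_on \<Omega>)"
    by (intro L2_integral_tendsto L2_component gL L test_L2 \<Omega> \<psi>)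
  moreover have "(\<lambda>n. \<integral>x. \<phi> n x * partial_deriv i \<psi> x \<partial>lebesgue_on \<Omega>)
      \<longlonglongrightarrow> (\<integral>x. y x * partial_deriv i \<psi> x \<partial>lebesgue_on \<Omega>)"
    by (intro L2_integral_tendsto L test_L2 \<Omega> \<phi> test_partial_deriv \<psi>)
  moreover have "(\<integral>x. \<phi> n x * partial_deriv i \<psi> x \<partial>lebesgue_on \<Omega>)
      = - (\<integral>x. grad (\<phi> n) x $ i * \<psi> x \<partial>lebesgue_on \<Omega>)" for n
    using has_weak_gradient_grad[OF \<Omega> \<phi>(1)] \<psi> unfolding has_weak_gradient_def by blast
  ultimately show "(\<integral>x. y x * partial_deriv i \<psi> x \<partial>lebesgue_on \<Omega>) = - (\<integral>x. g x $ i * \<psi> x \<partial>lebesgue_on \<Omega>)"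
    using LIMSEQ_unique[OF _ tendsto_minus] by (simp only:)
qed

lemma weak_gradient_cong_AE:
  assumes \<Omega>: "open \<Omega>" "\<Omega> \<in> lmeasurable" and g: "g \<in> L2 \<Omega>" "has_weak_gradient \<Omega> y g"
  shows "weak_gradient \<Omega> y \<in> L2 \<Omega>" "has_weak_gradient \<Omega> y (weak_gradient \<Omega> y)"
    "AE x in lebesgue_on \<Omega>. weak_gradient \<Omega> y x = g x"
proof -
  have "weak_gradient \<Omega> y \<in> L2 \<Omega> \<and> has_weak_gradient \<Omega> y (weak_gradient \<Omega> y)"
    unfolding weak_gradient_def by (rule someI2[of _ g]) (use g in auto)
  then show "weak_gradient \<Omega> y \<in> L2 \<Omega>" "has_weak_gradient \<Omega> y (weak_gradient \<Omega> y)" by auto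
  then show "AE x in lebesgue_on \<Omega>. weak_gradient \<Omega> y x = g x"
    by (rule weak_gradient_unique[OF \<Omega> _ _ g])
qed

lemma norm_H1_square:
  assumes \<Omega>: "open \<Omega>" "\<Omega> \<in> lmeasurable" and g: "g \<in> L2 \<Omega>" "has_weak_gradient \<Omega> y g"
  shows "(norm_H1 \<Omega> y)\<^sup>2 = (norm_L2 \<Omega> y)\<^sup>2 + (norm_L2 \<Omega> g)\<^sup>2"
proof -
  have "norm_L2 \<Omega> (weak_gradient \<Omega> y) = norm_L2 \<Omega> g"
    by (rule norm_L2_cong_AE) (use weak_gradient_cong_AE[OF assms] g in \<open>auto intro: L2_measurable\<close>)
  then show ?thesis by (simp add: norm_H1_def)
qed

lemma norm_H1_nonneg [simp]: "0 \<le> norm_H1 \<Omega> y"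
  by (simp add: norm_H1_def)

lemma has_weak_gradient_diff:
  fixes g h :: "real^'n \<Rightarrow> real^'n"
  assumes \<Omega>: "\<Omega> \<in> lmeasurable" and y: "y \<in> L2 \<Omega>" "g \<in> L2 \<Omega>" "has_weak_gradient \<Omega> y g"
    and z: "z \<in> L2 \<Omega>" "h \<in> L2 \<Omega>" "has_weak_gradient \<Omega> z h"
  shows "has_weak_gradient \<Omega> (\<lambda>x. y x - z x) (\<lambda>x. g x - h x)"
  unfolding has_weak_gradient_def
proof (intro ballI allI)
  fix \<psi> i assume \<psi>: "\<psi> \<in> test_functions \<Omega>"
  note i = L2_integrable_mult[OF _ test_L2[OF \<Omega> test_partial_deriv[OF \<psi>]]] L2_integrable_mult[OF L2_component test_L2[OF \<Omega> \<psi>]]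
  show "(\<integral>x. (y x - z x) * partial_deriv i \<psi> x \<partial>lebesgue_on \<Omega>) = - (\<integral>x. (g x - h x) $ i * \<psi> x \<partial>lebesgue_on \<Omega>)"
    using y(3) z(3) \<psi> by (simp add: left_diff_distrib i y z has_weak_gradient_def)
qed

text \<open>The norm of \<open>H\<^sup>1\<close> refers to the representative that is chosen for the weak gradient of the
  difference \<open>y - \<phi>\<^sub>n\<close>. By uniqueness this is almost everywhere the difference of the gradients,
  so the two descriptions of convergence agree.\<close>

lemma H10_imp_H10_gradient:
  fixes \<Omega> :: "(real^'n) set"
  assumes \<Omega>: "open \<Omega>" "\<Omega> \<in> lmeasurable" and y: "y \<in> H10 \<Omega>"
  shows "H10_gradient \<Omega> y (weak_gradient \<Omega> y)"
proof -
  obtain \<phi> :: "nat \<Rightarrow> real^'n \<Rightarrow> real" where \<phi>: "\<And>n. \<phi> n \<in> test_functions \<Omega>"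
      "(\<lambda>n. norm_H1 \<Omega> (\<lambda>x. y x - \<phi> n x)) \<longlonglongrightarrow> 0"
    using y by (auto simp: H10_def)
  obtain h where yL: "y \<in> L2 \<Omega>" and h: "h \<in> L2 \<Omega>" "has_weak_gradient \<Omega> y h"
    using y by (auto simp: H10_def H1_def)
  define g where "g = weak_gradient \<Omega> y"
  have g: "g \<in> L2 \<Omega>" "has_weak_gradient \<Omega> y g" using weak_gradient_cong_AE[OF \<Omega> h] by (auto simp: g_def)
  have eq: "(norm_H1 \<Omega> (\<lambda>x. y x - \<phi> n x))\<^sup>2
      = (norm_L2 \<Omega> (\<lambda>x. y x - \<phi> n x))\<^sup>2 + (norm_L2 \<Omega> (\<lambda>x. g x - grad (\<phi> n) x))\<^sup>2" for n
    by (rule norm_H1_square[OF \<Omega> L2_diff[OF g(1) grad_L2[OF \<Omega>(2) \<phi>(1)]] has_weak_gradient_diff[OF \<Omega>(2) yL g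
          test_L2[OF \<Omega>(2) \<phi>(1)] grad_L2[OF \<Omega>(2) \<phi>(1)] has_weak_gradient_grad[OF \<Omega> \<phi>(1)]]])
  have "norm_L2 \<Omega> (\<lambda>x. y x - \<phi> n x) \<le> norm_H1 \<Omega> (\<lambda>x. y x - \<phi> n x)"
    "norm_L2 \<Omega> (\<lambda>x. g x - grad (\<phi> n) x) \<le> norm_H1 \<Omega> (\<lambda>x. y x - \<phi> n x)" for n
    by (rule power2_le_imp_le, simp add: eq, simp)+
  then have "L2_converges \<Omega> \<phi> y" "L2_converges \<Omega> (\<lambda>n. grad (\<phi> n)) g"
    by (auto intro!: Lim_null_comparison[OF _ \<phi>(2)] always_eventually)
  then show ?thesis using \<phi>(1) yL g(1) unfolding g_def H10_gradient_def by blast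
qed

lemma H10_gradient_imp_H10:
  fixes \<Omega> :: "(real^'n) set"
  assumes \<Omega>: "open \<Omega>" "\<Omega> \<in> lmeasurable" and y: "H10_gradient \<Omega> y g"
  shows "y \<in> H10 \<Omega>" "AE x in lebesgue_on \<Omega>. weak_gradient \<Omega> y x = g x"
    "(norm_H1 \<Omega> y)\<^sup>2 = (norm_L2 \<Omega> y)\<^sup>2 + (norm_L2 \<Omega> g)\<^sup>2"
proof -
  note L = H10_gradient_L2[OF y] and w = H10_gradient_has_weak_gradient[OF \<Omega> y]
  obtain \<phi> :: "nat \<Rightarrow> real^'n \<Rightarrow> real" where \<phi>: "\<And>n. \<phi> n \<in> test_functions \<Omega>"
    "L2_converges \<Omega> \<phi> y" "L2_converges \<Omega> (\<lambda>n. grad (\<phi> n)) g"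
    by (rule H10_gradientE[OF y]) (rule that)
  have "(norm_H1 \<Omega> (\<lambda>x. y x - \<phi> n x))\<^sup>2
      = (norm_L2 \<Omega> (\<lambda>x. y x - \<phi> n x))\<^sup>2 + (norm_L2 \<Omega> (\<lambda>x. g x - grad (\<phi> n) x))\<^sup>2" for n
    by (rule norm_H1_square[OF \<Omega> L2_diff[OF L(2) grad_L2[OF \<Omega>(2) \<phi>(1)]] has_weak_gradient_diff[OF \<Omega>(2) L w
          test_L2[OF \<Omega>(2) \<phi>(1)] grad_L2[OF \<Omega>(2) \<phi>(1)] has_weak_gradient_grad[OF \<Omega> \<phi>(1)]]])
  then have "norm_H1 \<Omega> (\<lambda>x. y x - \<phi> n x)
      = sqrt ((norm_L2 \<Omega> (\<lambda>x. y x - \<phi> n x))\<^sup>2 + (norm_L2 \<Omega> (\<lambda>x. g x - grad (\<phi> n) x))\<^sup>2)" for n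
    by (metis norm_H1_nonneg real_sqrt_unique)
  moreover have "(\<lambda>n. sqrt ((norm_L2 \<Omega> (\<lambda>x. y x - \<phi> n x))\<^sup>2 + (norm_L2 \<Omega> (\<lambda>x. g x - grad (\<phi> n) x))\<^sup>2))
      \<longlonglongrightarrow> sqrt (0\<^sup>2 + 0\<^sup>2)"
    by (intro tendsto_intros \<phi>)
  ultimately have "(\<lambda>n. norm_H1 \<Omega> (\<lambda>x. y x - \<phi> n x)) \<longlonglongrightarrow> 0" by simp
  then show "y \<in> H10 \<Omega>" using L w \<phi>(1) unfolding H10_def H1_def by blast
  show "AE x in lebesgue_on \<Omega>. weak_gradient \<Omega> y x = g x" by (rule weak_gradient_cong_AE[OF \<Omega> L(2) w])
  show "(norm_H1 \<Omega> y)\<^sup>2 = (norm_L2 \<Omega> y)\<^sup>2 + (norm_L2 \<Omega> g)\<^sup>2" by (rule norm_H1_square[OF \<Omega> L(2) w])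
qed

lemma norm_L2_tendsto_0_add:
  assumes "\<And>n. u n \<in> L2 \<Omega>" "\<And>n. v n \<in> L2 \<Omega>"
    and "(\<lambda>n. norm_L2 \<Omega> (u n)) \<longlonglongrightarrow> 0" "(\<lambda>n. norm_L2 \<Omega> (v n)) \<longlonglongrightarrow> 0"
  shows "(\<lambda>n. norm_L2 \<Omega> (\<lambda>x. u n x + v n x)) \<longlonglongrightarrow> 0"
  by (rule Lim_null_comparison[OF _ tendsto_add_zero[OF assms(3,4)]])
     (use norm_L2_triangle[OF assms(1,2)] in simp)

text \<open>The closure of a graph is closed: replace each \<open>v n\<close> by a test function at distance at most
  \<open>1 / (n + 1)\<close>.\<close>

lemma H10_gradient_limit:
  fixes \<Omega> :: "(real^'n) set"
  assumes \<Omega>: "\<Omega> \<in> lmeasurable" and v: "\<And>n. H10_gradient \<Omega> (v n) (g n)" and L: "w \<in> L2 \<Omega>" "h \<in> L2 \<Omega>"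
    and lim: "L2_converges \<Omega> v w" "L2_converges \<Omega> g h"
  shows "H10_gradient \<Omega> w h"
proof -
  have "\<exists>\<phi>. \<phi> \<in> test_functions \<Omega> \<and> norm_L2 \<Omega> (\<lambda>x. v n x - \<phi> x) \<le> inverse (real (Suc n)) \<and>
      norm_L2 \<Omega> (\<lambda>x. g n x - grad \<phi> x) \<le> inverse (real (Suc n))" for n
  proof -
    obtain \<phi> :: "nat \<Rightarrow> real^'n \<Rightarrow> real" where \<phi>: "\<And>k. \<phi> k \<in> test_functions \<Omega>"
        "(\<lambda>k. norm_L2 \<Omega> (\<lambda>x. v n x - \<phi> k x)) \<longlonglongrightarrow> 0" "(\<lambda>k. norm_L2 \<Omega> (\<lambda>x. g n x - grad (\<phi> k) x)) \<longlonglongrightarrow> 0"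
      by (rule H10_gradientE[OF v[of n]]) (rule that)
    have p: "0 < inverse (real (Suc n))" by simp
    have "\<forall>\<^sub>F k in sequentially. norm_L2 \<Omega> (\<lambda>x. v n x - \<phi> k x) < inverse (real (Suc n)) \<and>
        norm_L2 \<Omega> (\<lambda>x. g n x - grad (\<phi> k) x) < inverse (real (Suc n))"
      using order_tendstoD(2)[OF \<phi>(2) p] order_tendstoD(2)[OF \<phi>(3) p] by (rule eventually_conj)
    from eventually_happens'[OF sequentially_bot this]
    obtain k where "norm_L2 \<Omega> (\<lambda>x. v n x - \<phi> k x) < inverse (real (Suc n)) \<and>
        norm_L2 \<Omega> (\<lambda>x. g n x - grad (\<phi> k) x) < inverse (real (Suc n))"
      by blast
    with \<phi>(1)[of k] show ?thesis by (intro exI[of _ "\<phi> k"]) auto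
  qed
  from choice[OF allI[OF this]] obtain \<phi> where
    "\<forall>n. \<phi> n \<in> test_functions \<Omega> \<and> norm_L2 \<Omega> (\<lambda>x. v n x - \<phi> n x) \<le> inverse (real (Suc n)) \<and>
      norm_L2 \<Omega> (\<lambda>x. g n x - grad (\<phi> n) x) \<le> inverse (real (Suc n))" ..
  then have \<phi>: "\<And>n. \<phi> n \<in> test_functions \<Omega>"
      "\<And>n. norm_L2 \<Omega> (\<lambda>x. v n x - \<phi> n x) \<le> inverse (real (Suc n))"
      "\<And>n. norm_L2 \<Omega> (\<lambda>x. g n x - grad (\<phi> n) x) \<le> inverse (real (Suc n))"
    by blast+
  note vL = v[THEN H10_gradient_L2(1)] v[THEN H10_gradient_L2(2)]
  note \<phi>L = \<phi>(1)[THEN test_L2[OF \<Omega>]] \<phi>(1)[THEN grad_L2[OF \<Omega>]]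
  have a: "(\<lambda>n. norm_L2 \<Omega> (\<lambda>x. v n x - \<phi> n x)) \<longlonglongrightarrow> 0"
    by (rule Lim_null_comparison[OF _ LIMSEQ_inverse_real_of_nat], rule always_eventually)
       (use \<phi>(2) in \<open>simp del: of_nat_Suc\<close>)
  have b: "(\<lambda>n. norm_L2 \<Omega> (\<lambda>x. g n x - grad (\<phi> n) x)) \<longlonglongrightarrow> 0"
    by (rule Lim_null_comparison[OF _ LIMSEQ_inverse_real_of_nat], rule always_eventually)
       (use \<phi>(3) in \<open>simp del: of_nat_Suc\<close>)
  have "(\<lambda>n. norm_L2 \<Omega> (\<lambda>x. (w x - v n x) + (v n x - \<phi> n x))) \<longlonglongrightarrow> 0"
    by (rule norm_L2_tendsto_0_add[OF L2_diff[OF L(1) vL(1)] L2_diff[OF vL(1) \<phi>L(1)] lim(1) a])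
  moreover have "(\<lambda>n. norm_L2 \<Omega> (\<lambda>x. (h x - g n x) + (g n x - grad (\<phi> n) x))) \<longlonglongrightarrow> 0"
    by (rule norm_L2_tendsto_0_add[OF L2_diff[OF L(2) vL(2)] L2_diff[OF vL(2) \<phi>L(2)] lim(2) b])
  ultimately show ?thesis using \<phi>(1) L unfolding H10_gradient_def by (auto intro!: exI[of _ \<phi>])
qed

lemma H10_gradient_test:
  fixes \<Omega> :: "(real^'n) set"
  assumes "\<Omega> \<in> lmeasurable" "\<phi> \<in> test_functions \<Omega>"
  shows "H10_gradient \<Omega> \<phi> (grad \<phi>)"
  unfolding H10_gradient_def using assms
  by (auto intro!: test_L2 grad_L2 exI[of _ "\<lambda>n. \<phi>"] simp: norm_L2_def)

lemma H10_gradient_add: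
  fixes \<Omega> :: "(real^'n) set"
  assumes \<Omega>: "\<Omega> \<in> lmeasurable" and y: "H10_gradient \<Omega> y g" and z: "H10_gradient \<Omega> z h"
  shows "H10_gradient \<Omega> (\<lambda>x. y x + z x) (\<lambda>x. g x + h x)"
proof -
  obtain \<phi> :: "nat \<Rightarrow> real^'n \<Rightarrow> real" where \<phi>: "\<And>n. \<phi> n \<in> test_functions \<Omega>"
    "L2_converges \<Omega> \<phi> y" "L2_converges \<Omega> (\<lambda>n. grad (\<phi> n)) g"
    by (rule H10_gradientE[OF y]) (rule that)
  obtain \<psi> :: "nat \<Rightarrow> real^'n \<Rightarrow> real" where \<psi>: "\<And>n. \<psi> n \<in> test_functions \<Omega>"
    "L2_converges \<Omega> \<psi> z" "L2_converges \<Omega> (\<lambda>n. grad (\<psi> n)) h"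
    by (rule H10_gradientE[OF z]) (rule that)
  note L = H10_gradient_L2[OF y] H10_gradient_L2[OF z]
  note tL = \<phi>(1)[THEN test_L2[OF \<Omega>]] \<phi>(1)[THEN grad_L2[OF \<Omega>]] \<psi>(1)[THEN test_L2[OF \<Omega>]] \<psi>(1)[THEN grad_L2[OF \<Omega>]]
  have "(\<lambda>n. norm_L2 \<Omega> (\<lambda>x. (y x - \<phi> n x) + (z x - \<psi> n x))) \<longlonglongrightarrow> 0"
    by (rule norm_L2_tendsto_0_add[OF L2_diff[OF L(1) tL(1)] L2_diff[OF L(3) tL(3)] \<phi>(2) \<psi>(2)])
  moreover have "(\<lambda>n. norm_L2 \<Omega> (\<lambda>x. (g x - grad (\<phi> n) x) + (h x - grad (\<psi> n) x))) \<longlonglongrightarrow> 0"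
    by (rule norm_L2_tendsto_0_add[OF L2_diff[OF L(2) tL(2)] L2_diff[OF L(4) tL(4)] \<phi>(3) \<psi>(3)])
  ultimately show ?thesis
    unfolding H10_gradient_def using L \<phi>(1) \<psi>(1)
    by (auto intro!: L2_add exI[of _ "\<lambda>n x. \<phi> n x + \<psi> n x"] test_add simp: grad_add[OF \<phi>(1) \<psi>(1)] algebra_simps)
qed

lemma H10_gradient_cmult:
  fixes \<Omega> :: "(real^'n) set"
  assumes y: "H10_gradient \<Omega> y g"
  shows "H10_gradient \<Omega> (\<lambda>x. c * y x) (\<lambda>x. c *\<^sub>R g x)"
proof -
  obtain \<phi> :: "nat \<Rightarrow> real^'n \<Rightarrow> real" where \<phi>: "\<And>n. \<phi> n \<in> test_functions \<Omega>"
    "L2_converges \<Omega> \<phi> y" "L2_converges \<Omega> (\<lambda>n. grad (\<phi> n)) g"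
    by (rule H10_gradientE[OF y]) (rule that)
  have "(\<lambda>n. norm_L2 \<Omega> (\<lambda>x. c *\<^sub>R (y x - \<phi> n x))) \<longlonglongrightarrow> 0"
    unfolding norm_L2_scaleR by (rule tendsto_mult_right_zero[OF \<phi>(2)])
  moreover have "(\<lambda>n. norm_L2 \<Omega> (\<lambda>x. c *\<^sub>R (g x - grad (\<phi> n) x))) \<longlonglongrightarrow> 0"
    unfolding norm_L2_scaleR by (rule tendsto_mult_right_zero[OF \<phi>(3)])
  ultimately show ?thesis
    unfolding H10_gradient_def using H10_gradient_L2[OF y] \<phi>(1)
    by (auto intro!: L2_cmult L2_scaleR exI[of _ "\<lambda>n x. c * \<phi> n x"] test_cmult
        simp: grad_cmult[OF \<phi>(1)] right_diff_distrib scaleR_right_diff_distrib)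
qed

lemma H10_gradient_diff:
  assumes "\<Omega> \<in> lmeasurable" "H10_gradient \<Omega> y g" "H10_gradient \<Omega> z h"
  shows "H10_gradient \<Omega> (\<lambda>x. y x - z x) (\<lambda>x. g x - h x)"
  using H10_gradient_add[OF assms(1,2) H10_gradient_cmult[OF assms(3), of "-1"]] by simp

section \<open>The positive part\<close>

text \<open>The derivative of \<open>flat 0\<close>.\<close>

abbreviation flat_slope :: "real \<Rightarrow> real" where
  "flat_slope t \<equiv> flat 1 t + flat 2 t"

lemma flat_slope_bounds: "0 \<le> flat_slope t" "flat_slope t \<le> 1"
proof -
  show "0 \<le> flat_slope t" by (simp add: flat_nonneg)
  show "flat_slope t \<le> 1"
  proof (cases "0 < t")
    case True
    have "(1 + 1 / t) * exp (- (1 / t)) \<le> exp (1 / t) * exp (- (1 / t))"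
      by (intro mult_right_mono exp_ge_add_one_self) simp
    also have "\<dots> = 1" by (simp add: exp_minus)
    finally show ?thesis using True by (simp add: flat_def power2_eq_square algebra_simps)
  qed simp
qed

lemma continuous_on_flat_slope: "continuous_on UNIV flat_slope"
  by (intro continuous_on_add continuous_on_flat)

lemma flat_zero_Lipschitz: "\<bar>flat 0 s - flat 0 t\<bar> \<le> \<bar>s - t\<bar>"
proof -
  have "\<bar>flat 0 s - flat 0 t\<bar> \<le> \<bar>s - t\<bar>" if ts: "t < s" for s t
  proof -
    have d: "(flat 0 has_real_derivative flat_slope x) (at x)" for x
      using has_real_derivative_flat[of 0 x] by (simp add: numeral_2_eq_2)
    obtain z where "flat 0 s - flat 0 t = (s - t) * flat_slope z"
      using MVT2[OF ts, of "flat 0" flat_slope] d by blast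
    then show ?thesis using ts flat_slope_bounds[of z]
      by (simp add: abs_mult mult_left_le)
  qed
  from this[of s t] this[of t s] show ?thesis
    by (cases s t rule: linorder_cases) (auto simp: abs_minus_commute)
qed

lemma flat_zero_bounds: "0 \<le> flat 0 t" "flat 0 t \<le> max 0 t" "max 0 t - flat 0 t \<le> 1"
proof -
  show "0 \<le> flat 0 t" by (rule flat_nonneg)
  show "flat 0 t \<le> max 0 t" by (auto simp: flat_def)
  show "max 0 t - flat 0 t \<le> 1"
  proof (cases "0 < t")
    case True
    have "1 - 1 / t \<le> exp (- (1 / t))" using exp_ge_add_one_self[of "- (1 / t)"] by simp
    then have "t * (1 - 1 / t) \<le> t * exp (- (1 / t))" using True by (intro mult_left_mono) auto
    then show ?thesis using True by (simp add: flat_def right_diff_distrib)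
  qed simp
qed

lemma flat_slope_tendsto: "(\<lambda>n. flat_slope (s * real (Suc n))) \<longlonglongrightarrow> indicator {0<..} s"
proof (cases "0 < s")
  case True
  have "(\<lambda>n. 1 / s * (1 / real (Suc n))) \<longlonglongrightarrow> 1 / s * 0"
    by (intro tendsto_mult tendsto_const LIMSEQ_inverse_real_of_nat[unfolded inverse_eq_divide])
  then have l: "(\<lambda>n. 1 / (s * real (Suc n))) \<longlonglongrightarrow> 0" by simp
  have "(\<lambda>n. (1 + 1 / (s * real (Suc n))) * exp (- (1 / (s * real (Suc n))))) \<longlonglongrightarrow> (1 + 0) * exp (- 0)"
    by (intro tendsto_intros l)
  moreover have "flat_slope (s * real (Suc n)) = (1 + 1 / (s * real (Suc n))) * exp (- (1 / (s * real (Suc n))))" for n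
  proof -
    have "0 < s * real (Suc n)" using True by simp
    then show ?thesis using True by (simp add: flat_def power2_eq_square distrib_right del: of_nat_Suc)
  qed
  ultimately show ?thesis using True by simp
next
  case False
  then have "s * real (Suc n) \<le> 0" for n by (simp add: mult_nonpos_nonneg del: of_nat_Suc)
  then show ?thesis using False by (simp del: of_nat_Suc)
qed

text \<open>The chain rule for the smooth positive part. Along a subsequence the approximating test
  functions converge almost everywhere, hence so do the derivatives of the outer function,
  which are bounded.\<close>

lemma H10_gradient_flat:
  fixes \<Omega> :: "(real^'n) set"
  assumes \<Omega>: "\<Omega> \<in> lmeasurable" and y: "H10_gradient \<Omega> y g"
  shows "H10_gradient \<Omega> (\<lambda>x. flat 0 (y x)) (\<lambda>x. flat_slope (y x) *\<^sub>R g x)"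
proof -
  obtain \<phi>' :: "nat \<Rightarrow> real^'n \<Rightarrow> real" where \<phi>': "\<And>n. \<phi>' n \<in> test_functions \<Omega>"
    "L2_converges \<Omega> \<phi>' y" "L2_converges \<Omega> (\<lambda>n. grad (\<phi>' n)) g"
    by (rule H10_gradientE[OF y]) (rule that)
  note L = H10_gradient_L2[OF y]
  obtain r :: "nat \<Rightarrow> nat" where r: "strict_mono r" "AE x in lebesgue_on \<Omega>. (\<lambda>n. y x - \<phi>' (r n) x) \<longlonglongrightarrow> 0"
    using L2_tendsto_AE_subsequence[OF L2_diff[OF L(1) test_L2[OF \<Omega> \<phi>'(1)]] \<phi>'(2)] by blast
  define \<phi> where "\<phi> n = \<phi>' (r n)" for n
  have \<phi>: "\<phi> n \<in> test_functions \<Omega>" for n using \<phi>' by (simp add: \<phi>_def)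
  have lim: "L2_converges \<Omega> \<phi> y" "L2_converges \<Omega> (\<lambda>n. grad (\<phi> n)) g"
    unfolding \<phi>_def using LIMSEQ_subseq_LIMSEQ[OF \<phi>'(2) r(1)] LIMSEQ_subseq_LIMSEQ[OF \<phi>'(3) r(1)]
    by (auto simp: o_def)
  have ae: "AE x in lebesgue_on \<Omega>. (\<lambda>n. \<phi> n x) \<longlonglongrightarrow> y x"
    using r(2)
  proof eventually_elim
    case (elim x)
    from tendsto_diff[OF tendsto_const[of "y x"] elim] show ?case by (simp add: \<phi>_def)
  qed
  note \<phi>L = \<phi>[THEN test_L2[OF \<Omega>]] \<phi>[THEN grad_L2[OF \<Omega>]]
  have ms: "(\<lambda>x. flat_slope (u x)) \<in> borel_measurable (lebesgue_on \<Omega>)" if "u \<in> L2 \<Omega>" for u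
    using measurable_compose[OF L2_measurable[OF that] borel_measurable_continuous_onI[OF continuous_on_flat_slope]] .
  have mf: "(\<lambda>x. flat 0 (u x)) \<in> borel_measurable (lebesgue_on \<Omega>)" if "u \<in> L2 \<Omega>" for u
    using measurable_compose[OF L2_measurable[OF that] borel_measurable_continuous_onI[OF continuous_on_flat]] .
  have fL: "(\<lambda>x. flat 0 (u x)) \<in> L2 \<Omega>" if "u \<in> L2 \<Omega>" for u
  proof (rule L2_dominated(1)[OF that mf[OF that]], rule AE_I2)
    show "norm (flat 0 (u x)) \<le> norm (u x)" for x
      using flat_zero_bounds[of "u x"] by auto
  qed
  have sL: "(\<lambda>x. flat_slope (u x) *\<^sub>R h x) \<in> L2 \<Omega>"
    and sle: "norm_L2 \<Omega> (\<lambda>x. flat_slope (u x) *\<^sub>R h x) \<le> norm_L2 \<Omega> h"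
    if u: "u \<in> L2 \<Omega>" and h: "h \<in> L2 \<Omega>" for u and h :: "real^'n \<Rightarrow> real^'n"
  proof -
    have m: "(\<lambda>x. flat_slope (u x) *\<^sub>R h x) \<in> borel_measurable (lebesgue_on \<Omega>)"
      by (intro borel_measurable_scaleR ms u L2_measurable h)
    have b: "AE x in lebesgue_on \<Omega>. norm (flat_slope (u x) *\<^sub>R h x) \<le> norm (h x)"
    proof (rule AE_I2)
      fix x show "norm (flat_slope (u x) *\<^sub>R h x) \<le> norm (h x)"
        using mult_right_mono[OF flat_slope_bounds(2)[of "u x"], of "norm (h x)"] flat_slope_bounds(1)[of "u x"]
        by (simp add: abs_of_nonneg)
    qed
    from L2_dominated[OF h m b] show "(\<lambda>x. flat_slope (u x) *\<^sub>R h x) \<in> L2 \<Omega>"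
      "norm_L2 \<Omega> (\<lambda>x. flat_slope (u x) *\<^sub>R h x) \<le> norm_L2 \<Omega> h" by auto
  qed
  show ?thesis
  proof (rule H10_gradient_limit[OF \<Omega> _ fL[OF L(1)] sL[OF L]])
    show "H10_gradient \<Omega> (\<lambda>x. flat 0 (\<phi> n x)) (\<lambda>x. flat_slope (\<phi> n x) *\<^sub>R grad (\<phi> n) x)" for n
      using H10_gradient_test[OF \<Omega> test_flat[OF \<phi>], of 0 n] unfolding grad_flat[OF \<phi>] .
    have "norm_L2 \<Omega> (\<lambda>x. flat 0 (y x) - flat 0 (\<phi> n x)) \<le> norm_L2 \<Omega> (\<lambda>x. y x - \<phi> n x)" for n
      by (rule L2_dominated(2)[OF L2_diff[OF L(1) \<phi>L(1)]])
         (auto intro!: borel_measurable_diff mf L \<phi>L flat_zero_Lipschitz)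
    then show "(\<lambda>n. norm_L2 \<Omega> (\<lambda>x. flat 0 (y x) - flat 0 (\<phi> n x))) \<longlonglongrightarrow> 0"
      by (intro Lim_null_comparison[OF _ lim(1)] always_eventually) simp
    have "(\<lambda>n. norm_L2 \<Omega> (\<lambda>x. flat_slope (\<phi> n x) *\<^sub>R (g x - grad (\<phi> n) x))) \<longlonglongrightarrow> 0"
      by (intro Lim_null_comparison[OF _ lim(2)] always_eventually)
         (use sle[OF \<phi>L(1) L2_diff[OF L(2) \<phi>L(2)]] in simp)
    moreover have "(\<lambda>n. norm_L2 \<Omega> (\<lambda>x. (flat_slope (y x) - flat_slope (\<phi> n x)) *\<^sub>R g x)) \<longlonglongrightarrow> 0"
    proof (rule L2_dominated_convergence[OF _ L(2)])
      show "(\<lambda>x. (flat_slope (y x) - flat_slope (\<phi> n x)) *\<^sub>R g x) \<in> borel_measurable (lebesgue_on \<Omega>)" for n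
        by (intro borel_measurable_scaleR borel_measurable_diff ms L \<phi>L L2_measurable[OF L(2)])
      show "AE x in lebesgue_on \<Omega>. (\<lambda>n. (flat_slope (y x) - flat_slope (\<phi> n x)) *\<^sub>R g x) \<longlonglongrightarrow> 0"
        using ae
      proof eventually_elim
        case (elim x)
        have "isCont flat_slope (y x)"
          using continuous_on_flat_slope by (simp add: continuous_on_eq_continuous_at)
        then have "(\<lambda>n. flat_slope (\<phi> n x)) \<longlonglongrightarrow> flat_slope (y x)"
          using elim by (rule isCont_tendsto_compose)
        then have "(\<lambda>n. (flat_slope (y x) - flat_slope (\<phi> n x)) *\<^sub>R g x) \<longlonglongrightarrow> (flat_slope (y x) - flat_slope (y x)) *\<^sub>R g x"
          by (intro tendsto_scaleR tendsto_diff tendsto_const)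
        then show ?case by simp
      qed
      show "AE x in lebesgue_on \<Omega>. norm ((flat_slope (y x) - flat_slope (\<phi> n x)) *\<^sub>R g x) \<le> norm (g x)" for n
      proof (rule AE_I2)
        fix x
        have "\<bar>flat_slope (y x) - flat_slope (\<phi> n x)\<bar> \<le> 1"
          using flat_slope_bounds[of "y x"] flat_slope_bounds[of "\<phi> n x"] by linarith
        from mult_right_mono[OF this, of "norm (g x)"]
        show "norm ((flat_slope (y x) - flat_slope (\<phi> n x)) *\<^sub>R g x) \<le> norm (g x)" by simp
      qed
    qed
    ultimately have "(\<lambda>n. norm_L2 \<Omega> (\<lambda>x. flat_slope (\<phi> n x) *\<^sub>R (g x - grad (\<phi> n) x)
        + (flat_slope (y x) - flat_slope (\<phi> n x)) *\<^sub>R g x)) \<longlonglongrightarrow> 0"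
    proof (rule norm_L2_tendsto_0_add[rotated 2])
      show "(\<lambda>x. flat_slope (\<phi> n x) *\<^sub>R (g x - grad (\<phi> n) x)) \<in> L2 \<Omega>" for n
        by (rule sL[OF \<phi>L(1) L2_diff[OF L(2) \<phi>L(2)]])
      show "(\<lambda>x. (flat_slope (y x) - flat_slope (\<phi> n x)) *\<^sub>R g x) \<in> L2 \<Omega>" for n
        unfolding scaleR_diff_left by (intro L2_diff sL L \<phi>L)
    qed
    moreover have "flat_slope (\<phi> n x) *\<^sub>R (g x - grad (\<phi> n) x) + (flat_slope (y x) - flat_slope (\<phi> n x)) *\<^sub>R g x
        = flat_slope (y x) *\<^sub>R g x - flat_slope (\<phi> n x) *\<^sub>R grad (\<phi> n) x" for n x
      by (simp add: scaleR_right_diff_distrib scaleR_diff_left)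
    ultimately show "(\<lambda>n. norm_L2 \<Omega> (\<lambda>x. flat_slope (y x) *\<^sub>R g x - flat_slope (\<phi> n x) *\<^sub>R grad (\<phi> n) x)) \<longlonglongrightarrow> 0"
      by (simp only:)
  qed
qed

text \<open>The positive part is the limit of \<open>flat 0 (N y) / N\<close> as \<open>N\<close> tends to infinity. The slopes
  \<open>flat_slope (N y)\<close> tend to zero wherever \<open>y \<le> 0\<close>, in particular on the level set \<open>{y = 0}\<close>,
  which is why the gradient vanishes there.\<close>

lemma H10_gradient_positive_part:
  fixes \<Omega> :: "(real^'n) set"
  assumes \<Omega>: "\<Omega> \<in> lmeasurable" and y: "H10_gradient \<Omega> y g"
  shows "H10_gradient \<Omega> (\<lambda>x. max 0 (y x)) (\<lambda>x. indicator {0<..} (y x) *\<^sub>R g x)"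
proof -
  note L = H10_gradient_L2[OF y]
  have [measurable]: "y \<in> borel_measurable (lebesgue_on \<Omega>)" "g \<in> borel_measurable (lebesgue_on \<Omega>)"
    using L by (auto intro: L2_measurable)
  define N where "N n = real (Suc n)" for n
  have N: "0 < N n" for n by (simp add: N_def)
  have v: "H10_gradient \<Omega> (\<lambda>x. inverse (N n) * flat 0 (N n * y x)) (\<lambda>x. flat_slope (N n * y x) *\<^sub>R g x)" for n
  proof -
    have "inverse (N n) *\<^sub>R flat_slope (N n * y x) *\<^sub>R N n *\<^sub>R g x = flat_slope (N n * y x) *\<^sub>R g x" for x
      using N[of n] by simp
    with H10_gradient_cmult[OF H10_gradient_flat[OF \<Omega> H10_gradient_cmult[OF y, of "N n"]], of "inverse (N n)"]
    show ?thesis by (simp only:)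
  qed
  note vL = v[THEN H10_gradient_L2(1)] v[THEN H10_gradient_L2(2)]
  have scale: "max 0 s = inverse (N n) * max 0 (N n * s)" for n s
    using N[of n] by (auto simp: max_def mult_le_0_iff zero_le_mult_iff)
  have close: "0 \<le> max 0 s - inverse (N n) * flat 0 (N n * s)"
    "max 0 s - inverse (N n) * flat 0 (N n * s) \<le> inverse (N n)" "0 \<le> inverse (N n) * flat 0 (N n * s)" for n s
  proof -
    have "max 0 s - inverse (N n) * flat 0 (N n * s) = inverse (N n) * (max 0 (N n * s) - flat 0 (N n * s))"
      using scale[of s n] by (simp only: right_diff_distrib)
    moreover have "0 \<le> inverse (N n)" using N[of n] by simp
    ultimately show "0 \<le> max 0 s - inverse (N n) * flat 0 (N n * s)"
      "max 0 s - inverse (N n) * flat 0 (N n * s) \<le> inverse (N n)" "0 \<le> inverse (N n) * flat 0 (N n * s)"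
      using flat_zero_bounds[of "N n * s"] mult_left_mono[of "max 0 (N n * s) - flat 0 (N n * s)" 1 "inverse (N n)"]
      by auto
  qed
  have pL: "(\<lambda>x. max 0 (y x)) \<in> L2 \<Omega>"
    by (rule L2_dominated(1)[OF L(1)]) (auto simp: max_def)
  have gL: "(\<lambda>x. indicator {0<..} (y x) *\<^sub>R g x) \<in> L2 \<Omega>"
    by (rule L2_dominated(1)[OF L(2)]) (auto simp: indicator_def)
  show ?thesis
  proof (rule H10_gradient_limit[OF \<Omega> v pL gL])
    show "(\<lambda>n. norm_L2 \<Omega> (\<lambda>x. max 0 (y x) - inverse (N n) * flat 0 (N n * y x))) \<longlonglongrightarrow> 0"
    proof (rule L2_dominated_convergence[OF L2_measurable[OF L2_diff[OF pL vL(1)]] L(1)])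
      show "AE x in lebesgue_on \<Omega>. (\<lambda>n. max 0 (y x) - inverse (N n) * flat 0 (N n * y x)) \<longlonglongrightarrow> 0"
        by (intro AE_I2 Lim_null_comparison[OF _ LIMSEQ_inverse_real_of_nat] always_eventually allI)
           (use close in \<open>simp add: N_def[symmetric] del: of_nat_Suc\<close>)
      show "AE x in lebesgue_on \<Omega>. norm (max 0 (y x) - inverse (N n) * flat 0 (N n * y x)) \<le> norm (y x)" for n
      proof (rule AE_I2)
        show "norm (max 0 (y x) - inverse (N n) * flat 0 (N n * y x)) \<le> norm (y x)" for x
          using close(1,3)[where s="y x" and n=n] by (auto simp: max_def split: if_splits)
      qed
    qed
    show "(\<lambda>n. norm_L2 \<Omega> (\<lambda>x. indicator {0<..} (y x) *\<^sub>R g x - flat_slope (N n * y x) *\<^sub>R g x)) \<longlonglongrightarrow> 0"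
    proof (rule L2_dominated_convergence[OF L2_measurable[OF L2_diff[OF gL vL(2)]] L(2)])
      show "AE x in lebesgue_on \<Omega>. (\<lambda>n. indicator {0<..} (y x) *\<^sub>R g x - flat_slope (N n * y x) *\<^sub>R g x) \<longlonglongrightarrow> 0"
      proof (rule AE_I2)
        fix x
        have "(\<lambda>n. flat_slope (N n * y x)) \<longlonglongrightarrow> indicator {0<..} (y x)"
          using flat_slope_tendsto[of "y x"] by (simp only: N_def mult.commute)
        then have "(\<lambda>n. indicator {0<..} (y x) *\<^sub>R g x - flat_slope (N n * y x) *\<^sub>R g x)
            \<longlonglongrightarrow> indicator {0<..} (y x) *\<^sub>R g x - indicator {0<..} (y x) *\<^sub>R g x"
          by (intro tendsto_diff tendsto_scaleR tendsto_const)
        then show "(\<lambda>n. indicator {0<..} (y x) *\<^sub>R g x - flat_slope (N n * y x) *\<^sub>R g x) \<longlonglongrightarrow> 0" by simp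
      qed
      show "AE x in lebesgue_on \<Omega>. norm (indicator {0<..} (y x) *\<^sub>R g x - flat_slope (N n * y x) *\<^sub>R g x) \<le> norm (g x)" for n
      proof (rule AE_I2)
        fix x
        have "\<bar>indicator {0<..} (y x) - flat_slope (N n * y x)\<bar> \<le> 1"
          using flat_slope_bounds[of "N n * y x"] unfolding indicator_def by (auto simp: abs_le_iff simp del: One_nat_def)
        from mult_right_mono[OF this, of "norm (g x)"]
        show "norm (indicator {0<..} (y x) *\<^sub>R g x - flat_slope (N n * y x) *\<^sub>R g x) \<le> norm (g x)"
          by (simp only: scaleR_diff_left[symmetric] norm_scaleR) simp
      qed
    qed
  qed
qed

section \<open>Small sets carry little mass\<close>

lemma nn_integral_lborel_translate:
  fixes f :: "real^'n \<Rightarrow> ennreal"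
  assumes "f \<in> borel_measurable borel"
  shows "(\<integral>\<^sup>+x. f (x + c) \<partial>lborel) = (\<integral>\<^sup>+x. f x \<partial>lborel)"
proof -
  have "(\<integral>\<^sup>+x. f x \<partial>lborel) = (\<integral>\<^sup>+x. f x \<partial>distr lborel borel ((+) c))" by (simp add: lborel_distr_plus)
  also have "\<dots> = (\<integral>\<^sup>+x. f (c + x) \<partial>lborel)" by (rule nn_integral_distr) (use assms in auto)
  finally show ?thesis by (simp add: add.commute)
qed

text \<open>Jensen's inequality for the square, obtained by integrating \<open>0 \<le> (k' - m)\<^sup>2\<close> with \<open>m\<close> the mean
  of \<open>k'\<close>.\<close>

lemma square_increment_le_integral_square:
  fixes k k' :: "real \<Rightarrow> real"
  assumes d: "\<And>s. (k has_real_derivative k' s) (at s)" and c: "continuous_on UNIV k'"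
  shows "ennreal ((k 1 - k 0)\<^sup>2) \<le> (\<integral>\<^sup>+s. ennreal ((k' s)\<^sup>2) * indicator {0..1} s \<partial>lborel)"
proof -
  define m where "m = k 1 - k 0"
  define J where "J = integral {0..1} (\<lambda>s. (k' s)\<^sup>2)"
  have 1: "(k' has_integral m) {0..1}"
    unfolding m_def using d
    by (intro fundamental_theorem_of_calculus)
       (auto simp: has_real_derivative_iff_has_vector_derivative[symmetric] intro: has_field_derivative_at_within)
  have 2: "((\<lambda>s. (k' s)\<^sup>2) has_integral J) {0..1}"
    unfolding J_def
    by (intro integrable_integral integrable_continuous_interval continuous_intros continuous_on_subset[OF c]) auto
  have "((\<lambda>s. (k' s)\<^sup>2 - (2 * m) * k' s + m\<^sup>2) has_integral (J - (2 * m) * m + m\<^sup>2)) {0..1}"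
    using has_integral_add[OF has_integral_diff[OF 2 has_integral_mult_right[OF 1, of "2 * m"]]
      has_integral_const_real[of "m\<^sup>2" 0 1]] by simp
  moreover have "0 \<le> (k' s)\<^sup>2 - (2 * m) * k' s + m\<^sup>2" for s
    using zero_le_power2[of "k' s - m"] by (simp add: power2_diff mult_ac)
  ultimately have "0 \<le> J - (2 * m) * m + m\<^sup>2" by (meson has_integral_nonneg)
  then have "m\<^sup>2 \<le> J" by (simp add: power2_eq_square)
  moreover have "(\<integral>\<^sup>+s. ennreal ((k' s)\<^sup>2) * indicator {0..1} s \<partial>lborel) = ennreal J"
    by (rule nn_integral_has_integral_lebesgue'[OF _ 2]) simp
  ultimately show ?thesis by (simp add: m_def ennreal_leI)
qed

text \<open>The increment is the mean of the directional derivative along the segment from \<open>x\<close> to \<open>x + h\<close>.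
  Square it with Jensen's inequality, exchange the two integrations, and use that the integral of
  the squared gradient is invariant under translations.\<close>

lemma nn_integral_translation_increment_le:
  fixes \<phi> :: "real^'n \<Rightarrow> real"
  assumes \<phi>: "\<phi> \<in> test_functions \<Omega>"
  shows "(\<integral>\<^sup>+x. ennreal ((\<phi> (x + h) - \<phi> x)\<^sup>2) \<partial>lborel)
    \<le> ennreal ((norm h)\<^sup>2) * (\<integral>\<^sup>+x. ennreal ((norm (grad \<phi> x))\<^sup>2) \<partial>lborel)"
proof -
  let ?g = "\<lambda>x. ennreal ((norm (grad \<phi> x))\<^sup>2)"
  have cg: "continuous_on UNIV (grad \<phi>)" by (rule continuous_on_grad[OF \<phi>])
  have mg: "grad \<phi> \<in> borel_measurable borel" by (rule borel_measurable_continuous_onI[OF cg])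
  have mg2: "?g \<in> borel_measurable borel" using mg by measurable
  have pt: "ennreal ((\<phi> (x + h) - \<phi> x)\<^sup>2)
      \<le> (\<integral>\<^sup>+s. ennreal ((norm h)\<^sup>2) * (?g (x + s *\<^sub>R h) * indicator {0..1} s) \<partial>lborel)" for x
  proof -
    have "ennreal ((\<phi> (x + 1 *\<^sub>R h) - \<phi> (x + 0 *\<^sub>R h))\<^sup>2)
        \<le> (\<integral>\<^sup>+s. ennreal ((grad \<phi> (x + s *\<^sub>R h) \<bullet> h)\<^sup>2) * indicator {0..1} s \<partial>lborel)"
    proof (rule square_increment_le_integral_square)
      show "((\<lambda>s. \<phi> (x + s *\<^sub>R h)) has_real_derivative grad \<phi> (x + s *\<^sub>R h) \<bullet> h) (at s)" for s
        by (rule has_real_derivative_along_line[OF test_differentiable[OF \<phi>]])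
      show "continuous_on UNIV (\<lambda>s. grad \<phi> (x + s *\<^sub>R h) \<bullet> h)"
        by (intro continuous_intros continuous_on_compose2[OF cg]) auto
    qed
    also have "\<dots> \<le> (\<integral>\<^sup>+s. ennreal ((norm h)\<^sup>2) * (?g (x + s *\<^sub>R h) * indicator {0..1} s) \<partial>lborel)"
    proof (rule nn_integral_mono)
      fix s :: real
      have "(grad \<phi> (x + s *\<^sub>R h) \<bullet> h)\<^sup>2 \<le> (norm h)\<^sup>2 * (norm (grad \<phi> (x + s *\<^sub>R h)))\<^sup>2"
        using Cauchy_Schwarz_ineq2[of "grad \<phi> (x + s *\<^sub>R h)" h]
        by (metis abs_le_square_iff abs_mult abs_norm_cancel mult.commute power_mult_distrib)
      then have "ennreal ((grad \<phi> (x + s *\<^sub>R h) \<bullet> h)\<^sup>2) \<le> ennreal ((norm h)\<^sup>2) * ?g (x + s *\<^sub>R h)"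
        by (simp add: ennreal_mult[symmetric] ennreal_leI)
      then show "ennreal ((grad \<phi> (x + s *\<^sub>R h) \<bullet> h)\<^sup>2) * indicator {0..1} s
          \<le> ennreal ((norm h)\<^sup>2) * (?g (x + s *\<^sub>R h) * indicator {0..1} s)"
        by (auto simp: indicator_def)
    qed
    finally show ?thesis by simp
  qed
  have mp: "(\<lambda>p. ?g (fst p + snd p *\<^sub>R h) * indicator {0..1} (snd p)) \<in> borel_measurable (lborel \<Otimes>\<^sub>M lborel)"
    by (intro borel_measurable_times_ennreal measurable_compose[OF _ mg2]) measurable
  have "(\<integral>\<^sup>+x. ennreal ((\<phi> (x + h) - \<phi> x)\<^sup>2) \<partial>lborel)
      \<le> (\<integral>\<^sup>+x. (\<integral>\<^sup>+s. ennreal ((norm h)\<^sup>2) * (?g (x + s *\<^sub>R h) * indicator {0..1} s) \<partial>lborel) \<partial>lborel)"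
    by (intro nn_integral_mono pt)
  also have "\<dots> = (\<integral>\<^sup>+s. (\<integral>\<^sup>+x. ennreal ((norm h)\<^sup>2) * (?g (x + s *\<^sub>R h) * indicator {0..1} s) \<partial>lborel) \<partial>lborel)"
    by (rule lborel_pair.Fubini'[symmetric])
       (use mp in \<open>auto simp: case_prod_beta intro!: borel_measurable_times_ennreal\<close>)
  also have "\<dots> = (\<integral>\<^sup>+(s::real). (ennreal ((norm h)\<^sup>2) * (\<integral>\<^sup>+x. ?g x \<partial>lborel)) * indicator {0..1} s \<partial>lborel)"
  proof (rule nn_integral_cong)
    fix s :: real
    have m: "(\<lambda>x. ?g (x + s *\<^sub>R h)) \<in> borel_measurable lborel"
      by (rule measurable_compose[OF _ mg2]) measurable
    have "(\<integral>\<^sup>+x. ennreal ((norm h)\<^sup>2) * (?g (x + s *\<^sub>R h) * indicator {0..1} s) \<partial>lborel)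
        = ennreal ((norm h)\<^sup>2) * ((\<integral>\<^sup>+x. ?g (x + s *\<^sub>R h) \<partial>lborel) * indicator {0..1} s)"
      by (cases "s \<in> {0..1}") (simp_all add: nn_integral_cmult[OF m])
    then show "(\<integral>\<^sup>+x. ennreal ((norm h)\<^sup>2) * (?g (x + s *\<^sub>R h) * indicator {0..1} s) \<partial>lborel)
        = (ennreal ((norm h)\<^sup>2) * (\<integral>\<^sup>+x. ?g x \<partial>lborel)) * indicator {0..1} s"
      by (simp add: nn_integral_lborel_translate[OF mg2] mult.assoc)
  qed
  also have "\<dots> = ennreal ((norm h)\<^sup>2) * (\<integral>\<^sup>+x. ?g x \<partial>lborel)"
    by (simp add: nn_integral_cmult)
  finally show ?thesis .
qed

text \<open>On \<open>S\<close> compare \<open>\<phi>(x)\<close> with \<open>\<phi>(x + h)\<close> and average over all \<open>h\<close> in a ball of radius \<open>\<delta>\<close>. The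
  differences are controlled by the gradient; the values \<open>\<phi>(x + h)\<close> are averaged over a set
  of fixed size, so integrating them over \<open>S\<close> gains the factor \<open>|S|\<close>.\<close>

lemma nn_integral_square_over_set_le:
  fixes \<phi> :: "real^'n \<Rightarrow> real"
  assumes \<phi>: "\<phi> \<in> test_functions \<Omega>" and S: "S \<in> sets borel" and \<delta>: "0 < \<delta>"
  defines "Q \<equiv> cball (0::real^'n) \<delta>"
  shows "emeasure lborel Q * (\<integral>\<^sup>+x. ennreal ((\<phi> x)\<^sup>2) * indicator S x \<partial>lborel)
    \<le> 2 * (emeasure lborel S * (\<integral>\<^sup>+x. ennreal ((\<phi> x)\<^sup>2) \<partial>lborel))
      + 2 * (emeasure lborel Q * (ennreal (\<delta>\<^sup>2) * (\<integral>\<^sup>+x. ennreal ((norm (grad \<phi> x))\<^sup>2) \<partial>lborel)))"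
proof -
  let ?f = "\<lambda>x. ennreal ((\<phi> x)\<^sup>2)"
  let ?d = "\<lambda>h x. ennreal ((\<phi> (x + h) - \<phi> x)\<^sup>2)"
  let ?G = "\<integral>\<^sup>+x. ennreal ((norm (grad \<phi> x))\<^sup>2) \<partial>lborel"
  have m\<phi>[measurable]: "\<phi> \<in> borel_measurable borel"
    by (rule borel_measurable_continuous_onI[OF test_continuous[OF \<phi>]])
  have [measurable]: "S \<in> sets borel" "Q \<in> sets borel" using S by (auto simp: Q_def)
  have ms: "(\<lambda>p. \<phi> (snd p + fst p)) \<in> borel_measurable (lborel \<Otimes>\<^sub>M lborel)"
    by (rule measurable_compose[OF _ m\<phi>]) measurable
  have mt[measurable]: "(\<lambda>x. \<phi> (x + h)) \<in> borel_measurable borel" for h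
    by (rule measurable_compose[OF _ m\<phi>]) measurable
  have mt'[measurable]: "(\<lambda>h. \<phi> (x + h)) \<in> borel_measurable borel" for x
    by (rule measurable_compose[OF _ m\<phi>]) measurable
  have msq: "(\<lambda>p. ?f (snd p + fst p)) \<in> borel_measurable (lborel \<Otimes>\<^sub>M lborel)"
    using ms by measurable
  have pt: "?f x \<le> 2 * ?f (x + h) + 2 * ?d h x" for x h
  proof -
    \<comment> \<open>The difference of the two sides of the next inequality is this square.\<close>
    have "0 \<le> (2 * \<phi> (x + h) - \<phi> x)\<^sup>2" by simp
    then have "(\<phi> x)\<^sup>2 \<le> 2 * (\<phi> (x + h))\<^sup>2 + 2 * (\<phi> (x + h) - \<phi> x)\<^sup>2"
      by (simp add: power2_eq_square algebra_simps)
    then have "?f x \<le> ennreal (2 * (\<phi> (x + h))\<^sup>2 + 2 * (\<phi> (x + h) - \<phi> x)\<^sup>2)" by (rule ennreal_leI)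
    then show ?thesis by (simp add: ennreal_plus ennreal_mult)
  qed
  have "emeasure lborel Q * (\<integral>\<^sup>+x. ?f x * indicator S x \<partial>lborel)
      = (\<integral>\<^sup>+h. (\<integral>\<^sup>+x. ?f x * indicator S x \<partial>lborel) * indicator Q h \<partial>lborel)"
    by (subst nn_integral_cmult_indicator) (simp_all add: mult.commute)
  also have "\<dots> \<le> (\<integral>\<^sup>+h. 2 * (\<integral>\<^sup>+x. ?f (x + h) * indicator S x \<partial>lborel)
        + 2 * (ennreal (\<delta>\<^sup>2) * ?G) * indicator Q h \<partial>lborel)"
  proof (rule nn_integral_mono)
    fix h
    show "(\<integral>\<^sup>+x. ?f x * indicator S x \<partial>lborel) * indicator Q h
      \<le> 2 * (\<integral>\<^sup>+x. ?f (x + h) * indicator S x \<partial>lborel) + 2 * (ennreal (\<delta>\<^sup>2) * ?G) * indicator Q h"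
    proof (cases "h \<in> Q")
      case True
      have "(\<integral>\<^sup>+x. ?f x * indicator S x \<partial>lborel)
          \<le> (\<integral>\<^sup>+x. 2 * (?f (x + h) * indicator S x) + 2 * ?d h x \<partial>lborel)"
        using pt by (intro nn_integral_mono) (auto simp: indicator_def)
      also have "\<dots> = 2 * (\<integral>\<^sup>+x. ?f (x + h) * indicator S x \<partial>lborel) + 2 * (\<integral>\<^sup>+x. ?d h x \<partial>lborel)"
        by (simp add: nn_integral_add nn_integral_cmult)
      also have "(\<integral>\<^sup>+x. ?d h x \<partial>lborel) \<le> ennreal ((norm h)\<^sup>2) * ?G"
        by (rule nn_integral_translation_increment_le[OF \<phi>])
      also have "\<dots> \<le> ennreal (\<delta>\<^sup>2) * ?G"
        using True by (intro mult_right_mono ennreal_leI power_mono) (auto simp: Q_def)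
      finally show ?thesis using True by (simp add: add_left_mono mult_left_mono)
    qed simp
  qed
  also have "\<dots> = 2 * (\<integral>\<^sup>+h. (\<integral>\<^sup>+x. ?f (x + h) * indicator S x \<partial>lborel) \<partial>lborel)
      + 2 * (ennreal (\<delta>\<^sup>2) * ?G) * emeasure lborel Q"
  proof -
    have "(\<lambda>p. ?f (snd p + fst p) * indicator S (snd p)) \<in> borel_measurable (lborel \<Otimes>\<^sub>M lborel)"
      using msq by measurable
    then have "(\<lambda>h. \<integral>\<^sup>+x. ?f (x + h) * indicator S x \<partial>lborel) \<in> borel_measurable lborel"
      using lborel.borel_measurable_nn_integral[of "\<lambda>h x. ?f (x + h) * indicator S x" lborel]
      by (simp add: case_prod_beta)
    then show ?thesis by (simp add: nn_integral_add nn_integral_cmult)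
  qed
  also have "(\<integral>\<^sup>+h. (\<integral>\<^sup>+x. ?f (x + h) * indicator S x \<partial>lborel) \<partial>lborel)
      = (\<integral>\<^sup>+x. (\<integral>\<^sup>+h. ?f (x + h) * indicator S x \<partial>lborel) \<partial>lborel)"
  proof (rule lborel_pair.Fubini')
    have [measurable]: "(\<lambda>p. \<phi> (fst p + snd p)) \<in> borel_measurable (lborel \<Otimes>\<^sub>M lborel)"
      by (rule measurable_compose[OF _ m\<phi>]) measurable
    have "(\<lambda>p. ?f (fst p + snd p) * indicator S (fst p)) \<in> borel_measurable (lborel \<Otimes>\<^sub>M lborel)"
      by measurable
    then show "(\<lambda>(x, h). ?f (x + h) * indicator S x) \<in> borel_measurable (lborel \<Otimes>\<^sub>M lborel)"
      by (simp add: case_prod_beta)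
  qed
  also have "\<dots> = (\<integral>\<^sup>+x. (\<integral>\<^sup>+h. ?f h \<partial>lborel) * indicator S x \<partial>lborel)"
  proof (rule nn_integral_cong)
    fix x
    have "(\<integral>\<^sup>+h. ?f (h + x) \<partial>lborel) = (\<integral>\<^sup>+h. ?f h \<partial>lborel)"
      by (rule nn_integral_lborel_translate[where f="?f"]) measurable
    then show "(\<integral>\<^sup>+h. ?f (x + h) * indicator S x \<partial>lborel) = (\<integral>\<^sup>+h. ?f h \<partial>lborel) * indicator S x"
      by (simp add: nn_integral_multc add.commute)
  qed
  also have "\<dots> = (\<integral>\<^sup>+h. ?f h \<partial>lborel) * emeasure lborel S"
    by (simp add: nn_integral_cmult)
  finally show ?thesis by (simp add: mult_ac)
qed

lemma norm_L2_square_lborel: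
  fixes f :: "real^'n \<Rightarrow> 'b::euclidean_space"
  assumes "open \<Omega>" "f \<in> borel_measurable borel" "\<And>x. x \<notin> \<Omega> \<Longrightarrow> f x = 0" "f \<in> L2 \<Omega>"
  shows "(\<integral>\<^sup>+x. ennreal ((norm (f x))\<^sup>2) \<partial>lborel) = ennreal ((norm_L2 \<Omega> f)\<^sup>2)"
proof -
  have m: "(\<lambda>x. (norm (f x))\<^sup>2) \<in> borel_measurable borel" using assms(2) by measurable
  have "(\<integral>\<^sup>+x. ennreal ((norm (f x))\<^sup>2) \<partial>lborel) = (\<integral>\<^sup>+x. ennreal ((norm (f x))\<^sup>2) \<partial>lebesgue)"
    by (simp add: nn_integral_completion)
  also have "\<dots> = (\<integral>\<^sup>+x. ennreal ((norm (f x))\<^sup>2) * indicator \<Omega> x \<partial>lebesgue)"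
    by (rule nn_integral_cong) (use assms(3) in \<open>auto simp: indicator_def\<close>)
  also have "\<dots> = (\<integral>\<^sup>+x. ennreal ((norm (f x))\<^sup>2) \<partial>lebesgue_on \<Omega>)"
    using assms(1) by (subst nn_integral_restrict_space) auto
  also have "\<dots> = ennreal ((norm_L2 \<Omega> f)\<^sup>2)"
    unfolding norm_L2_square by (rule nn_integral_eq_integral[OF L2_integrable_square[OF assms(4)]]) simp
  finally show ?thesis .
qed

lemma L2_indicator_mult:
  fixes u :: "real^'n \<Rightarrow> real"
  assumes "S \<in> sets borel" "u \<in> L2 \<Omega>"
  shows "(\<lambda>x. indicator S x * u x) \<in> L2 \<Omega>"
    "norm_L2 \<Omega> (\<lambda>x. indicator S x * u x) \<le> norm_L2 \<Omega> u"
proof -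
  have "indicat_real S \<in> borel_measurable (lebesgue_on \<Omega>)"
    by (rule borel_measurable_lebesgue_on) (use assms(1) in simp)
  then have *: "(\<lambda>x. indicator S x * u x) \<in> borel_measurable (lebesgue_on \<Omega>)"
    by (rule borel_measurable_times[OF _ L2_measurable[OF assms(2)]])
  have "AE x in lebesgue_on \<Omega>. norm (indicator S x * u x) \<le> norm (u x)"
    by (rule AE_I2) (simp add: indicator_def)
  from L2_dominated[OF assms(2) * this]
  show "(\<lambda>x. indicator S x * u x) \<in> L2 \<Omega>" "norm_L2 \<Omega> (\<lambda>x. indicator S x * u x) \<le> norm_L2 \<Omega> u" by auto
qed

text \<open>Fix the averaging radius \<open>\<delta>\<close> first, so small that the gradient term is harmless, and then
  \<open>\<epsilon>\<close>. The estimate passes from test functions to \<open>H\<^sup>1\<^sub>0\<close> by density. In other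
  words, the squares of the functions in a bounded subset of \<open>H\<^sup>1\<^sub>0\<close> are uniformly integrable.\<close>

lemma small_set_estimate:
  fixes \<Omega> :: "(real^'n) set"
  assumes \<Omega>: "open \<Omega>" "\<Omega> \<in> lmeasurable" and \<kappa>: "0 < \<kappa>"
  obtains \<epsilon> where "0 < \<epsilon>"
    "\<And>S y g. S \<in> sets borel \<Longrightarrow> S \<subseteq> \<Omega> \<Longrightarrow> measure lebesgue S \<le> \<epsilon> \<Longrightarrow> H10_gradient \<Omega> y g \<Longrightarrow>
      (norm_L2 \<Omega> (\<lambda>x. indicator S x * y x))\<^sup>2 \<le> \<kappa>\<^sup>2 * ((norm_L2 \<Omega> y)\<^sup>2 + (norm_L2 \<Omega> g)\<^sup>2)"
proof -
  define \<delta> where "\<delta> = \<kappa> / 2"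
  define q where "q = measure lborel (cball (0::real^'n) \<delta>)"
  have \<delta>: "0 < \<delta>" "2 * \<delta>\<^sup>2 \<le> \<kappa>\<^sup>2" using \<kappa> by (auto simp: \<delta>_def power2_eq_square)
  have q: "0 < q" "emeasure lborel (cball (0::real^'n) \<delta>) = ennreal q"
  proof -
    show "0 < q" unfolding q_def by (rule content_cball_pos[OF \<delta>(1)])
    have "emeasure lborel (cball (0::real^'n) \<delta>) \<noteq> top"
      using emeasure_lborel_cball_finite[of "0::real^'n" \<delta>] by (simp add: less_top)
    then show "emeasure lborel (cball (0::real^'n) \<delta>) = ennreal q"
      unfolding q_def by (rule emeasure_eq_ennreal_measure)
  qed
  define \<epsilon> where "\<epsilon> = \<kappa>\<^sup>2 * q / 2"
  have \<epsilon>: "0 < \<epsilon>" using \<kappa> q(1) by (simp add: \<epsilon>_def)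
  have est: "(norm_L2 \<Omega> (\<lambda>x. indicator S x * y x))\<^sup>2 \<le> \<kappa>\<^sup>2 * ((norm_L2 \<Omega> y)\<^sup>2 + (norm_L2 \<Omega> g)\<^sup>2)"
    if S: "S \<in> sets borel" "S \<subseteq> \<Omega>" "measure lebesgue S \<le> \<epsilon>" and y: "H10_gradient \<Omega> y g" for S y g
  proof -
    obtain \<phi> :: "nat \<Rightarrow> real^'n \<Rightarrow> real" where \<phi>: "\<And>n. \<phi> n \<in> test_functions \<Omega>"
      "L2_converges \<Omega> \<phi> y" "L2_converges \<Omega> (\<lambda>n. grad (\<phi> n)) g"
      by (rule H10_gradientE[OF y]) (rule that)
    note L = H10_gradient_L2[OF y]
    note tL = \<phi>(1)[THEN test_L2[OF \<Omega>(2)]] \<phi>(1)[THEN grad_L2[OF \<Omega>(2)]]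
    have Sl: "S \<in> lmeasurable"
      by (rule fmeasurableI2[OF \<Omega>(2) S(2)]) (use S(1) in auto)
    have eS: "emeasure lborel S = ennreal (measure lebesgue S)"
      using emeasure_eq_measure2[OF Sl] S(1) by simp
    have test: "(norm_L2 \<Omega> (\<lambda>x. indicator S x * \<phi> n x))\<^sup>2 \<le> \<kappa>\<^sup>2 * ((norm_L2 \<Omega> (\<phi> n))\<^sup>2 + (norm_L2 \<Omega> (grad (\<phi> n)))\<^sup>2)" for n
    proof -
      let ?X = "(norm_L2 \<Omega> (\<lambda>x. indicator S x * \<phi> n x))\<^sup>2"
      let ?N = "(norm_L2 \<Omega> (\<phi> n))\<^sup>2" and ?G = "(norm_L2 \<Omega> (grad (\<phi> n)))\<^sup>2"
      have m: "\<phi> n \<in> borel_measurable borel"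
        by (rule borel_measurable_continuous_onI[OF test_continuous[OF \<phi>(1)]])
      have mS: "(\<lambda>x. indicator S x * \<phi> n x) \<in> borel_measurable borel"
        using S(1) m by (intro borel_measurable_times borel_measurable_indicator) auto
      have X: "(\<integral>\<^sup>+x. ennreal ((\<phi> n x)\<^sup>2) * indicator S x \<partial>lborel) = ennreal ?X"
      proof -
        have "(\<integral>\<^sup>+x. ennreal ((norm (indicator S x * \<phi> n x))\<^sup>2) \<partial>lborel) = ennreal ?X"
          by (rule norm_L2_square_lborel[OF \<Omega>(1) mS _ L2_indicator_mult(1)[OF S(1) tL(1)]])
             (simp add: test_zero_outside[OF \<phi>(1)])
        moreover have "ennreal ((norm (indicator S x * \<phi> n x))\<^sup>2) = ennreal ((\<phi> n x)\<^sup>2) * indicator S x" for x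
          by (simp add: indicator_def)
        ultimately show ?thesis by simp
      qed
      have N: "(\<integral>\<^sup>+x. ennreal ((\<phi> n x)\<^sup>2) \<partial>lborel) = ennreal ?N"
        using norm_L2_square_lborel[OF \<Omega>(1) m test_zero_outside[OF \<phi>(1)] tL(1)] by simp
      have G: "(\<integral>\<^sup>+x. ennreal ((norm (grad (\<phi> n) x))\<^sup>2) \<partial>lborel) = ennreal ?G"
        by (rule norm_L2_square_lborel[OF \<Omega>(1) borel_measurable_continuous_onI[OF continuous_on_grad[OF \<phi>(1)]]
              grad_zero_outside[OF \<phi>(1)] tL(2)])
      have "ennreal (q * ?X) \<le> ennreal (2 * (measure lebesgue S * ?N) + 2 * (q * (\<delta>\<^sup>2 * ?G)))"
        using nn_integral_square_over_set_le[OF \<phi>(1) S(1) \<delta>(1), of n] q(1)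
        unfolding X N G q(2) eS
        by (simp add: ennreal_mult ennreal_plus)
      then have "q * ?X \<le> 2 * (measure lebesgue S * ?N) + 2 * (q * (\<delta>\<^sup>2 * ?G))"
        using q(1) by (subst (asm) ennreal_le_iff) auto
      also have "\<dots> \<le> 2 * (\<epsilon> * ?N) + q * (\<kappa>\<^sup>2 * ?G)"
      proof -
        have "measure lebesgue S * ?N \<le> \<epsilon> * ?N" using S(3) by (rule mult_right_mono) simp
        moreover have "q * ((2 * \<delta>\<^sup>2) * ?G) \<le> q * (\<kappa>\<^sup>2 * ?G)"
          using q(1) \<delta>(2) by (intro mult_left_mono mult_right_mono) auto
        ultimately show ?thesis by (simp add: mult_ac)
      qed
      also have "\<dots> = q * (\<kappa>\<^sup>2 * (?N + ?G))" by (simp add: \<epsilon>_def algebra_simps)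
      finally show ?thesis using q(1) by simp
    qed
    have l: "(\<lambda>n. norm_L2 \<Omega> (\<phi> n)) \<longlonglongrightarrow> norm_L2 \<Omega> y" "(\<lambda>n. norm_L2 \<Omega> (grad (\<phi> n))) \<longlonglongrightarrow> norm_L2 \<Omega> g"
      by (rule norm_L2_tendsto[OF tL(1) L(1) \<phi>(2)], rule norm_L2_tendsto[OF tL(2) L(2) \<phi>(3)])
    have "(\<lambda>n. norm_L2 \<Omega> (\<lambda>x. indicator S x * y x - indicator S x * \<phi> n x)) \<longlonglongrightarrow> 0"
      by (rule Lim_null_comparison[OF _ \<phi>(2)], rule always_eventually)
         (use L2_indicator_mult(2)[OF S(1) L2_diff[OF L(1) tL(1)]] in \<open>simp add: right_diff_distrib\<close>)
    then have "(\<lambda>n. norm_L2 \<Omega> (\<lambda>x. indicator S x * \<phi> n x)) \<longlonglongrightarrow> norm_L2 \<Omega> (\<lambda>x. indicator S x * y x)"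
      by (rule norm_L2_tendsto[OF L2_indicator_mult(1)[OF S(1) tL(1)] L2_indicator_mult(1)[OF S(1) L(1)]])
    then have "(\<lambda>n. (norm_L2 \<Omega> (\<lambda>x. indicator S x * \<phi> n x))\<^sup>2) \<longlonglongrightarrow> (norm_L2 \<Omega> (\<lambda>x. indicator S x * y x))\<^sup>2"
      by (rule tendsto_power)
    moreover have "(\<lambda>n. \<kappa>\<^sup>2 * ((norm_L2 \<Omega> (\<phi> n))\<^sup>2 + (norm_L2 \<Omega> (grad (\<phi> n)))\<^sup>2))
        \<longlonglongrightarrow> \<kappa>\<^sup>2 * ((norm_L2 \<Omega> y)\<^sup>2 + (norm_L2 \<Omega> g)\<^sup>2)"
      by (intro tendsto_intros l)
    ultimately show ?thesis by (rule LIMSEQ_le) (use test in blast)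
  qed
  show ?thesis by (rule that[OF \<epsilon> est])
qed

section \<open>Coercive elliptic operators\<close>

text \<open>The set of exceptional points is open as well as null.\<close>

lemma AE_le_imp_le_on_open:
  fixes h :: "real^'n \<Rightarrow> real"
  assumes "open \<Omega>" "continuous_on \<Omega> h" and ae: "AE x in lebesgue_on \<Omega>. h x \<le> C" and x: "x \<in> \<Omega>"
  shows "h x \<le> C"
proof (rule ccontr)
  assume "\<not> h x \<le> C"
  define U where "U = {x \<in> \<Omega>. C < h x}"
  have "open (\<Omega> \<inter> h -` {C<..})"
    by (rule continuous_open_preimage[OF assms(2,1) open_greaterThan])
  moreover have "\<Omega> \<inter> h -` {C<..} = U" by (auto simp: U_def)
  ultimately have "open U" by simp
  moreover have "x \<in> U" using x \<open>\<not> h x \<le> C\<close> by (simp add: U_def)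
  ultimately obtain e where e: "0 < e" "cball x e \<subseteq> U" using open_contains_cball_eq by blast
  have "AE x in lebesgue. x \<in> \<Omega> \<longrightarrow> h x \<le> C"
    using ae assms(1) by (subst (asm) AE_restrict_space_iff) auto
  then have "AE x in lebesgue. x \<notin> U" by eventually_elim (auto simp: U_def)
  then have "U \<in> null_sets lebesgue" using \<open>open U\<close> by (subst (asm) AE_iff_null_sets[symmetric]) auto
  then have "negligible U" by (simp add: negligible_iff_null_sets)
  then have "negligible (cball x e)" using e(2) by (rule negligible_subset)
  then have "measure lebesgue (cball x e) = 0" by (rule negligible_imp_measure0)
  with content_cball_pos[OF e(1), of x] show False by simp
qed

lemma bounded_bilinear_matrix_vector_mult:
  "bounded_bilinear ((*v) :: real^'n^'m \<Rightarrow> real^'n \<Rightarrow> real^'m)"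
proof -
  have "bilinear ((*v) :: real^'n^'m \<Rightarrow> real^'n \<Rightarrow> real^'m)"
    unfolding bilinear_def
    by (auto intro!: linearI
      simp: vec_eq_iff matrix_vector_mult_def sum.distrib sum_distrib_left algebra_simps)
  then show ?thesis by (simp add: bilinear_conv_bounded_bilinear)
qed

text \<open>This is the integrand of the pairing of \<open>A y\<close> with \<open>v\<close>. The numbers \<open>s\<close> and \<open>t\<close> stand for the
  values of \<open>y\<close> and \<open>v\<close> at \<open>x\<close>, the vectors \<open>p\<close> and \<open>q\<close> for their gradients.\<close>

definition pairing_density ::
    "(real^'n \<Rightarrow> real^'n^'n) \<Rightarrow> (real^'n \<Rightarrow> real^'n) \<Rightarrow> (real^'n \<Rightarrow> real^'n) \<Rightarrow> (real^'n \<Rightarrow> real)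
      \<Rightarrow> real^'n \<Rightarrow> real \<Rightarrow> real^'n \<Rightarrow> real \<Rightarrow> real^'n \<Rightarrow> real" where
  "pairing_density M b d c x s p t q = (M x *v p + s *\<^sub>R b x) \<bullet> q + (d x \<bullet> p) * t + c x * s * t"

lemma pairing_density_zero_right [simp]: "pairing_density M b d c x s p 0 0 = 0"
  by (simp add: pairing_density_def)

lemma pairing_density_diff:
  "pairing_density M b d c x (s - s') (p - p') t q
    = pairing_density M b d c x s p t q - pairing_density M b d c x s' p' t q"
  by (simp add: pairing_density_def matrix_vector_mult_diff_distrib algebra_simps inner_simps)

lemma pairing_density_scale:
  "pairing_density M b d c x (r * s) (r *\<^sub>R p) t q = r * pairing_density M b d c x s p t q"
  by (simp add: pairing_density_def matrix_vector_mult_scaleR algebra_simps inner_simps)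

lemma integrable_pairing_density:
  fixes \<Omega> :: "(real^'n) set"
  assumes M: "M \<in> Linfty \<Omega>" and b: "b \<in> Linfty \<Omega>" and d: "d \<in> Linfty \<Omega>" and c: "c \<in> Linfty \<Omega>"
    and y: "y \<in> L2 \<Omega>" "g \<in> L2 \<Omega>" and v: "v \<in> L2 \<Omega>" "h \<in> L2 \<Omega>"
  shows "integrable (lebesgue_on \<Omega>) (\<lambda>x. pairing_density M b d c x (y x) (g x) (v x) (h x))"
proof -
  let ?L = "lebesgue_on \<Omega>"
  obtain CM where CM: "AE x in ?L. norm (M x) \<le> CM" using M by (auto simp: Linfty_def)
  obtain Cb where Cb: "AE x in ?L. norm (b x) \<le> Cb" using b by (auto simp: Linfty_def)
  obtain Cd where Cd: "AE x in ?L. norm (d x) \<le> Cd" using d by (auto simp: Linfty_def)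
  obtain Cc where Cc: "AE x in ?L. norm (c x) \<le> Cc" using c by (auto simp: Linfty_def)
  obtain K where K: "0 < K" "\<And>(A::real^'n^'n) p. norm (A *v p) \<le> norm A * norm p * K"
  proof -
    have "\<exists>K>0. \<forall>(A::real^'n^'n) p. norm (A *v p) \<le> norm A * norm p * K"
      by (rule bounded_bilinear.pos_bounded[OF bounded_bilinear_matrix_vector_mult])
    then show ?thesis using that by blast
  qed
  have m: "M \<in> borel_measurable ?L" "b \<in> borel_measurable ?L" "d \<in> borel_measurable ?L" "c \<in> borel_measurable ?L"
    using M b d c by (auto simp: Linfty_def)
  note [measurable] = m(2-4) L2_measurable[OF y(1)] L2_measurable[OF y(2)] L2_measurable[OF v(1)] L2_measurable[OF v(2)]
  have [measurable]: "(\<lambda>x. M x *v g x) \<in> borel_measurable ?L"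
    by (rule borel_measurable_continuous_Pair[OF m(1) L2_measurable[OF y(2)]])
       (intro bounded_bilinear.continuous_on[OF bounded_bilinear_matrix_vector_mult] continuous_intros)
  define C where "C = max 0 (CM * K) + \<bar>Cb\<bar> + \<bar>Cd\<bar> + \<bar>Cc\<bar>"
  let ?F = "\<lambda>x. C * (norm (g x) * norm (h x)) + C * (norm (y x) * norm (h x))
        + C * (norm (g x) * norm (v x)) + C * (norm (y x) * norm (v x))"
  show ?thesis
  proof (rule Bochner_Integration.integrable_bound[where f="?F"])
    show "integrable ?L ?F"
      by (intro Bochner_Integration.integrable_add Bochner_Integration.integrable_mult_right impI
          L2_integrable_product y v)
    show "(\<lambda>x. pairing_density M b d c x (y x) (g x) (v x) (h x)) \<in> borel_measurable ?L"
      unfolding pairing_density_def by measurable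
    show "AE x in ?L. norm (pairing_density M b d c x (y x) (g x) (v x) (h x)) \<le> norm (?F x)"
      using CM Cb Cd Cc
    proof eventually_elim
      case (elim x)
      have C: "norm (M x) * K \<le> C" "norm (b x) \<le> C" "norm (d x) \<le> C" "\<bar>c x\<bar> \<le> C" "0 \<le> C"
      proof -
        have "norm (M x) * K \<le> max 0 (CM * K)"
          using mult_right_mono[OF elim(1), of K] K(1) by (simp add: le_max_iff_disj)
        then show "norm (M x) * K \<le> C" unfolding C_def by linarith
        show "norm (b x) \<le> C" "norm (d x) \<le> C" "\<bar>c x\<bar> \<le> C" "0 \<le> C"
          using elim(2-4) unfolding C_def real_norm_def by linarith+
      qed
      have "norm (M x *v g x) * norm (h x) \<le> (C * norm (g x)) * norm (h x)"
      proof (rule mult_right_mono)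
        have "norm (M x *v g x) \<le> (norm (M x) * K) * norm (g x)" using K(2)[of "M x" "g x"] by (simp add: mult_ac)
        also have "\<dots> \<le> C * norm (g x)" using C(1) by (rule mult_right_mono) simp
        finally show "norm (M x *v g x) \<le> C * norm (g x)" .
      qed simp
      with Cauchy_Schwarz_ineq2[of "M x *v g x" "h x"]
      have 1: "\<bar>(M x *v g x) \<bullet> h x\<bar> \<le> C * (norm (g x) * norm (h x))" by (simp add: mult_ac)
      have "\<bar>y x\<bar> * (norm (b x) * norm (h x)) \<le> \<bar>y x\<bar> * (C * norm (h x))"
        using C by (intro mult_left_mono mult_right_mono) auto
      with mult_left_mono[OF Cauchy_Schwarz_ineq2[of "b x" "h x"], of "\<bar>y x\<bar>"]
      have 2: "\<bar>y x * (b x \<bullet> h x)\<bar> \<le> C * (\<bar>y x\<bar> * norm (h x))" by (simp add: abs_mult mult_ac)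
      have "(norm (d x) * norm (g x)) * \<bar>v x\<bar> \<le> (C * norm (g x)) * \<bar>v x\<bar>"
        using C by (intro mult_right_mono) auto
      with mult_right_mono[OF Cauchy_Schwarz_ineq2[of "d x" "g x"], of "\<bar>v x\<bar>"]
      have 3: "\<bar>(d x \<bullet> g x) * v x\<bar> \<le> C * (norm (g x) * \<bar>v x\<bar>)" by (simp add: abs_mult mult_ac)
      have "\<bar>c x\<bar> * (\<bar>y x\<bar> * \<bar>v x\<bar>) \<le> C * (\<bar>y x\<bar> * \<bar>v x\<bar>)" using C by (intro mult_right_mono) auto
      then have 4: "\<bar>c x * y x * v x\<bar> \<le> C * (\<bar>y x\<bar> * \<bar>v x\<bar>)" by (simp add: abs_mult mult_ac)
      have "pairing_density M b d c x (y x) (g x) (v x) (h x)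
          = (M x *v g x) \<bullet> h x + y x * (b x \<bullet> h x) + (d x \<bullet> g x) * v x + c x * y x * v x"
        by (simp add: pairing_density_def inner_simps)
      then have "\<bar>pairing_density M b d c x (y x) (g x) (v x) (h x)\<bar>
          \<le> C * (norm (g x) * norm (h x)) + C * (\<bar>y x\<bar> * norm (h x)) + C * (norm (g x) * \<bar>v x\<bar>) + C * (\<bar>y x\<bar> * \<bar>v x\<bar>)"
        using 1 2 3 4 by linarith
      then show ?case by (simp only: real_norm_def) linarith
    qed
  qed
qed

text \<open>The gradients enter as arbitrary representatives, so that convenient ones can be chosen.\<close>

definition has_density ::
    "(real^'n) set \<Rightarrow> ((real^'n \<Rightarrow> real) \<Rightarrow> (real^'n \<Rightarrow> real) \<Rightarrow> real)
      \<Rightarrow> (real^'n \<Rightarrow> real \<Rightarrow> real^'n \<Rightarrow> real \<Rightarrow> real^'n \<Rightarrow> real) \<Rightarrow> bool" where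
  "has_density \<Omega> A P \<longleftrightarrow> (\<forall>y g v h. H10_gradient \<Omega> y g \<longrightarrow> H10_gradient \<Omega> v h \<longrightarrow>
      integrable (lebesgue_on \<Omega>) (\<lambda>x. P x (y x) (g x) (v x) (h x)) \<and>
      A y v = (\<integral>x. P x (y x) (g x) (v x) (h x) \<partial>lebesgue_on \<Omega>))"

lemma has_densityD:
  assumes "has_density \<Omega> A P" "H10_gradient \<Omega> y g" "H10_gradient \<Omega> v h"
  shows "integrable (lebesgue_on \<Omega>) (\<lambda>x. P x (y x) (g x) (v x) (h x))"
    "A y v = (\<integral>x. P x (y x) (g x) (v x) (h x) \<partial>lebesgue_on \<Omega>)"
  using assms unfolding has_density_def by blast+

lemma elliptic_operator_density:
  fixes \<Omega> :: "(real^'n) set"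
  assumes \<Omega>: "open \<Omega>" "\<Omega> \<in> lmeasurable" and A: "elliptic_operator \<Omega> A"
  obtains M b d c where "has_density \<Omega> A (pairing_density M b d c)"
proof -
  obtain M b d c where coeff: "M \<in> Linfty \<Omega>" "b \<in> Linfty \<Omega>" "d \<in> Linfty \<Omega>" "c \<in> Linfty \<Omega>"
    and eq: "\<And>y v. y \<in> H10 \<Omega> \<Longrightarrow> v \<in> H10 \<Omega> \<Longrightarrow> A y v = (\<integral>x. (M x *v weak_gradient \<Omega> y x + y x *\<^sub>R b x) \<bullet> weak_gradient \<Omega> v x
          + (d x \<bullet> weak_gradient \<Omega> y x) * v x + c x * y x * v x \<partial>lebesgue_on \<Omega>)"
    using A unfolding elliptic_operator_def by blast
  show ?thesis
  proof (rule that[of M b d c], unfold has_density_def, intro allI impI conjI)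
    fix y g v h assume y: "H10_gradient \<Omega> y g" and v: "H10_gradient \<Omega> v h"
    note yL = H10_gradient_L2[OF y] and vL = H10_gradient_L2[OF v]
    show i: "integrable (lebesgue_on \<Omega>) (\<lambda>x. pairing_density M b d c x (y x) (g x) (v x) (h x))"
      by (rule integrable_pairing_density[OF coeff yL vL])
    note yH = H10_gradient_imp_H10[OF \<Omega> y] and vH = H10_gradient_imp_H10[OF \<Omega> v]
    have wL: "weak_gradient \<Omega> y \<in> L2 \<Omega>" "weak_gradient \<Omega> v \<in> L2 \<Omega>"
      using H10_gradient_L2(2)[OF H10_imp_H10_gradient[OF \<Omega> yH(1)]]
        H10_gradient_L2(2)[OF H10_imp_H10_gradient[OF \<Omega> vH(1)]] by auto
    have "A y v = (\<integral>x. pairing_density M b d c x (y x) (weak_gradient \<Omega> y x) (v x) (weak_gradient \<Omega> v x) \<partial>lebesgue_on \<Omega>)"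
      unfolding pairing_density_def by (rule eq[OF yH(1) vH(1)])
    also have "\<dots> = (\<integral>x. pairing_density M b d c x (y x) (g x) (v x) (h x) \<partial>lebesgue_on \<Omega>)"
    proof (rule integral_cong_AE)
      show "AE x in lebesgue_on \<Omega>. pairing_density M b d c x (y x) (weak_gradient \<Omega> y x) (v x) (weak_gradient \<Omega> v x)
          = pairing_density M b d c x (y x) (g x) (v x) (h x)"
        using yH(2) vH(2) by eventually_elim simp
    qed (rule borel_measurable_integrable, rule integrable_pairing_density[OF coeff yL(1) wL(1) vL(1) wL(2)],
         rule borel_measurable_integrable, rule i)
    finally show "A y v = (\<integral>x. pairing_density M b d c x (y x) (g x) (v x) (h x) \<partial>lebesgue_on \<Omega>)" .
  qed
qed

locale coercive_problem =
  fixes \<Omega> :: "(real^'n) set" and A :: "(real^'n \<Rightarrow> real) \<Rightarrow> (real^'n \<Rightarrow> real) \<Rightarrow> real" and c\<^sub>0 :: real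
  assumes open_domain: "open \<Omega>" and finite_domain: "\<Omega> \<in> lmeasurable"
    and elliptic: "elliptic_operator \<Omega> A" and c\<^sub>0: "0 < c\<^sub>0"
    and coercive: "\<And>y. y \<in> H10 \<Omega> \<Longrightarrow> c\<^sub>0 * (norm_H1 \<Omega> y)\<^sup>2 \<le> A y y"
begin

lemmas H10_gradient_of_H10 = H10_imp_H10_gradient[OF open_domain finite_domain]
lemmas H10_of_H10_gradient = H10_gradient_imp_H10[OF open_domain finite_domain]

lemma H10_L2: "y \<in> H10 \<Omega> \<Longrightarrow> y \<in> L2 \<Omega>"
  using H10_gradient_L2(1)[OF H10_gradient_of_H10] .

lemma norm_L2_le_norm_H1:
  assumes "y \<in> H10 \<Omega>"
  shows "norm_L2 \<Omega> y \<le> norm_H1 \<Omega> y"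
  by (rule power2_le_imp_le) (use H10_of_H10_gradient(3)[OF H10_gradient_of_H10[OF assms]] in simp_all)

lemma H10_diff: "y \<in> H10 \<Omega> \<Longrightarrow> z \<in> H10 \<Omega> \<Longrightarrow> (\<lambda>x. y x - z x) \<in> H10 \<Omega>"
  by (rule H10_of_H10_gradient(1)[OF H10_gradient_diff[OF finite_domain H10_gradient_of_H10 H10_gradient_of_H10]])

lemma H10_cmult: "y \<in> H10 \<Omega> \<Longrightarrow> (\<lambda>x. r * y x) \<in> H10 \<Omega>"
  by (rule H10_of_H10_gradient(1)[OF H10_gradient_cmult[OF H10_gradient_of_H10]])

lemma pairing_diff:
  assumes "y \<in> H10 \<Omega>" "z \<in> H10 \<Omega>" "v \<in> H10 \<Omega>"
  shows "A (\<lambda>x. y x - z x) v = A y v - A z v"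
proof -
  obtain M b d c where "has_density \<Omega> A (pairing_density M b d c)"
    by (rule elliptic_operator_density[OF open_domain finite_domain elliptic])
  note D = has_densityD[OF this]
  note g = assms[THEN H10_gradient_of_H10]
  show ?thesis
    using D[OF g(1,3)] D[OF g(2,3)] D[OF H10_gradient_diff[OF finite_domain g(1,2)] g(3)]
    by (simp add: pairing_density_diff)
qed

lemma pairing_cmult:
  assumes "y \<in> H10 \<Omega>" "v \<in> H10 \<Omega>"
  shows "A (\<lambda>x. r * y x) v = r * A y v"
proof -
  obtain M b d c where "has_density \<Omega> A (pairing_density M b d c)"
    by (rule elliptic_operator_density[OF open_domain finite_domain elliptic])
  note D = has_densityD[OF this]
  note g = assms[THEN H10_gradient_of_H10]
  show ?thesis
    using D[OF g(1,2)] D[OF H10_gradient_cmult[OF g(1)] g(2)] by (simp add: pairing_density_scale)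
qed

text \<open>The operator is local: where \<open>e \<le> 0\<close>, the positive part and the gradient assigned to it vanish,
  and elsewhere they agree with \<open>e\<close> and its gradient.\<close>

lemma pairing_positive_part:
  assumes "e \<in> H10 \<Omega>"
  shows "(\<lambda>x. max 0 (e x)) \<in> H10 \<Omega>"
    and "A e (\<lambda>x. max 0 (e x)) = A (\<lambda>x. max 0 (e x)) (\<lambda>x. max 0 (e x))"
proof -
  obtain M b d c where "has_density \<Omega> A (pairing_density M b d c)"
    by (rule elliptic_operator_density[OF open_domain finite_domain elliptic])
  note D = has_densityD[OF this]
  define g where "g = weak_gradient \<Omega> e"
  have e: "H10_gradient \<Omega> e g" unfolding g_def by (rule H10_gradient_of_H10[OF assms])
  have p: "H10_gradient \<Omega> (\<lambda>x. max 0 (e x)) (\<lambda>x. indicator {0<..} (e x) *\<^sub>R g x)"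
    by (rule H10_gradient_positive_part[OF finite_domain e])
  show "(\<lambda>x. max 0 (e x)) \<in> H10 \<Omega>" by (rule H10_of_H10_gradient(1)[OF p])
  have "pairing_density M b d c x (e x) (g x) (max 0 (e x)) (indicator {0<..} (e x) *\<^sub>R g x)
      = pairing_density M b d c x (max 0 (e x)) (indicator {0<..} (e x) *\<^sub>R g x)
          (max 0 (e x)) (indicator {0<..} (e x) *\<^sub>R g x)" for x
    by (cases "0 < e x") (simp_all add: max_def)
  then show "A e (\<lambda>x. max 0 (e x)) = A (\<lambda>x. max 0 (e x)) (\<lambda>x. max 0 (e x))"
    using D[OF e p] D[OF p p] by simp
qed

text \<open>Zero order terms count as part of the right hand side \<open>g\<close>, so that the linear and the
  semilinear equation are treated alike.\<close>

definition solves :: "(real^'n \<Rightarrow> real) \<Rightarrow> (real^'n \<Rightarrow> real) \<Rightarrow> bool" where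
  "solves g y \<longleftrightarrow> y \<in> H10 \<Omega> \<and> g \<in> L2 \<Omega> \<and> (\<forall>v \<in> H10 \<Omega>. A y v = (\<integral>x. g x * v x \<partial>lebesgue_on \<Omega>))"

lemma solvesD:
  assumes "solves g y"
  shows "y \<in> H10 \<Omega>" "g \<in> L2 \<Omega>" "v \<in> H10 \<Omega> \<Longrightarrow> A y v = (\<integral>x. g x * v x \<partial>lebesgue_on \<Omega>)"
  using assms by (auto simp: solves_def)

lemma solves_diff:
  assumes "solves g y" "solves h z"
  shows "solves (\<lambda>x. g x - h x) (\<lambda>x. y x - z x)"
  unfolding solves_def
proof (intro conjI ballI)
  note y = solvesD[OF assms(1)] and z = solvesD[OF assms(2)]
  show "(\<lambda>x. y x - z x) \<in> H10 \<Omega>" by (rule H10_diff[OF y(1) z(1)])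
  show "(\<lambda>x. g x - h x) \<in> L2 \<Omega>" by (rule L2_diff[OF y(2) z(2)])
  fix v assume v: "v \<in> H10 \<Omega>"
  show "A (\<lambda>x. y x - z x) v = (\<integral>x. (g x - h x) * v x \<partial>lebesgue_on \<Omega>)"
    using L2_integrable_mult[OF y(2) H10_L2[OF v]] L2_integrable_mult[OF z(2) H10_L2[OF v]]
    by (simp add: pairing_diff[OF y(1) z(1) v] y(3)[OF v] z(3)[OF v] left_diff_distrib)
qed

lemma solves_cmult:
  assumes "solves g y"
  shows "solves (\<lambda>x. r * g x) (\<lambda>x. r * y x)"
  unfolding solves_def
proof (intro conjI ballI)
  note y = solvesD[OF assms(1)]
  show "(\<lambda>x. r * y x) \<in> H10 \<Omega>" by (rule H10_cmult[OF y(1)])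
  show "(\<lambda>x. r * g x) \<in> L2 \<Omega>" by (rule L2_cmult[OF y(2)])
  show "A (\<lambda>x. r * y x) v = (\<integral>x. (r * g x) * v x \<partial>lebesgue_on \<Omega>)" if "v \<in> H10 \<Omega>" for v
    by (simp add: pairing_cmult[OF y(1) that] y(3)[OF that] mult.assoc)
qed

text \<open>The weak maximum principle: test the difference of the equations with the positive part of
  \<open>y - z\<close>, on whose support the right hand sides are ordered.\<close>

lemma comparison:
  assumes y: "solves g y" and z: "solves h z"
    and le: "AE x in lebesgue_on \<Omega>. z x < y x \<longrightarrow> g x \<le> h x"
  shows "AE x in lebesgue_on \<Omega>. y x \<le> z x"
proof -
  note e = solvesD[OF solves_diff[OF y z]]
  define v where "v x = max 0 (y x - z x)" for x
  have v: "v \<in> H10 \<Omega>" and Av: "A (\<lambda>x. y x - z x) v = A v v"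
    using pairing_positive_part[OF e(1)] by (auto simp: v_def[abs_def])
  have "A v v = (\<integral>x. (g x - h x) * v x \<partial>lebesgue_on \<Omega>)" using e(3)[OF v] Av by simp
  also have "\<dots> \<le> (\<integral>x. 0 \<partial>lebesgue_on \<Omega>)"
  proof (rule integral_mono_AE)
    show "AE x in lebesgue_on \<Omega>. (g x - h x) * v x \<le> 0"
      using le by eventually_elim (auto simp: v_def max_def mult_nonpos_nonneg)
  qed (use L2_integrable_mult[OF e(2) H10_L2[OF v]] in auto)
  finally have "c\<^sub>0 * (norm_H1 \<Omega> v)\<^sup>2 \<le> 0" using coercive[OF v] by simp
  then have "norm_H1 \<Omega> v = 0" using c\<^sub>0 by (simp add: mult_le_0_iff)
  then have "norm_L2 \<Omega> v = 0" using norm_L2_le_norm_H1[OF v] norm_L2_nonneg[of \<Omega> v] by linarith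
  then have "AE x in lebesgue_on \<Omega>. v x = 0" by (rule norm_L2_eq_0_imp_AE[OF H10_L2[OF v]])
  then show ?thesis by eventually_elim (auto simp: v_def max_def split: if_splits)
qed

lemma energy: "solves g y \<Longrightarrow> c\<^sub>0 * (norm_H1 \<Omega> y)\<^sup>2 \<le> (\<integral>x. g x * y x \<partial>lebesgue_on \<Omega>)"
  using coercive[of y] solvesD by fastforce

end

section \<open>Monotone piecewise continuously differentiable nonlinearities\<close>

locale monotone_piecewise =
  fixes k :: nat and t :: "nat \<Rightarrow> real" and fs :: "nat \<Rightarrow> real \<Rightarrow> real" and f :: "real \<Rightarrow> real"
  assumes continuous_f: "continuous_on UNIV f"
    and knots: "strict_mono_on {1..k} t"
    and f_sum: "\<And>s. f s = (\<Sum>i=1..k+1. indicator (piece k t i) s * fs i s)"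
    and C1_pieces: "\<And>i. i \<in> {1..k+1} \<Longrightarrow> fs i C1_differentiable_on UNIV"
    and mono_pieces: "\<And>i. i \<in> {1..k+1} \<Longrightarrow> mono_on (open_piece k t i) (fs i)"
begin

text \<open>The slope is the derivative of \<open>f\<close>, except that at a knot the derivative from the left is taken.
  The coefficient of the linearised equation is \<open>slope\<close> composed with the state.\<close>

definition slope :: "real \<Rightarrow> real" where
  "slope s = (\<Sum>i=1..k+1. indicator (piece k t i) s * deriv (fs i) s)"

lemma slope_coeff_eq: "slope_coeff k t fs y x = slope (y x)"
  by (simp add: slope_coeff_def slope_def)

lemma knot_mono: "i \<le> j \<Longrightarrow> knot k t i \<le> knot k t j"
  using strict_mono_onD[OF knots, of i j] by (cases "i = j") (auto simp: knot_def)

lemma piece_exists: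
  obtains i where "i \<in> {1..k+1}" "s \<in> piece k t i"
proof -
  define i where "i = (LEAST i. ereal s \<le> knot k t i)"
  have ex: "ereal s \<le> knot k t (k + 1)" by (simp add: knot_def)
  have le: "ereal s \<le> knot k t i" unfolding i_def by (rule LeastI[where P="\<lambda>i. ereal s \<le> knot k t i", OF ex])
  have "i \<le> k + 1" unfolding i_def by (rule Least_le[where P="\<lambda>i. ereal s \<le> knot k t i", OF ex])
  moreover have "i \<noteq> 0" using le by (auto simp: knot_def split: if_splits)
  moreover from this have "\<not> ereal s \<le> knot k t (i - 1)"
    unfolding i_def by (intro not_less_Least) simp
  ultimately show ?thesis using le by (intro that[of i]) (auto simp: piece_def)
qed

lemma piece_unique:
  assumes "s \<in> piece k t i" "s \<in> piece k t j"
  shows "i = j"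
proof -
  have False if "i < j" "s \<in> piece k t i" "s \<in> piece k t j" for i j
  proof -
    have "ereal s \<le> knot k t i" using that(2) by (simp add: piece_def)
    also have "\<dots> \<le> knot k t (j - 1)" using that(1) by (intro knot_mono) simp
    also have "\<dots> < ereal s" using that(3) by (simp add: piece_def)
    finally show False by simp
  qed
  then show ?thesis using assms by (metis linorder_neqE_nat)
qed

lemma sum_over_pieces:
  fixes h :: "nat \<Rightarrow> real"
  assumes "i \<in> {1..k+1}" "s \<in> piece k t i"
  shows "(\<Sum>j=1..k+1. indicator (piece k t j) s * h j) = h i"
proof -
  have "(\<Sum>j=1..k+1. indicator (piece k t j) s * h j) = (\<Sum>j=1..k+1. if j = i then h i else 0)"
    using assms(2) by (intro sum.cong) (auto simp: indicator_def dest: piece_unique)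
  also have "\<dots> = h i" using assms(1) by (subst sum.delta) auto
  finally show ?thesis .
qed

lemma f_on_piece: "i \<in> {1..k+1} \<Longrightarrow> s \<in> piece k t i \<Longrightarrow> f s = fs i s"
  using sum_over_pieces[of i s "\<lambda>j. fs j s"] by (simp add: f_sum)

lemma slope_on_piece: "i \<in> {1..k+1} \<Longrightarrow> s \<in> piece k t i \<Longrightarrow> slope s = deriv (fs i) s"
  using sum_over_pieces[of i s "\<lambda>j. deriv (fs j) s"] by (simp add: slope_def)

lemma
  assumes "i \<in> {1..k+1}"
  shows has_derivative_piece: "(fs i has_real_derivative deriv (fs i) s) (at s)"
    and continuous_deriv_piece: "continuous_on UNIV (deriv (fs i))"
proof -
  obtain D where D: "\<And>s. (fs i has_vector_derivative D s) (at s)" "continuous_on UNIV D"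
    using C1_pieces[OF assms] by (auto simp: C1_differentiable_on_def)
  have d: "(fs i has_real_derivative D s) (at s)" for s
    using D(1) by (simp add: has_real_derivative_iff_has_vector_derivative)
  then have "deriv (fs i) = D" by (intro ext DERIV_imp_deriv)
  with d D(2) show "(fs i has_real_derivative deriv (fs i) s) (at s)" "continuous_on UNIV (deriv (fs i))"
    by auto
qed

lemma open_open_piece: "open (open_piece k t i)"
proof -
  have "open_piece k t i = {s. knot k t (i - 1) < ereal s} \<inter> {s. ereal s < knot k t i}"
    by (auto simp: open_piece_def)
  then show ?thesis by (auto intro!: open_Int open_Collect_less continuous_intros)
qed

lemma open_piece_subset: "open_piece k t i \<subseteq> piece k t i"
  by (auto simp: open_piece_def piece_def)

lemma piece_minus_knots:
  assumes "i \<in> {1..k+1}" "s \<in> piece k t i" "s \<notin> t ` {1..k}"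
  shows "s \<in> open_piece k t i"
  using assms by (auto simp: piece_def open_piece_def knot_def split: if_splits)

lemma has_derivative_f:
  assumes "s \<notin> t ` {1..k}"
  shows "(f has_real_derivative slope s) (at s)"
proof -
  obtain i where i: "i \<in> {1..k+1}" "s \<in> piece k t i" by (rule piece_exists)
  have o: "s \<in> open_piece k t i" by (rule piece_minus_knots[OF i assms])
  have "(fs i has_real_derivative slope s) (at s)"
    using has_derivative_piece[OF i(1), of s] slope_on_piece[OF i] by simp
  then show ?thesis
    by (rule has_field_derivative_transform_within_open[OF _ open_open_piece o])
       (metis f_on_piece[OF i(1)] open_piece_subset subsetD)
qed

text \<open>Finitely many exceptional points do not matter for the fundamental theorem of calculus, so
  monotonicity and Lipschitz continuity of \<open>f\<close> can be read off from \<open>slope\<close>.\<close>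

lemma slope_has_integral:
  assumes "a \<le> b"
  shows "(slope has_integral (f b - f a)) {a..b}"
  by (rule fundamental_theorem_of_calculus_interior_strong[of "t ` {1..k}"])
     (use assms has_derivative_f continuous_on_subset[OF continuous_f]
       in \<open>auto simp: has_real_derivative_iff_has_vector_derivative[symmetric]\<close>)

text \<open>Level sets at the knots may have positive measure, so the sign matters at the knots too. There it
  follows from continuity of the derivative of the piece that ends at the knot.\<close>

lemma slope_nonneg: "0 \<le> slope s"
proof -
  obtain i where i: "i \<in> {1..k+1}" "s \<in> piece k t i" by (rule piece_exists)
  have pos: "0 \<le> deriv (fs i) x" if "x \<in> open_piece k t i" for x
    by (rule mono_on_imp_deriv_nonneg[OF mono_pieces[OF i(1)] has_derivative_piece[OF i(1)]])
       (simp add: that interior_open[OF open_open_piece])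
  have "knot k t (i - 1) < ereal s" using i(2) by (simp add: piece_def)
  then obtain l where l: "knot k t (i - 1) < ereal l" "ereal l < ereal s" using ereal_dense2 by blast
  have "{l<..<s} \<subseteq> open_piece k t i"
  proof
    fix x assume "x \<in> {l<..<s}"
    then have x: "ereal l < ereal x" "ereal x < ereal s" by simp_all
    have "ereal s \<le> knot k t i" using i(2) by (simp add: piece_def)
    with less_trans[OF l(1) x(1)] less_le_trans[OF x(2)]
    have "knot k t (i - 1) < ereal x" "ereal x < knot k t i" by blast+
    then show "x \<in> open_piece k t i" by (simp add: open_piece_def)
  qed
  then have "s \<in> closure (open_piece k t i)"
    using closure_mono[of "{l<..<s}" "open_piece k t i"] l(2) by auto
  then have "0 \<le> deriv (fs i) s"
    by (rule continuous_ge_on_closure[OF continuous_on_subset[OF continuous_deriv_piece[OF i(1)] subset_UNIV]])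
       (rule pos)
  then show ?thesis using slope_on_piece[OF i] by simp
qed

lemma f_mono: "a \<le> b \<Longrightarrow> f a \<le> f b"
  using has_integral_nonneg[OF slope_has_integral, of a b] slope_nonneg by auto

lemma slope_measurable: "slope \<in> borel_measurable borel"
proof -
  have "piece k t i \<in> sets borel" for i
  proof -
    have "piece k t i = {s. knot k t (i - 1) < ereal s} \<inter> {s. ereal s \<le> knot k t i}"
      by (auto simp: piece_def)
    moreover have "open {s. knot k t (i - 1) < ereal s}" "closed {s. ereal s \<le> knot k t i}"
      by (auto intro!: open_Collect_less closed_Collect_le continuous_intros)
    ultimately show ?thesis by auto
  qed
  then show ?thesis
    unfolding slope_def[abs_def]
    by (intro borel_measurable_sum borel_measurable_times borel_measurable_indicator
        borel_measurable_continuous_onI continuous_deriv_piece)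
qed

lemma slope_bounded:
  obtains B where "0 < B" "\<And>s. \<bar>s\<bar> \<le> R \<Longrightarrow> slope s \<le> B"
proof -
  have "\<exists>C. \<forall>s\<in>{-R..R}. \<bar>deriv (fs i) s\<bar> \<le> C" if "i \<in> {1..k+1}" for i
  proof -
    have "bounded (deriv (fs i) ` {-R..R})"
      by (intro compact_imp_bounded compact_continuous_image continuous_on_subset[OF continuous_deriv_piece[OF that]]) auto
    then show ?thesis by (auto simp: bounded_iff)
  qed
  then obtain C where C: "\<And>i s. i \<in> {1..k+1} \<Longrightarrow> s \<in> {-R..R} \<Longrightarrow> \<bar>deriv (fs i) s\<bar> \<le> C i"
    by metis
  define B where "B = 1 + (\<Sum>i=1..k+1. \<bar>C i\<bar>)"
  show ?thesis
  proof (rule that[of B])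
    show "0 < B" unfolding B_def by (simp add: add_pos_nonneg sum_nonneg)
    fix s assume s: "\<bar>s\<bar> \<le> R"
    obtain i where i: "i \<in> {1..k+1}" "s \<in> piece k t i" by (rule piece_exists)
    have "s \<in> {-R..R}" using s by auto
    from C[OF i(1) this] have "slope s \<le> \<bar>C i\<bar>" using slope_on_piece[OF i] by linarith
    also have "\<dots> \<le> (\<Sum>i=1..k+1. \<bar>C i\<bar>)" by (rule member_le_sum[OF i(1)]) auto
    finally show "slope s \<le> B" by (simp add: B_def)
  qed
qed

lemma f_Lipschitz_of_slope_bound:
  assumes B: "\<And>s. \<bar>s\<bar> \<le> R \<Longrightarrow> slope s \<le> B" and "\<bar>a\<bar> \<le> R" "\<bar>b\<bar> \<le> R"
  shows "\<bar>f b - f a\<bar> \<le> B * \<bar>b - a\<bar>"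
proof -
  have *: "\<bar>f b - f a\<bar> \<le> B * \<bar>b - a\<bar>" if "a \<le> b" "\<bar>a\<bar> \<le> R" "\<bar>b\<bar> \<le> R" for a b
  proof -
    have "((\<lambda>s. B) has_integral B * (b - a)) {a..b}"
      using has_integral_const_real[of B a b] that(1) by (simp add: mult.commute)
    with slope_has_integral[OF that(1)] have "f b - f a \<le> B * (b - a)"
      by (rule has_integral_le) (use B that in auto)
    then show ?thesis using f_mono[OF that(1)] that(1) by simp
  qed
  from *[of a b] *[of b a] assms(2,3) show ?thesis
    by (cases "a \<le> b") (auto simp: abs_minus_commute)
qed

text \<open>If no knot is within distance \<open>\<rho>\<close> of \<open>r\<close>, then \<open>r'\<close> lies in the same piece as \<open>r\<close>, and the mean
  value theorem compares slopes of this single piece at nearby points. The distance \<open>\<rho>\<close> is kept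
  apart from \<open>\<delta>\<close> because it has to be shrunk later without touching \<open>\<tau>\<close>.\<close>

lemma linearisation_error_away_from_knots:
  assumes "0 < \<tau>"
  obtains \<delta> where "0 < \<delta>"
    "\<And>r r' \<rho>. \<bar>r\<bar> \<le> R \<Longrightarrow> \<bar>r'\<bar> \<le> R \<Longrightarrow> \<bar>r' - r\<bar> \<le> \<rho> \<Longrightarrow> \<rho> \<le> \<delta> \<Longrightarrow> \<forall>i\<in>{1..k}. \<rho> < \<bar>r - t i\<bar> \<Longrightarrow>
      \<bar>f r' - f r - slope r * (r' - r)\<bar> \<le> \<tau> * \<bar>r' - r\<bar>"
proof -
  have "\<exists>\<delta>>0. \<forall>r\<in>{-R..R}. \<forall>r'\<in>{-R..R}. \<bar>r' - r\<bar> \<le> \<delta> \<longrightarrow> \<bar>deriv (fs i) r' - deriv (fs i) r\<bar> \<le> \<tau>"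
    if i: "i \<in> {1..k+1}" for i
  proof -
    have "uniformly_continuous_on {-R..R} (deriv (fs i))"
      by (intro compact_uniformly_continuous continuous_on_subset[OF continuous_deriv_piece[OF i]]) auto
    then obtain d where d: "0 < d" "\<And>r r'. r \<in> {-R..R} \<Longrightarrow> r' \<in> {-R..R} \<Longrightarrow> dist r' r < d \<Longrightarrow>
        dist (deriv (fs i) r') (deriv (fs i) r) < \<tau>"
      using \<open>0 < \<tau>\<close> unfolding uniformly_continuous_on_def by blast
    show ?thesis
      using d by (intro exI[of _ "d / 2"]) (force simp: dist_real_def intro: less_imp_le)
  qed
  then have "\<forall>i\<in>{1..k+1}. \<exists>\<delta>>0. \<forall>r\<in>{-R..R}. \<forall>r'\<in>{-R..R}. \<bar>r' - r\<bar> \<le> \<delta> \<longrightarrow>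
      \<bar>deriv (fs i) r' - deriv (fs i) r\<bar> \<le> \<tau>"
    by blast
  from bchoice[OF this] obtain \<delta> where \<delta>': "\<forall>i\<in>{1..k+1}. 0 < \<delta> i \<and> (\<forall>r\<in>{-R..R}. \<forall>r'\<in>{-R..R}.
      \<bar>r' - r\<bar> \<le> \<delta> i \<longrightarrow> \<bar>deriv (fs i) r' - deriv (fs i) r\<bar> \<le> \<tau>)" ..
  then have \<delta>: "\<And>i. i \<in> {1..k+1} \<Longrightarrow> 0 < \<delta> i"
    "\<And>i r r'. i \<in> {1..k+1} \<Longrightarrow> r \<in> {-R..R} \<Longrightarrow> r' \<in> {-R..R} \<Longrightarrow> \<bar>r' - r\<bar> \<le> \<delta> i \<Longrightarrow>
      \<bar>deriv (fs i) r' - deriv (fs i) r\<bar> \<le> \<tau>"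
    by blast+
  define d where "d = Min (\<delta> ` {1..k+1})"
  have d: "0 < d" unfolding d_def using \<delta>(1) by (subst Min_gr_iff) auto
  have dle: "d \<le> \<delta> i" if "i \<in> {1..k+1}" for i unfolding d_def using that by (intro Min_le) auto
  show ?thesis
  proof (rule that[OF d])
    fix r r' \<rho> assume r: "\<bar>r\<bar> \<le> R" "\<bar>r'\<bar> \<le> R" "\<bar>r' - r\<bar> \<le> \<rho>" "\<rho> \<le> d" and "\<forall>i\<in>{1..k}. \<rho> < \<bar>r - t i\<bar>"
    then have far: "\<And>i. i \<in> {1..k} \<Longrightarrow> \<rho> < \<bar>r - t i\<bar>" by blast
    obtain i where i: "i \<in> {1..k+1}" "r \<in> piece k t i" by (rule piece_exists)
    have near: "x \<in> piece k t i" if x: "\<bar>x - r\<bar> \<le> \<rho>" for x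
    proof -
      have "knot k t (i - 1) < ereal x"
      proof (cases "i = 1")
        case False
        then have "i - 1 \<in> {1..k}" using i(1) by auto
        then show ?thesis using i(2) far[of "i - 1"] x by (auto simp: piece_def knot_def)
      qed (simp add: knot_def)
      moreover have "ereal x \<le> knot k t i"
      proof (cases "i \<le> k")
        case True
        then have "i \<in> {1..k}" using i(1) by auto
        then show ?thesis using i(2) far[of i] x by (auto simp: piece_def knot_def)
      qed (use i(1) in \<open>simp add: knot_def\<close>)
      ultimately show ?thesis by (simp add: piece_def)
    qed
    have fr: "f r' = fs i r'" "f r = fs i r" using near[OF r(3)] i f_on_piece by auto
    have mvt: "\<exists>z. min a b \<le> z \<and> z \<le> max a b \<and> fs i b - fs i a = (b - a) * deriv (fs i) z" for a b
    proof (cases a b rule: linorder_cases)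
      case less
      from MVT2[OF this has_derivative_piece[OF i(1)]] obtain z where
        "a < z" "z < b" "fs i b - fs i a = (b - a) * deriv (fs i) z" by auto
      then show ?thesis using less by (intro exI[of _ z]) auto
    next
      case greater
      from MVT2[OF this has_derivative_piece[OF i(1)]] obtain z where
        "b < z" "z < a" "fs i a - fs i b = (a - b) * deriv (fs i) z" by auto
      then show ?thesis using greater by (intro exI[of _ z]) (auto simp: algebra_simps)
    qed auto
    obtain z where z: "min r r' \<le> z" "z \<le> max r r'" "fs i r' - fs i r = (r' - r) * deriv (fs i) z"
      using mvt[of r r'] by blast
    have zr: "\<bar>z\<bar> \<le> R" "\<bar>z - r\<bar> \<le> d" using z(1,2) r by (auto simp: min_def max_def split: if_splits)
    have "\<bar>deriv (fs i) z - deriv (fs i) r\<bar> \<le> \<tau>"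
      using zr r dle[OF i(1)] by (intro \<delta>(2)[OF i(1)]) auto
    from mult_right_mono[OF this, of "\<bar>r' - r\<bar>"]
    have "\<bar>(deriv (fs i) z - deriv (fs i) r) * (r' - r)\<bar> \<le> \<tau> * \<bar>r' - r\<bar>" by (simp add: abs_mult)
    moreover have "f r' - f r - slope r * (r' - r) = (deriv (fs i) z - deriv (fs i) r) * (r' - r)"
      using fr z(3) slope_on_piece[OF i] by (simp add: algebra_simps)
    ultimately show "\<bar>f r' - f r - slope r * (r' - r)\<bar> \<le> \<tau> * \<bar>r' - r\<bar>" by simp
  qed
qed

lemma linearisation_error_le:
  assumes B: "\<And>s. \<bar>s\<bar> \<le> R \<Longrightarrow> slope s \<le> B" and r: "\<bar>r\<bar> \<le> R" "\<bar>r'\<bar> \<le> R"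
  shows "\<bar>f r' - f r - slope r * (r' - r)\<bar> \<le> 2 * B * \<bar>r' - r\<bar>"
proof -
  have "\<bar>slope r * (r' - r)\<bar> \<le> B * \<bar>r' - r\<bar>"
    using B[OF r(1)] slope_nonneg[of r] by (simp add: abs_mult mult_right_mono)
  then show ?thesis using f_Lipschitz_of_slope_bound[OF B r] by linarith
qed

end

section \<open>Uniform estimates for solutions\<close>

lemma summable_square_of_geometric_bound:
  fixes b :: "nat \<Rightarrow> real"
  assumes "\<And>n. 0 \<le> b n" "\<And>n. b n \<le> (1 / 2) ^ n"
  shows "summable (\<lambda>n. (b n)\<^sup>2)"
proof (rule summable_comparison_test')
  show "summable (\<lambda>n. (1 / 4 :: real) ^ n)" by (rule summable_geometric) simp
  fix n
  have "(b n)\<^sup>2 \<le> ((1 / 2) ^ n)\<^sup>2" by (rule power_mono[OF assms(2,1)])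
  also have "\<dots> = (1 / 4 :: real) ^ n" by (simp add: power2_eq_square power_mult_distrib[symmetric])
  finally show "norm ((b n)\<^sup>2) \<le> (1 / 4) ^ n" by simp
qed

context coercive_problem
begin

text \<open>Suppose that this fails. Then there are data \<open>h\<^sub>n\<close> of norm at most \<open>4\<^sup>-\<^sup>n\<close> whose solutions do not
  become uniformly small. A single \<open>W \<in> L\<^sup>2\<close> dominates all \<open>2\<^sup>n \<bar>h\<^sub>n\<bar>\<close>, so by comparison the bounded
  solution for \<open>W\<close> dominates \<open>2\<^sup>n\<close> times the solution for \<open>h\<^sub>n\<close>. In this way boundedness of each single
  solution turns into a bound that is uniform in the data.\<close>

lemma linear_solutions_uniformly_small:
  assumes a: "\<And>x. 0 \<le> a x"
    and sol: "\<And>w. w \<in> L2 \<Omega> \<Longrightarrow> solves (\<lambda>x. w x - a x * S w x) (S w)"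
    and bdd: "\<And>w. w \<in> L2 \<Omega> \<Longrightarrow> \<exists>R. \<forall>x\<in>\<Omega>. \<bar>S w x\<bar> \<le> R"
    and \<delta>: "0 < \<delta>"
  obtains \<rho> where "0 < \<rho>" "\<And>h e. h \<in> L2 \<Omega> \<Longrightarrow> norm_L2 \<Omega> h \<le> \<rho> \<Longrightarrow> solves (\<lambda>x. h x - a x * e x) e \<Longrightarrow>
      AE x in lebesgue_on \<Omega>. \<bar>e x\<bar> \<le> \<delta>"
proof (rule ccontr)
  assume contra: "\<not> thesis"
  have "\<exists>h e. h \<in> L2 \<Omega> \<and> norm_L2 \<Omega> h \<le> (1 / 4) ^ n \<and> solves (\<lambda>x. h x - a x * e x) e \<and>
      \<not> (AE x in lebesgue_on \<Omega>. \<bar>e x\<bar> \<le> \<delta>)" for n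
  proof (rule ccontr)
    assume "\<not> ?thesis"
    then have "thesis" by (intro that[of "(1 / 4) ^ n"]) auto
    with contra show False by simp
  qed
  then have "\<forall>n. \<exists>h e. h \<in> L2 \<Omega> \<and> norm_L2 \<Omega> h \<le> (1 / 4) ^ n \<and> solves (\<lambda>x. h x - a x * e x) e \<and>
      \<not> (AE x in lebesgue_on \<Omega>. \<bar>e x\<bar> \<le> \<delta>)" ..
  from choice[OF this] obtain h where "\<forall>n. \<exists>e. h n \<in> L2 \<Omega> \<and> norm_L2 \<Omega> (h n) \<le> (1 / 4) ^ n \<and>
      solves (\<lambda>x. h n x - a x * e x) e \<and> \<not> (AE x in lebesgue_on \<Omega>. \<bar>e x\<bar> \<le> \<delta>)" ..
  from choice[OF this] obtain e where he: "\<forall>n. h n \<in> L2 \<Omega> \<and> norm_L2 \<Omega> (h n) \<le> (1 / 4) ^ n \<and>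
      solves (\<lambda>x. h n x - a x * e n x) (e n) \<and> \<not> (AE x in lebesgue_on \<Omega>. \<bar>e n x\<bar> \<le> \<delta>)" ..
  have h: "h n \<in> L2 \<Omega>" "norm_L2 \<Omega> (h n) \<le> (1 / 4) ^ n"
    and e: "solves (\<lambda>x. h n x - a x * e n x) (e n)" "\<not> (AE x in lebesgue_on \<Omega>. \<bar>e n x\<bar> \<le> \<delta>)" for n
    using he by blast+
  have nw: "norm_L2 \<Omega> (\<lambda>x. 2 ^ n * h n x) \<le> (1 / 2) ^ n" for n
  proof -
    have "norm_L2 \<Omega> (\<lambda>x. 2 ^ n * h n x) = 2 ^ n * norm_L2 \<Omega> (h n)"
      using norm_L2_scaleR[of \<Omega> "2 ^ n" "h n"] by simp
    also have "\<dots> \<le> 2 ^ n * (1 / 4) ^ n" using h(2) by (intro mult_left_mono) auto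
    also have "\<dots> = (1 / 2) ^ n" by (simp add: power_mult_distrib[symmetric])
    finally show ?thesis .
  qed
  have "summable (\<lambda>n. (norm_L2 \<Omega> (\<lambda>x. 2 ^ n * h n x))\<^sup>2)"
    by (rule summable_square_of_geometric_bound[OF norm_L2_nonneg nw])
  then obtain W where W: "W \<in> L2 \<Omega>" "\<And>x. 0 \<le> W x" "\<And>n. AE x in lebesgue_on \<Omega>. \<bar>2 ^ n * h n x\<bar> \<le> W x"
    using L2_common_majorant[of "\<lambda>n x. 2 ^ n * h n x" \<Omega>] L2_cmult[OF h(1)] by blast
  obtain R where R: "\<And>x. x \<in> \<Omega> \<Longrightarrow> \<bar>S W x\<bar> \<le> R" using bdd[OF W(1)] by blast
  have R': "AE x in lebesgue_on \<Omega>. \<bar>S W x\<bar> \<le> R"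
    by (rule AE_I2) (use R in \<open>simp add: space_restrict_space\<close>)
  have upper: "AE x in lebesgue_on \<Omega>. r * e n x \<le> S W x" if r: "\<bar>r\<bar> = 2 ^ n" for n r
  proof (rule comparison[OF solves_cmult[OF e(1)] sol[OF W(1)]])
    show "AE x in lebesgue_on \<Omega>. S W x < r * e n x \<longrightarrow> r * (h n x - a x * e n x) \<le> W x - a x * S W x"
      using W(3)[of n]
    proof eventually_elim
      case (elim x)
      have "r * h n x \<le> W x" using elim r by (metis abs_le_D1 abs_mult abs_of_pos zero_less_numeral zero_less_power)
      moreover have "a x * S W x \<le> a x * (r * e n x)" if "S W x < r * e n x"
        using a[of x] that by (intro mult_left_mono) auto
      ultimately show ?case by (simp add: algebra_simps) (smt (verit, best))
    qed
  qed
  obtain n where "R / \<delta> < 2 ^ n" using real_arch_pow[of 2 "R / \<delta>"] by auto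
  then have n: "R < 2 ^ n * \<delta>" using \<delta> by (simp add: field_simps)
  have u1: "AE x in lebesgue_on \<Omega>. 2 ^ n * e n x \<le> S W x" by (rule upper) simp
  have u2: "AE x in lebesgue_on \<Omega>. - (2 ^ n) * e n x \<le> S W x" by (rule upper) simp
  have "AE x in lebesgue_on \<Omega>. \<bar>e n x\<bar> \<le> \<delta>"
    using u1 u2 R'
  proof eventually_elim
    case (elim x)
    then have "\<bar>2 ^ n * e n x\<bar> \<le> R" by linarith
    then have "2 ^ n * \<bar>e n x\<bar> \<le> R" by (simp add: abs_mult)
    also note n
    finally show ?case by simp
  qed
  with e(2) show False by blast
qed

end

locale semilinear_problem =
  coercive_problem \<Omega> A c\<^sub>0 + monotone_piecewise k t fs f
  for \<Omega> :: "(real^'n) set" and A c\<^sub>0 k t fs f +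
  fixes F :: "(real^'n \<Rightarrow> real) \<Rightarrow> real^'n \<Rightarrow> real"
    and G :: "(real^'n \<Rightarrow> real) \<Rightarrow> (real^'n \<Rightarrow> real) \<Rightarrow> real^'n \<Rightarrow> real"
  assumes bounded_domain: "bounded \<Omega>"
    and F_solution: "\<And>u. u \<in> L2 \<Omega> \<Longrightarrow> semilinear_solution \<Omega> A f u (F u)"
    and G_solution: "\<And>u w. u \<in> L2 \<Omega> \<Longrightarrow> w \<in> L2 \<Omega> \<Longrightarrow>
           linear_solution \<Omega> A (slope_coeff k t fs (F u)) w (G u w)"
begin

lemma bounded_of_continuous_closure:
  fixes y :: "real^'n \<Rightarrow> real"
  assumes "continuous_on (closure \<Omega>) y"
  obtains R where "0 \<le> R" "\<And>x. x \<in> \<Omega> \<Longrightarrow> \<bar>y x\<bar> \<le> R"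
proof -
  have "bounded (y ` closure \<Omega>)"
    using assms bounded_domain by (intro compact_imp_bounded compact_continuous_image) (auto simp: compact_closure)
  then obtain R where R: "\<And>x. x \<in> closure \<Omega> \<Longrightarrow> \<bar>y x\<bar> \<le> R" by (auto simp: bounded_iff)
  show ?thesis
    by (rule that[of "max 0 R"]) (use R closure_subset[of \<Omega>] in \<open>auto simp: le_max_iff_disj\<close>)
qed

lemma F_H10: "u \<in> L2 \<Omega> \<Longrightarrow> F u \<in> H10 \<Omega>"
  and F_continuous: "u \<in> L2 \<Omega> \<Longrightarrow> continuous_on (closure \<Omega>) (F u)"
  using F_solution by (auto simp: semilinear_solution_def)

lemma G_continuous: "u \<in> L2 \<Omega> \<Longrightarrow> w \<in> L2 \<Omega> \<Longrightarrow> continuous_on (closure \<Omega>) (G u w)"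
  using G_solution by (auto simp: linear_solution_def)

lemma F_bounded:
  assumes "u \<in> L2 \<Omega>"
  obtains R where "0 \<le> R" "\<And>x. x \<in> \<Omega> \<Longrightarrow> \<bar>F u x\<bar> \<le> R"
  using bounded_of_continuous_closure[OF F_continuous[OF assms]] by blast

lemma F_measurable: "u \<in> L2 \<Omega> \<Longrightarrow> F u \<in> borel_measurable (lebesgue_on \<Omega>)"
  by (rule L2_measurable[OF H10_L2[OF F_H10]])

lemma slope_F_measurable: "u \<in> L2 \<Omega> \<Longrightarrow> (\<lambda>x. slope (F u x)) \<in> borel_measurable (lebesgue_on \<Omega>)"
  using measurable_compose[OF F_measurable slope_measurable] .

lemma slope_F_bounded:
  assumes "u \<in> L2 \<Omega>"
  obtains B where "0 < B" "AE x in lebesgue_on \<Omega>. \<bar>slope (F u x)\<bar> \<le> B"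
proof -
  obtain R where R: "0 \<le> R" "\<And>x. x \<in> \<Omega> \<Longrightarrow> \<bar>F u x\<bar> \<le> R" by (rule F_bounded[OF assms]) (rule that)
  obtain B where B: "0 < B" "\<And>s. \<bar>s\<bar> \<le> R \<Longrightarrow> slope s \<le> B" by (rule slope_bounded[of R]) (rule that)
  show ?thesis
    by (rule that[OF B(1)], rule AE_I2)
       (use R B slope_nonneg in \<open>simp add: space_restrict_space abs_of_nonneg\<close>)
qed

lemma f_F_L2:
  assumes "u \<in> L2 \<Omega>"
  shows "(\<lambda>x. f (F u x)) \<in> L2 \<Omega>"
proof -
  obtain R where R: "0 \<le> R" "\<And>x. x \<in> \<Omega> \<Longrightarrow> \<bar>F u x\<bar> \<le> R" by (rule F_bounded[OF assms]) (rule that)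
  show ?thesis
  proof (rule L2_bounded[OF finite_domain, where C="max \<bar>f (- R)\<bar> \<bar>f R\<bar>"])
    show "(\<lambda>x. f (F u x)) \<in> borel_measurable (lebesgue_on \<Omega>)"
      using measurable_compose[OF F_measurable[OF assms] borel_measurable_continuous_onI[OF continuous_f]] .
    fix x assume "x \<in> \<Omega>"
    then have "f (- R) \<le> f (F u x)" "f (F u x) \<le> f R" using R(2)[of x] by (auto intro!: f_mono)
    then show "norm (f (F u x)) \<le> max \<bar>f (- R)\<bar> \<bar>f R\<bar>" by (simp add: max_def) linarith
  qed
qed

lemma F_solves:
  assumes "u \<in> L2 \<Omega>"
  shows "solves (\<lambda>x. u x - f (F u x)) (F u)"
  unfolding solves_def
proof (intro conjI ballI)
  show "F u \<in> H10 \<Omega>" by (rule F_H10[OF assms])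
  show "(\<lambda>x. u x - f (F u x)) \<in> L2 \<Omega>" by (rule L2_diff[OF assms f_F_L2[OF assms]])
  fix v assume v: "v \<in> H10 \<Omega>"
  have "A (F u) v + (\<integral>x. f (F u x) * v x \<partial>lebesgue_on \<Omega>) = (\<integral>x. u x * v x \<partial>lebesgue_on \<Omega>)"
    using F_solution[OF assms] v by (simp add: semilinear_solution_def)
  then show "A (F u) v = (\<integral>x. (u x - f (F u x)) * v x \<partial>lebesgue_on \<Omega>)"
    using L2_integrable_mult[OF assms H10_L2[OF v]] L2_integrable_mult[OF f_F_L2[OF assms] H10_L2[OF v]]
    by (simp add: left_diff_distrib)
qed

lemma G_solves:
  assumes u: "u \<in> L2 \<Omega>" and w: "w \<in> L2 \<Omega>"
  shows "solves (\<lambda>x. w x - slope (F u x) * G u w x) (G u w)"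
  unfolding solves_def
proof (intro conjI ballI)
  have G: "G u w \<in> H10 \<Omega>"
    and eq: "\<And>v. v \<in> H10 \<Omega> \<Longrightarrow> A (G u w) v + (\<integral>x. slope (F u x) * G u w x * v x \<partial>lebesgue_on \<Omega>)
      = (\<integral>x. w x * v x \<partial>lebesgue_on \<Omega>)"
    using G_solution[OF u w] by (auto simp: linear_solution_def slope_coeff_eq)
  show "G u w \<in> H10 \<Omega>" by (rule G)
  obtain B where B: "0 < B" "AE x in lebesgue_on \<Omega>. \<bar>slope (F u x)\<bar> \<le> B" by (rule slope_F_bounded[OF u])
  have aL: "(\<lambda>x. slope (F u x) * G u w x) \<in> L2 \<Omega>"
    by (rule L2_bounded_mult(1)[OF H10_L2[OF G] slope_F_measurable[OF u] _ B(2)]) (use B(1) in simp)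
  show "(\<lambda>x. w x - slope (F u x) * G u w x) \<in> L2 \<Omega>" by (rule L2_diff[OF w aL])
  fix v assume v: "v \<in> H10 \<Omega>"
  show "A (G u w) v = (\<integral>x. (w x - slope (F u x) * G u w x) * v x \<partial>lebesgue_on \<Omega>)"
    using eq[OF v] L2_integrable_mult[OF w H10_L2[OF v]] L2_integrable_mult[OF aL H10_L2[OF v]]
    by (simp add: left_diff_distrib)
qed

text \<open>Where \<open>F u' < F u\<close>, monotonicity of \<open>f\<close> orders the zero order terms in favour of the claim.\<close>

lemma F_comparison:
  assumes "u \<in> L2 \<Omega>" "u' \<in> L2 \<Omega>" "AE x in lebesgue_on \<Omega>. u x \<le> u' x"
  shows "AE x in lebesgue_on \<Omega>. F u x \<le> F u' x"
proof (rule comparison[OF F_solves[OF assms(1)] F_solves[OF assms(2)]])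
  show "AE x in lebesgue_on \<Omega>. F u' x < F u x \<longrightarrow> u x - f (F u x) \<le> u' x - f (F u' x)"
    using assms(3)
  proof eventually_elim
    case (elim x)
    then show ?case using f_mono[of "F u' x" "F u x"] by auto
  qed
qed

text \<open>Test the difference of the equations with the difference of the states; the contribution of the
  monotone nonlinearity has the good sign.\<close>

lemma F_L2_Lipschitz:
  assumes u: "u \<in> L2 \<Omega>" and u': "u' \<in> L2 \<Omega>"
  shows "c\<^sub>0 * norm_L2 \<Omega> (\<lambda>x. F u' x - F u x) \<le> norm_L2 \<Omega> (\<lambda>x. u' x - u x)"
proof -
  let ?e = "\<lambda>x. F u' x - F u x" and ?w = "\<lambda>x. u' x - u x"
  let ?g = "\<lambda>x. (u' x - f (F u' x)) - (u x - f (F u x))"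
  have e: "solves ?g ?e" by (rule solves_diff[OF F_solves[OF u'] F_solves[OF u]])
  note eL = H10_L2[OF solvesD(1)[OF e]] and wL = L2_diff[OF u' u]
  have "c\<^sub>0 * (norm_L2 \<Omega> ?e)\<^sup>2 \<le> c\<^sub>0 * (norm_H1 \<Omega> ?e)\<^sup>2"
    using c\<^sub>0 norm_L2_le_norm_H1[OF solvesD(1)[OF e]] by (intro mult_left_mono power_mono) auto
  also have "\<dots> \<le> (\<integral>x. ?g x * ?e x \<partial>lebesgue_on \<Omega>)" by (rule energy[OF e])
  also have "\<dots> \<le> (\<integral>x. ?w x * ?e x \<partial>lebesgue_on \<Omega>)"
  proof (rule integral_mono)
    show "integrable (lebesgue_on \<Omega>) (\<lambda>x. ?g x * ?e x)" by (rule L2_integrable_mult[OF solvesD(2)[OF e] eL])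
    show "integrable (lebesgue_on \<Omega>) (\<lambda>x. ?w x * ?e x)" by (rule L2_integrable_mult[OF wL eL])
    fix x
    have "0 \<le> (f (F u' x) - f (F u x)) * ?e x"
      using f_mono[of "F u' x" "F u x"] f_mono[of "F u x" "F u' x"]
      by (cases "F u' x \<le> F u x") (auto simp: zero_le_mult_iff)
    then show "?g x * ?e x \<le> ?w x * ?e x" by (simp add: algebra_simps)
  qed
  also have "\<dots> \<le> norm_L2 \<Omega> ?w * norm_L2 \<Omega> ?e"
    using L2_Cauchy_Schwarz_mult[OF wL eL] by linarith
  finally have "(c\<^sub>0 * norm_L2 \<Omega> ?e) * norm_L2 \<Omega> ?e \<le> norm_L2 \<Omega> ?w * norm_L2 \<Omega> ?e"
    by (simp add: power2_eq_square mult_ac)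
  then show ?thesis
    by (cases "norm_L2 \<Omega> ?e = 0") (auto simp: mult_le_cancel_right less_le)
qed

text \<open>Suppose that this fails, and choose controls violating it that converge to \<open>u\<close> so fast that one
  \<open>W \<in> L\<^sup>2\<close> dominates all the perturbations. By comparison all the states lie between the two
  bounded states for \<open>u \<plusminus> W\<close>. So \<open>f\<close> may be treated as Lipschitz continuous, and then the
  differences of the states solve the linearised equation with data that tend to zero in \<open>L\<^sup>2\<close>.\<close>

lemma F_uniformly_continuous_at:
  assumes u: "u \<in> L2 \<Omega>" and \<delta>: "0 < \<delta>"
  obtains \<rho> where "0 < \<rho>" "\<And>u' x. u' \<in> cball_L2 \<Omega> u \<rho> \<Longrightarrow> x \<in> \<Omega> \<Longrightarrow> \<bar>F u' x - F u x\<bar> \<le> \<delta>"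
proof -
  let ?L = "lebesgue_on \<Omega>"
  have "\<exists>\<rho>>0. \<forall>u' \<in> cball_L2 \<Omega> u \<rho>. AE x in ?L. \<bar>F u' x - F u x\<bar> \<le> \<delta>"
  proof (rule ccontr)
    assume contra: "\<not> ?thesis"
    have "\<forall>n::nat. \<exists>u'. u' \<in> cball_L2 \<Omega> u ((1 / 2) ^ n) \<and> \<not> (AE x in ?L. \<bar>F u' x - F u x\<bar> \<le> \<delta>)"
    proof
      fix n :: nat
      have "(0::real) < (1 / 2) ^ n" by simp
      with contra show "\<exists>u'. u' \<in> cball_L2 \<Omega> u ((1 / 2) ^ n) \<and> \<not> (AE x in ?L. \<bar>F u' x - F u x\<bar> \<le> \<delta>)" by blast
    qed
    from choice[OF this] obtain v where v: "\<forall>n. v n \<in> cball_L2 \<Omega> u ((1 / 2) ^ n) \<and>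
        \<not> (AE x in ?L. \<bar>F (v n) x - F u x\<bar> \<le> \<delta>)" ..
    have vL: "v n \<in> L2 \<Omega>" and vn: "norm_L2 \<Omega> (\<lambda>x. v n x - u x) \<le> (1 / 2) ^ n"
      and bad: "\<not> (AE x in ?L. \<bar>F (v n) x - F u x\<bar> \<le> \<delta>)" for n
      using v by (auto simp: cball_L2_def)
    have wL: "(\<lambda>x. v n x - u x) \<in> L2 \<Omega>" for n by (rule L2_diff[OF vL u])
    have sm: "summable (\<lambda>n. (norm_L2 \<Omega> (\<lambda>x. v n x - u x))\<^sup>2)"
      by (rule summable_square_of_geometric_bound[OF norm_L2_nonneg vn])
    obtain W where W: "W \<in> L2 \<Omega>" "\<And>n. AE x in ?L. \<bar>v n x - u x\<bar> \<le> W x"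
      by (rule L2_common_majorant[where w="\<lambda>n x. v n x - u x", OF wL sm]) (rule that)
    have uW: "(\<lambda>x. u x + W x) \<in> L2 \<Omega>" "(\<lambda>x. u x - W x) \<in> L2 \<Omega>" 
      by (rule L2_add[OF u W(1)], rule L2_diff[OF u W(1)])
    obtain R1 where R1: "0 \<le> R1" "\<And>x. x \<in> \<Omega> \<Longrightarrow> \<bar>F (\<lambda>x. u x + W x) x\<bar> \<le> R1" by (rule F_bounded[OF uW(1)]) (rule that)
    obtain R2 where R2: "0 \<le> R2" "\<And>x. x \<in> \<Omega> \<Longrightarrow> \<bar>F (\<lambda>x. u x - W x) x\<bar> \<le> R2" by (rule F_bounded[OF uW(2)]) (rule that)
    obtain R3 where R3: "0 \<le> R3" "\<And>x. x \<in> \<Omega> \<Longrightarrow> \<bar>F u x\<bar> \<le> R3" by (rule F_bounded[OF u]) (rule that)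
    define R where "R = R1 + R2 + R3"
    have Fu: "\<bar>F u x\<bar> \<le> R" if "x \<in> \<Omega>" for x using R3(2)[OF that] R1(1) R2(1) by (simp add: R_def)
    have Fv: "AE x in ?L. \<bar>F (v n) x\<bar> \<le> R" for n
    proof -
      have "AE x in ?L. F (v n) x \<le> F (\<lambda>x. u x + W x) x"
        by (rule F_comparison[OF vL uW(1)]) (use W(2)[of n] in eventually_elim, linarith)
      moreover have "AE x in ?L. F (\<lambda>x. u x - W x) x \<le> F (v n) x"
        by (rule F_comparison[OF uW(2) vL]) (use W(2)[of n] in eventually_elim, linarith)
      moreover have "AE x in ?L. \<bar>F (\<lambda>x. u x + W x) x\<bar> \<le> R1 \<and> \<bar>F (\<lambda>x. u x - W x) x\<bar> \<le> R2"
        by (rule AE_I2) (use R1 R2 in \<open>simp add: space_restrict_space\<close>)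
      ultimately show ?thesis
      proof eventually_elim
        case (elim x)
        then show ?case using R1(1) R2(1) R3(1) unfolding R_def by linarith
      qed
    qed
    obtain B where B: "0 < B" "\<And>s. \<bar>s\<bar> \<le> R \<Longrightarrow> slope s \<le> B" by (rule slope_bounded[of R]) (rule that)
    have Gb: "\<exists>R. \<forall>x\<in>\<Omega>. \<bar>G u w x\<bar> \<le> R" if w: "w \<in> L2 \<Omega>" for w
      by (rule bounded_of_continuous_closure[OF G_continuous[OF u w]]) blast
    obtain \<rho> where \<rho>: "0 < \<rho>" "\<And>h e. h \<in> L2 \<Omega> \<Longrightarrow> norm_L2 \<Omega> h \<le> \<rho> \<Longrightarrow> solves (\<lambda>x. h x - slope (F u x) * e x) e \<Longrightarrow>
        AE x in ?L. \<bar>e x\<bar> \<le> \<delta>"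
      by (rule linear_solutions_uniformly_small[OF slope_nonneg G_solves[OF u] Gb \<delta>], assumption, assumption) (rule that)
    define C where "C = 1 + 2 * B / c\<^sub>0"
    have C: "0 < C" using B(1) c\<^sub>0 by (simp add: C_def add_pos_pos)
    obtain n where n: "(1 / 2) ^ n < \<rho> / C" using real_arch_pow_inv[of "\<rho> / C" "1 / 2"] \<rho>(1) C by auto
    let ?e = "\<lambda>x. F (v n) x - F u x" and ?w = "\<lambda>x. v n x - u x"
    define r where "r x = f (F (v n) x) - f (F u x) - slope (F u x) * (F (v n) x - F u x)" for x
    \<comment> \<open>Adding and subtracting the linearised zero order term turns the equation for the difference
      of the states into the linear equation at \<open>u\<close> with right hand side \<open>h\<close>.\<close>
    define h where "h x = (v n x - u x) - r x" for x
    have e: "solves (\<lambda>x. (v n x - f (F (v n) x)) - (u x - f (F u x))) ?e"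
      by (rule solves_diff[OF F_solves[OF vL] F_solves[OF u]])
    have eL: "?e \<in> L2 \<Omega>" by (rule H10_L2[OF solvesD(1)[OF e]])
    have "(\<lambda>x. (v n x - f (F (v n) x)) - (u x - f (F u x))) = (\<lambda>x. h x - slope (F u x) * ?e x)"
      by (rule ext) (simp add: h_def r_def)
    with e have e': "solves (\<lambda>x. h x - slope (F u x) * ?e x) ?e" by simp
    have rm: "r \<in> borel_measurable ?L"
      unfolding r_def
      by (intro borel_measurable_diff borel_measurable_times L2_measurable[OF f_F_L2] slope_F_measurable F_measurable vL u)
    have rle: "AE x in ?L. norm (r x) \<le> norm (2 * B * ?e x)"
    proof -
      have "AE x in ?L. x \<in> \<Omega>" by (rule AE_I2) (simp add: space_restrict_space)
      then show ?thesis
        using Fv[of n]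
      proof eventually_elim
        case (elim x)
        then show ?case
          using linearisation_error_le[OF B(2) Fu[OF elim(1)] elim(2)] B(1) by (simp add: r_def abs_mult)
      qed
    qed
    note rL = L2_dominated[OF L2_cmult[OF eL, of "2 * B"] rm rle]
    have hL: "h \<in> L2 \<Omega>" unfolding h_def by (rule L2_diff[OF wL rL(1)])
    have "norm_L2 \<Omega> h \<le> norm_L2 \<Omega> ?w + norm_L2 \<Omega> r"
      using norm_L2_triangle[OF wL L2_uminus[OF rL(1)]] by (simp add: h_def[abs_def] norm_L2_uminus)
    also have "norm_L2 \<Omega> r \<le> 2 * B * norm_L2 \<Omega> ?e"
      using rL(2) norm_L2_scaleR[of \<Omega> "2 * B" ?e] B(1) by simp
    also have "norm_L2 \<Omega> ?e \<le> norm_L2 \<Omega> ?w / c\<^sub>0"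
      using F_L2_Lipschitz[OF u vL] c\<^sub>0 by (simp add: field_simps)
    finally have "norm_L2 \<Omega> h \<le> C * norm_L2 \<Omega> ?w"
      using B(1) by (simp add: C_def distrib_right mult_left_mono)
    also have "\<dots> \<le> C * (\<rho> / C)" using vn[of n] n C by (intro mult_left_mono) auto
    also have "\<dots> = \<rho>" using C by simp
    finally have "AE x in ?L. \<bar>?e x\<bar> \<le> \<delta>" by (rule \<rho>(2)[OF hL _ e'])
    with bad show False by blast
  qed
  then obtain \<rho> where \<rho>: "0 < \<rho>" "\<And>u'. u' \<in> cball_L2 \<Omega> u \<rho> \<Longrightarrow> AE x in ?L. \<bar>F u' x - F u x\<bar> \<le> \<delta>" by blast
  show ?thesis
  proof (rule that[OF \<rho>(1)])
    fix u' x assume u': "u' \<in> cball_L2 \<Omega> u \<rho>" and x: "x \<in> \<Omega>"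
    have u'L: "u' \<in> L2 \<Omega>" using u' by (simp add: cball_L2_def)
    have "continuous_on \<Omega> (\<lambda>x. \<bar>F u' x - F u x\<bar>)"
      by (intro continuous_on_rabs continuous_on_diff continuous_on_subset[OF F_continuous[OF u'L] closure_subset]
          continuous_on_subset[OF F_continuous[OF u] closure_subset])
    from AE_le_imp_le_on_open[OF open_domain this \<rho>(2)[OF u'] x] show "\<bar>F u' x - F u x\<bar> \<le> \<delta>" .
  qed
qed

end

section \<open>The linearisation estimate\<close>

lemma closed_level_set_borel:
  fixes y :: "real^'n \<Rightarrow> real"
  assumes "open \<Omega>" "continuous_on \<Omega> y"
  shows "{x \<in> \<Omega>. \<bar>y x - c\<bar> \<le> r} \<in> sets borel"
proof -
  have "continuous_on \<Omega> (\<lambda>x. \<bar>y x - c\<bar>)" by (intro continuous_on_rabs continuous_on_diff assms(2) continuous_on_const)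
  then have "open (\<Omega> \<inter> (\<lambda>x. \<bar>y x - c\<bar>) -` {r<..})"
    by (rule continuous_open_preimage[OF _ assms(1) open_greaterThan])
  moreover have "{x \<in> \<Omega>. \<bar>y x - c\<bar> \<le> r} = \<Omega> - (\<Omega> \<inter> (\<lambda>x. \<bar>y x - c\<bar>) -` {r<..})" by auto
  ultimately show ?thesis using assms(1) by auto
qed

text \<open>The sublevel sets of \<open>\<bar>y - c\<bar>\<close> decrease to the level set.\<close>

lemma measure_near_level_set:
  fixes y :: "real^'n \<Rightarrow> real"
  assumes \<Omega>: "open \<Omega>" "\<Omega> \<in> lmeasurable" and y: "continuous_on \<Omega> y"
    and m: "measure lebesgue {x \<in> \<Omega>. y x = c} < \<epsilon>"
  obtains r where "0 < r" "measure lebesgue {x \<in> \<Omega>. \<bar>y x - c\<bar> \<le> r} \<le> \<epsilon>"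
proof -
  define D where "D n = {x \<in> \<Omega>. \<bar>y x - c\<bar> \<le> inverse (real (Suc n))}" for n
  have Dm: "D n \<in> sets lebesgue" for n
    unfolding D_def using closed_level_set_borel[OF \<Omega>(1) y] by simp
  have Dl: "D n \<in> lmeasurable" for n
    by (rule fmeasurableI2[OF \<Omega>(2) _ Dm]) (auto simp: D_def)
  have "decseq D"
  proof (rule decseq_SucI)
    fix n
    have "inverse (real (Suc (Suc n))) \<le> inverse (real (Suc n))" by (rule le_imp_inverse_le) auto
    then show "D (Suc n) \<subseteq> D n" unfolding D_def by (auto intro: order_trans)
  qed
  moreover have "emeasure lebesgue (D n) \<noteq> \<infinity>" for n
    unfolding infinity_ennreal_def by (rule fmeasurableD2[OF Dl])
  moreover have "range D \<subseteq> sets lebesgue" using Dm by blast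
  ultimately have "(\<lambda>n. measure lebesgue (D n)) \<longlonglongrightarrow> measure lebesgue (\<Inter>n. D n)"
    by (intro Lim_measure_decseq)
  moreover have "(\<Inter>n. D n) = {x \<in> \<Omega>. y x = c}"
  proof (intro equalityI subsetI)
    fix x assume x: "x \<in> (\<Inter>n. D n)"
    have "\<bar>y x - c\<bar> \<le> 0"
      by (rule LIMSEQ_le_const[OF LIMSEQ_inverse_real_of_nat]) (use x in \<open>auto simp: D_def\<close>)
    then show "x \<in> {x \<in> \<Omega>. y x = c}" using x by (auto simp: D_def)
  qed (auto simp: D_def)
  ultimately have "\<forall>\<^sub>F n in sequentially. measure lebesgue (D n) < \<epsilon>"
    using m by (intro order_tendstoD(2)) auto
  from eventually_happens'[OF sequentially_bot this]
  obtain n where "measure lebesgue (D n) < \<epsilon>" by blast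
  then show ?thesis by (intro that[of "inverse (real (Suc n))"]) (auto simp: D_def)
qed

context semilinear_problem
begin

text \<open>The defect \<open>d = F u' - F u - G u (u' - u)\<close> solves the linearised equation, the right hand side
  being minus the linearisation error of \<open>f\<close>; test this equation with \<open>d\<close>. The error is at most \<open>\<tau> \<bar>F u' - F u\<bar>\<close> off \<open>S\<close> and
  at most \<open>K \<bar>F u' - F u\<bar>\<close> on \<open>S\<close>, where the mass of \<open>d\<close> is small.\<close>

lemma defect_estimate:
  assumes u: "u \<in> L2 \<Omega>" and u': "u' \<in> L2 \<Omega>" and S: "S \<in> sets borel" and nn: "0 \<le> \<tau>" "0 \<le> K" "0 \<le> \<kappa>"
    and off: "\<And>x. x \<in> \<Omega> \<Longrightarrow> x \<notin> S \<Longrightarrow>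
      \<bar>f (F u' x) - f (F u x) - slope (F u x) * (F u' x - F u x)\<bar> \<le> \<tau> * \<bar>F u' x - F u x\<bar>"
    and on: "\<And>x. x \<in> \<Omega> \<Longrightarrow> x \<in> S \<Longrightarrow>
      \<bar>f (F u' x) - f (F u x) - slope (F u x) * (F u' x - F u x)\<bar> \<le> K * \<bar>F u' x - F u x\<bar>"
    and small: "\<And>y g. H10_gradient \<Omega> y g \<Longrightarrow>
      (norm_L2 \<Omega> (\<lambda>x. indicator S x * y x))\<^sup>2 \<le> \<kappa>\<^sup>2 * ((norm_L2 \<Omega> y)\<^sup>2 + (norm_L2 \<Omega> g)\<^sup>2)"
  shows "c\<^sub>0 * norm_L2 \<Omega> (\<lambda>x. F u' x - F u x - G u (\<lambda>x. u' x - u x) x)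
    \<le> (\<tau> + K * \<kappa>) * norm_L2 \<Omega> (\<lambda>x. F u' x - F u x)"
proof -
  let ?L = "lebesgue_on \<Omega>"
  define w where "w = (\<lambda>x. u' x - u x)"
  define e where "e = (\<lambda>x. F u' x - F u x)"
  define d where "d = (\<lambda>x. e x - G u w x)"
  define r where "r x = f (F u' x) - f (F u x) - slope (F u x) * e x" for x
  have w: "w \<in> L2 \<Omega>" unfolding w_def by (rule L2_diff[OF u' u])
  have es: "solves (\<lambda>x. (u' x - f (F u' x)) - (u x - f (F u x))) e"
    unfolding e_def by (rule solves_diff[OF F_solves[OF u'] F_solves[OF u]])
  let ?g = "\<lambda>x. ((u' x - f (F u' x)) - (u x - f (F u x))) - (w x - slope (F u x) * G u w x)"
  have ds: "solves ?g d" unfolding d_def by (rule solves_diff[OF es G_solves[OF u w]])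
  have dH: "d \<in> H10 \<Omega>" by (rule solvesD(1)[OF ds])
  note dL = H10_L2[OF dH] and eL = H10_L2[OF solvesD(1)[OF es]]
  define N where "N = norm_H1 \<Omega> d"
  have SL: "(\<lambda>x. indicator S x * d x) \<in> L2 \<Omega>" by (rule L2_indicator_mult(1)[OF S dL])
  have "(norm_L2 \<Omega> (\<lambda>x. indicator S x * d x))\<^sup>2 \<le> (\<kappa> * N)\<^sup>2"
    using small[OF H10_gradient_of_H10[OF dH]] H10_of_H10_gradient(3)[OF H10_gradient_of_H10[OF dH]]
    by (simp add: N_def power_mult_distrib)
  then have SN: "norm_L2 \<Omega> (\<lambda>x. indicator S x * d x) \<le> \<kappa> * N"
    by (rule power2_le_imp_le) (simp add: N_def nn)
  have dN: "norm_L2 \<Omega> d \<le> N" unfolding N_def by (rule norm_L2_le_norm_H1[OF dH])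
  have N0: "0 \<le> N" by (simp add: N_def)
  let ?I = "\<lambda>x. \<tau> * (norm (e x) * norm (d x)) + K * (norm (e x) * norm (indicator S x * d x))"
  have ed: "integrable ?L (\<lambda>x. norm (e x) * norm (d x))"
    "integrable ?L (\<lambda>x. norm (e x) * norm (indicator S x * d x))"
    by (rule L2_integrable_product[OF eL dL], rule L2_integrable_product[OF eL SL])
  have iI: "integrable ?L ?I"
    by (intro Bochner_Integration.integrable_add Bochner_Integration.integrable_mult_right impI ed)
  have "c\<^sub>0 * N\<^sup>2 \<le> (\<integral>x. ?g x * d x \<partial>?L)" unfolding N_def by (rule energy[OF ds])
  also have "\<dots> \<le> (\<integral>x. ?I x \<partial>?L)"
  proof (rule integral_mono_AE[OF L2_integrable_mult[OF solvesD(2)[OF ds] dL] iI], rule AE_I2)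
    fix x assume "x \<in> space ?L"
    then have x: "x \<in> \<Omega>" by (simp add: space_restrict_space)
    have "?g x = - r x - slope (F u x) * d x"
      by (simp add: w_def r_def d_def algebra_simps)
    then have "?g x * d x = - r x * d x - slope (F u x) * (d x)\<^sup>2"
      by (simp add: power2_eq_square left_diff_distrib)
    also have "\<dots> \<le> \<bar>r x\<bar> * \<bar>d x\<bar>"
    proof -
      have "0 \<le> slope (F u x) * (d x)\<^sup>2" using slope_nonneg by simp
      moreover have "- r x * d x \<le> \<bar>r x\<bar> * \<bar>d x\<bar>" by (metis abs_ge_self abs_minus_cancel abs_mult)
      ultimately show ?thesis by linarith
    qed
    also have "\<dots> \<le> ?I x"
    proof (cases "x \<in> S")
      case True
      have "\<bar>r x\<bar> * \<bar>d x\<bar> \<le> (K * \<bar>e x\<bar>) * \<bar>d x\<bar>"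
        using on[OF x True] by (intro mult_right_mono) (auto simp: r_def e_def)
      moreover have "0 \<le> \<tau> * (\<bar>e x\<bar> * \<bar>d x\<bar>)" using nn by simp
      ultimately show ?thesis using True by (simp add: mult.assoc)
    next
      case False
      have "\<bar>r x\<bar> * \<bar>d x\<bar> \<le> (\<tau> * \<bar>e x\<bar>) * \<bar>d x\<bar>"
        using off[OF x False] by (intro mult_right_mono) (auto simp: r_def e_def)
      then show ?thesis using False by (simp add: mult.assoc)
    qed
    finally show "?g x * d x \<le> ?I x" .
  qed
  also have "\<dots> = \<tau> * (\<integral>x. norm (e x) * norm (d x) \<partial>?L) + K * (\<integral>x. norm (e x) * norm (indicator S x * d x) \<partial>?L)"
    using ed by (simp add: integral_add)
  also have "\<dots> \<le> \<tau> * (norm_L2 \<Omega> e * N) + K * (norm_L2 \<Omega> e * (\<kappa> * N))"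
  proof (intro add_mono mult_left_mono nn)
    show "(\<integral>x. norm (e x) * norm (d x) \<partial>?L) \<le> norm_L2 \<Omega> e * N"
      by (rule order_trans[OF L2_Cauchy_Schwarz[OF eL dL]]) (intro mult_left_mono dN norm_L2_nonneg)
    show "(\<integral>x. norm (e x) * norm (indicator S x * d x) \<partial>?L) \<le> norm_L2 \<Omega> e * (\<kappa> * N)"
      by (rule order_trans[OF L2_Cauchy_Schwarz[OF eL SL]]) (intro mult_left_mono SN norm_L2_nonneg)
  qed
  also have "\<dots> = ((\<tau> + K * \<kappa>) * norm_L2 \<Omega> e) * N" by (simp add: algebra_simps)
  finally have "(c\<^sub>0 * N) * N \<le> ((\<tau> + K * \<kappa>) * norm_L2 \<Omega> e) * N"
    by (simp add: power2_eq_square mult.assoc)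
  then have "c\<^sub>0 * N \<le> (\<tau> + K * \<kappa>) * norm_L2 \<Omega> e"
    using N0 nn by (cases "N = 0") (auto simp: mult_le_cancel_right)
  moreover have "c\<^sub>0 * norm_L2 \<Omega> d \<le> c\<^sub>0 * N" using c\<^sub>0 dN by simp
  ultimately show ?thesis by (simp add: d_def e_def w_def)
qed

text \<open>The threshold \<open>\<epsilon>\<close> must not depend on \<open>u\<^sub>d\<close>. It depends on the nonlinearity only through
  the bound \<open>B\<close> for the slopes in a neighbourhood of the knots, because \<open>S\<close> consists of points
  where both states are close to a knot. The other bounds for \<open>f\<close> used here depend on the size of
  the state for \<open>u\<^sub>d\<close>, but they influence \<open>\<rho>\<close> only.\<close>

lemma linearisation_estimate:
  assumes \<mu>: "0 < \<mu>"
  shows "\<exists>\<epsilon>>0. \<forall>u\<^sub>d \<in> L2 \<Omega>.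
           (\<forall>i \<in> {1..k}. measure lebesgue {x \<in> \<Omega>. F u\<^sub>d x = t i} \<le> \<epsilon>) \<longrightarrow>
           (\<exists>\<rho>>0. \<forall>u \<in> cball_L2 \<Omega> u\<^sub>d \<rho>. \<forall>u' \<in> cball_L2 \<Omega> u\<^sub>d \<rho>.
              norm_L2 \<Omega> (\<lambda>x. F u' x - F u x - G u (\<lambda>x. u' x - u x) x)
                \<le> \<mu> * norm_L2 \<Omega> (\<lambda>x. F u' x - F u x))"
proof -
  define T where "T = 1 + (\<Sum>i=1..k. \<bar>t i\<bar>)"
  have T: "\<bar>t i\<bar> + 1 \<le> T" if "i \<in> {1..k}" for i
    using member_le_sum[OF that, of "\<lambda>i. \<bar>t i\<bar>"] by (simp add: T_def)
  obtain B where B: "0 < B" "\<And>s. \<bar>s\<bar> \<le> T \<Longrightarrow> slope s \<le> B" by (rule slope_bounded[of T]) (rule that)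
  \<comment> \<open>The contributions of the two regions to the final bound are \<open>\<tau>\<close> and \<open>2 B \<kappa>\<close>, half of \<open>\<mu> c\<^sub>0\<close> each.\<close>
  define \<tau> where "\<tau> = \<mu> * c\<^sub>0 / 2"
  define \<kappa> where "\<kappa> = \<mu> * c\<^sub>0 / (2 * (2 * B))"
  have \<tau>: "0 < \<tau>" and \<kappa>: "0 < \<kappa>" using \<mu> c\<^sub>0 B(1) by (auto simp: \<tau>_def \<kappa>_def)
  have sum: "\<tau> + 2 * B * \<kappa> = \<mu> * c\<^sub>0" using B(1) by (simp add: \<tau>_def \<kappa>_def field_simps)
  obtain \<epsilon>1 where \<epsilon>1: "0 < \<epsilon>1"
    "\<And>S y g. S \<in> sets borel \<Longrightarrow> S \<subseteq> \<Omega> \<Longrightarrow> measure lebesgue S \<le> \<epsilon>1 \<Longrightarrow> H10_gradient \<Omega> y g \<Longrightarrow>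
      (norm_L2 \<Omega> (\<lambda>x. indicator S x * y x))\<^sup>2 \<le> \<kappa>\<^sup>2 * ((norm_L2 \<Omega> y)\<^sup>2 + (norm_L2 \<Omega> g)\<^sup>2)"
    by (rule small_set_estimate[OF open_domain finite_domain \<kappa>]) (rule that)
  \<comment> \<open>Each level set gets a share \<open>\<epsilon>2\<close> of the admissible measure. Requiring \<open>\<epsilon>2 / 2\<close> leaves room for a
    neighbourhood of the level set.\<close>
  define \<epsilon>2 where "\<epsilon>2 = \<epsilon>1 / real (k + 1)"
  have \<epsilon>2: "0 < \<epsilon>2" using \<epsilon>1(1) by (simp add: \<epsilon>2_def)
  show ?thesis
  proof (rule exI[of _ "\<epsilon>2 / 2"], intro conjI ballI impI)
    show "0 < \<epsilon>2 / 2" using \<epsilon>2 by simp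
    fix u\<^sub>d assume ud: "u\<^sub>d \<in> L2 \<Omega>"
      and level: "\<forall>i \<in> {1..k}. measure lebesgue {x \<in> \<Omega>. F u\<^sub>d x = t i} \<le> \<epsilon>2 / 2"
    have cont: "continuous_on \<Omega> (F u)" if "u \<in> L2 \<Omega>" for u
      by (rule continuous_on_subset[OF F_continuous[OF that] closure_subset])
    have "\<forall>i\<in>{1..k}. \<exists>r. 0 < r \<and> measure lebesgue {x \<in> \<Omega>. \<bar>F u\<^sub>d x - t i\<bar> \<le> r} \<le> \<epsilon>2"
    proof
      fix i assume "i \<in> {1..k}"
      with level \<epsilon>2 have "measure lebesgue {x \<in> \<Omega>. F u\<^sub>d x = t i} < \<epsilon>2" by fastforce
      then show "\<exists>r. 0 < r \<and> measure lebesgue {x \<in> \<Omega>. \<bar>F u\<^sub>d x - t i\<bar> \<le> r} \<le> \<epsilon>2"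
        by (rule measure_near_level_set[OF open_domain finite_domain cont[OF ud]]) blast
    qed
    from bchoice[OF this] obtain r where
      "\<forall>i\<in>{1..k}. 0 < r i \<and> measure lebesgue {x \<in> \<Omega>. \<bar>F u\<^sub>d x - t i\<bar> \<le> r i} \<le> \<epsilon>2" ..
    then have r: "\<And>i. i \<in> {1..k} \<Longrightarrow> 0 < r i"
      "\<And>i. i \<in> {1..k} \<Longrightarrow> measure lebesgue {x \<in> \<Omega>. \<bar>F u\<^sub>d x - t i\<bar> \<le> r i} \<le> \<epsilon>2"
      by blast+
    obtain R where R: "0 \<le> R" "\<And>x. x \<in> \<Omega> \<Longrightarrow> \<bar>F u\<^sub>d x\<bar> \<le> R" by (rule F_bounded[OF ud]) (rule that)
    obtain \<delta>1 where \<delta>1: "0 < \<delta>1"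
      "\<And>r r' \<rho>. \<bar>r\<bar> \<le> R + 1 \<Longrightarrow> \<bar>r'\<bar> \<le> R + 1 \<Longrightarrow> \<bar>r' - r\<bar> \<le> \<rho> \<Longrightarrow> \<rho> \<le> \<delta>1 \<Longrightarrow>
        \<forall>i\<in>{1..k}. \<rho> < \<bar>r - t i\<bar> \<Longrightarrow> \<bar>f r' - f r - slope r * (r' - r)\<bar> \<le> \<tau> * \<bar>r' - r\<bar>"
      by (rule linearisation_error_away_from_knots[OF \<tau>, of "R + 1"]) (rule that)
    \<comment> \<open>The bound \<open>1 / 2\<close> keeps both states within distance 1 of a knot, hence in \<open>[-T, T]\<close>, on the set
      where the first state is within \<open>\<delta>\<close> of that knot.\<close>
    define \<delta> where "\<delta> = Min (insert \<delta>1 (insert (1/2) ((\<lambda>i. r i / 2) ` {1..k})))"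
    have \<delta>: "0 < \<delta>" unfolding \<delta>_def using \<delta>1(1) r(1) by (subst Min_gr_iff) auto
    have \<delta>le: "\<delta> \<le> \<delta>1" "\<delta> \<le> 1 / 2" unfolding \<delta>_def by (rule Min_le; simp)+
    have \<delta>r: "2 * \<delta> \<le> r i" if "i \<in> {1..k}" for i
    proof -
      have "\<delta> \<le> r i / 2" unfolding \<delta>_def using that by (intro Min_le) auto
      then show ?thesis by simp
    qed
    obtain \<rho> where \<rho>: "0 < \<rho>"
      "\<And>u x. u \<in> cball_L2 \<Omega> u\<^sub>d \<rho> \<Longrightarrow> x \<in> \<Omega> \<Longrightarrow> \<bar>F u x - F u\<^sub>d x\<bar> \<le> \<delta> / 2"
      by (rule F_uniformly_continuous_at[OF ud, of "\<delta> / 2"]) (use \<delta> in simp, rule that)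
    show "\<exists>\<rho>>0. \<forall>u \<in> cball_L2 \<Omega> u\<^sub>d \<rho>. \<forall>u' \<in> cball_L2 \<Omega> u\<^sub>d \<rho>.
        norm_L2 \<Omega> (\<lambda>x. F u' x - F u x - G u (\<lambda>x. u' x - u x) x) \<le> \<mu> * norm_L2 \<Omega> (\<lambda>x. F u' x - F u x)"
    proof (intro exI[of _ \<rho>] conjI ballI \<rho>(1))
      fix u u' assume ub: "u \<in> cball_L2 \<Omega> u\<^sub>d \<rho>" and ub': "u' \<in> cball_L2 \<Omega> u\<^sub>d \<rho>"
      have u: "u \<in> L2 \<Omega>" and u': "u' \<in> L2 \<Omega>" using ub ub' by (auto simp: cball_L2_def)
      define S where "S = (\<Union>i\<in>{1..k}. {x \<in> \<Omega>. \<bar>F u x - t i\<bar> \<le> \<delta>})"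
      have S: "S \<in> sets borel"
        unfolding S_def by (intro sets.finite_UN closed_level_set_borel open_domain cont u) auto
      have S\<Omega>: "S \<subseteq> \<Omega>" by (auto simp: S_def)
      let ?D = "\<lambda>i. {x \<in> \<Omega>. \<bar>F u\<^sub>d x - t i\<bar> \<le> r i}"
      have Db: "?D i \<in> sets borel" for i
        by (rule closed_level_set_borel[OF open_domain cont[OF ud]])
      have Dl: "?D i \<in> lmeasurable" for i
        by (rule fmeasurableI2[OF finite_domain]) (use Db[of i] in auto)
      have "measure lebesgue S \<le> measure lebesgue (\<Union>i\<in>{1..k}. ?D i)"
      proof (rule measure_mono_fmeasurable)
        show "S \<subseteq> (\<Union>i\<in>{1..k}. ?D i)"
        proof
          fix x assume "x \<in> S"
          then obtain i where i: "i \<in> {1..k}" "x \<in> \<Omega>" "\<bar>F u x - t i\<bar> \<le> \<delta>" by (auto simp: S_def)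
          then have "\<bar>F u\<^sub>d x - t i\<bar> \<le> r i" using \<rho>(2)[OF ub i(2)] \<delta>r[OF i(1)] \<delta> by linarith
          with i show "x \<in> (\<Union>i\<in>{1..k}. ?D i)" by blast
        qed
        show "S \<in> sets lebesgue" using S by simp
        show "(\<Union>i\<in>{1..k}. ?D i) \<in> lmeasurable" using Dl by (intro fmeasurable.finite_UN) auto
      qed
      also have "\<dots> \<le> (\<Sum>i\<in>{1..k}. measure lebesgue (?D i))"
        by (rule measure_UNION_le) (use Dl in auto)
      also have "\<dots> \<le> (\<Sum>i\<in>{1..k}. \<epsilon>2)" by (rule sum_mono[OF r(2)])
      also have "\<dots> \<le> \<epsilon>1" using \<epsilon>1(1) by (simp add: \<epsilon>2_def field_simps)
      finally have small: "measure lebesgue S \<le> \<epsilon>1" .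
      have near: "\<bar>F u' x - F u x\<bar> \<le> \<delta>" "\<bar>F u x\<bar> \<le> R + 1" "\<bar>F u' x\<bar> \<le> R + 1" if "x \<in> \<Omega>" for x
        using \<rho>(2)[OF ub that] \<rho>(2)[OF ub' that] R(2)[OF that] \<delta>le(2) \<delta> by linarith+
      have "c\<^sub>0 * norm_L2 \<Omega> (\<lambda>x. F u' x - F u x - G u (\<lambda>x. u' x - u x) x)
          \<le> (\<tau> + 2 * B * \<kappa>) * norm_L2 \<Omega> (\<lambda>x. F u' x - F u x)"
      proof (rule defect_estimate[OF u u' S _ _ _ _ _ \<epsilon>1(2)[OF S S\<Omega> small]])
        fix x assume x: "x \<in> \<Omega>"
        show "\<bar>f (F u' x) - f (F u x) - slope (F u x) * (F u' x - F u x)\<bar> \<le> \<tau> * \<bar>F u' x - F u x\<bar>" if "x \<notin> S"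
        proof (rule \<delta>1(2)[OF near(2,3)[OF x] near(1)[OF x] \<delta>le(1)])
          show "\<forall>i\<in>{1..k}. \<delta> < \<bar>F u x - t i\<bar>"
            using \<open>x \<notin> S\<close> x by (force simp: S_def)
        qed
        show "\<bar>f (F u' x) - f (F u x) - slope (F u x) * (F u' x - F u x)\<bar> \<le> 2 * B * \<bar>F u' x - F u x\<bar>" if xS: "x \<in> S"
        proof (rule linearisation_error_le[OF B(2)])
          obtain i where i: "i \<in> {1..k}" "\<bar>F u x - t i\<bar> \<le> \<delta>" using xS by (auto simp: S_def)
          show "\<bar>F u x\<bar> \<le> T" "\<bar>F u' x\<bar> \<le> T" using i(2) T[OF i(1)] near(1)[OF x] \<delta>le(2) by linarith+
        qed
      qed (use \<tau> \<kappa> B(1) in auto)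
      also have "\<dots> = c\<^sub>0 * (\<mu> * norm_L2 \<Omega> (\<lambda>x. F u' x - F u x))" unfolding sum by (simp add: mult_ac)
      finally show "norm_L2 \<Omega> (\<lambda>x. F u' x - F u x - G u (\<lambda>x. u' x - u x) x) \<le> \<mu> * norm_L2 \<Omega> (\<lambda>x. F u' x - F u x)"
        using c\<^sub>0 by simp
    qed
  qed
qed

end

theorem corollaryA6:
  fixes \<Omega> :: "(real^'n) set"
    and A :: "(real^'n \<Rightarrow> real) \<Rightarrow> (real^'n \<Rightarrow> real) \<Rightarrow> real"
    and c\<^sub>0 c\<^sub>1 :: real
    and f :: "real \<Rightarrow> real"
    and k :: nat
    and t :: "nat \<Rightarrow> real"
    and fs :: "nat \<Rightarrow> real \<Rightarrow> real"
    and F :: "(real^'n \<Rightarrow> real) \<Rightarrow> real^'n \<Rightarrow> real"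
    and G :: "(real^'n \<Rightarrow> real) \<Rightarrow> (real^'n \<Rightarrow> real) \<Rightarrow> real^'n \<Rightarrow> real"
    and \<mu> :: real
  assumes "CARD('n) \<le> 3"
    and "bounded_lipschitz_domain \<Omega>"
    and "elliptic_operator \<Omega> A"
    and "0 < c\<^sub>0" and "c\<^sub>0 \<le> c\<^sub>1"
    and "\<And>y. y \<in> H10 \<Omega> \<Longrightarrow> c\<^sub>0 * (norm_H1 \<Omega> y)\<^sup>2 \<le> A y y \<and> A y y \<le> c\<^sub>1 * (norm_H1 \<Omega> y)\<^sup>2"
    and "PC1 f"
    and "strict_mono_on {1..k} t"
    and "{s. \<not> f differentiable (at s)} = t ` {1..k}"
    and "\<And>s. f s = (\<Sum>i=1..k+1. indicator (piece k t i) s * fs i s)"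
    and "\<And>i. i \<in> {1..k+1} \<Longrightarrow> fs i C1_differentiable_on UNIV"
    and "\<And>i. i \<in> {1..k+1} \<Longrightarrow> mono_on (open_piece k t i) (fs i)"
    and "\<And>i. i \<in> {1..k} \<Longrightarrow> fs i (t i) = fs (i + 1) (t i)"
    and "\<And>u. u \<in> L2 \<Omega> \<Longrightarrow> semilinear_solution \<Omega> A f u (F u)"
    and "\<And>u w. u \<in> L2 \<Omega> \<Longrightarrow> w \<in> L2 \<Omega> \<Longrightarrow>
           linear_solution \<Omega> A (slope_coeff k t fs (F u)) w (G u w)"
    and "0 < \<mu>"
  shows "\<exists>\<epsilon>>0. \<forall>u\<^sub>d \<in> L2 \<Omega>.
           (\<forall>i \<in> {1..k}. measure lebesgue {x \<in> \<Omega>. F u\<^sub>d x = t i} \<le> \<epsilon>) \<longrightarrow>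
           (\<exists>\<rho>>0. \<forall>u \<in> cball_L2 \<Omega> u\<^sub>d \<rho>. \<forall>u' \<in> cball_L2 \<Omega> u\<^sub>d \<rho>.
              norm_L2 \<Omega> (\<lambda>x. F u' x - F u x - G u (\<lambda>x. u' x - u x) x)
                \<le> \<mu> * norm_L2 \<Omega> (\<lambda>x. F u' x - F u x))"
proof -
  have domain: "open \<Omega>" "bounded \<Omega>" using assms(2) by (auto simp: bounded_lipschitz_domain_def)
  then have "\<Omega> \<in> lmeasurable" by (simp add: lmeasurable_open)
  interpret semilinear_problem \<Omega> A c\<^sub>0 k t fs f F G
  proof
    show "continuous_on UNIV f" using assms(7) by (simp add: PC1_def)
  qed (use assms domain \<open>\<Omega> \<in> lmeasurable\<close> in auto)
  show ?thesis by (rule linearisation_estimate[OF assms(16)])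
qed

end
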